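(* Let $B_n(x)=B_n(x;\rho_1,\rho_2,r_1,r_2)$ and $I_n(x)=I_n(x;\rho_1,\rho_2,r_1,r_2)$ be the monic Bannai--Ito polynomials and the complementary Bannai--Ito (CBI) polynomials with parameters $\rho_1,\rho_2,r_1,r_2$, as defined in the context. (a) The CBI polynomials $I_n(x)$ are the kernel polynomials of the Bannai--Ito polynomials $B_n(x)$ with kernel parameter $\rho_1$, i.e. $$I_n(x)=(x-\rho_1)^{-1}\left[B_{n+1}(x)-\frac{B_{n+1}(\rho_1)}{B_n(\rho_1)}B_n(x)\right].$$ (b) The monic CBI polynomials obey the three-term recurrence relation $$I_{n+1}(x)+(-1)^n\rho_2 I_n(x)+\tau_n I_{n-1}(x)=xI_n(x),$$ where $$\tau_{2n}=-\frac{n(n+\rho_1-r_1+\tfrac12)(n+\rho_1-r_2+\tfrac12)(n-r_1-r_2)}{(2n+g)(2n+g+1)},$$ $$\tau_{2n+1}=-\frac{(n+g+1)(n+\rho_1+\rho_2+1)(n+\rho_2-r_1+\tfrac12)(n+\rho_2-r_2+\tfrac12)}{(2n+g+1)(2n+g+2)}.$$ (c) They have the explicit hypergeometric representation $I_{2n}(x)=R_n(x^2)$, $I_{2n+1}(x)=(x-\rho_2)Q_n(x^2)$, where $$R_n(x^2)=\eta_n\;{}_4F_3\!\left[\begin{matrix}-n,\;n+g+1,\;\rho_2+x,\;\rho_2-x\\ \rho_1+\rho_2+1,\;\rho_2-r_1+\tfrac12,\;\rho_2-r_2+\tfrac12\end{matrix};1\right],$$ $$Q_n(x^2)=\iota_n\;{}_4F_3\!\left[\begin{matrix}-n,\;n+g+2,\;\rho_2+1+x,\;\rho_2+1-x\\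 \rho_1+\rho_2+2,\;\rho_2-r_1+\tfrac32,\;\rho_2-r_2+\tfrac32\end{matrix};1\right],$$ $$\eta_n=\frac{(\rho_1+\rho_2+1)_n(\rho_2-r_1+\frac12)_n(\rho_2-r_2+\frac12)_n}{(n+g+1)_n},\qquad \iota_n=\frac{(\rho_1+\rho_2+2)_n(\rho_2-r_1+\frac32)_n(\rho_2-r_2+\frac32)_n}{(n+g+2)_n}.$$ (d) If the truncation condition $\tau_{N+1}=0$ and the positivity condition $\tau_n>0$, $n\in\{1,\dots,N\}$, are satisfied, the CBI polynomials $I_0(x),\dots,I_N(x)$ obey the orthogonality relation $$\sum_{k=0}^{N}\widetilde w_k\, I_n(x_k)I_m(x_k)=\widetilde h_n\,\delta_{nm}$$ with respect to the positive weights $\widetilde w_k$, where $\widetilde h_n$ is a normalization factor. The grid points $x_k$ correspond to the simple roots of the polynomial $I_{N+1}(x)$. The formulas for the weights and grid points depend on the truncation condition. With $$w_k(\rho_1,\rho_2,r_1,r_2)=\frac{(-1)^\nu}{\ell!}\,\frac{(\rho_1-r_1+\frac12)_{\ell+\nu}(\rho_1-r_2+\frac12)_{\ell+\nu}(\rho_1+\rho_2+1)_\ell(2\rho_1+1)_\ell}{(\rho_1+r_1+\frac12)_{\ell+\nu}(\rho_1+r_2+\frac12)_{\ell+\nu}(\rho_1-\rho_2+1)_\ell},\qquad k=2\ell+\nu,\ \nu\in\{0,1\},$$ one has: 1. For $r_1=\frac{N+1}{2}+\rho_2$, $r_2=\frac{N+1}{2}+\rho_2$ or $\rho_1=-\frac{N+2}{2}-\rho_2$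 with $N$ even: $$x_k=(-1)^k(\rho_2+k/2+1/4)-1/4,\qquad \widetilde w_k=(x_k-\rho_1)\,w_k(\rho_2,\rho_1,r_1,r_2).$$ 2. For $r_1=\frac{N+2}{2}+\rho_1$ or $r_1=\frac{N+1}{2}-r_2$ with $N$ odd: $$x_k=(-1)^k(r_1-k/2-1/4)-1/4,\qquad \widetilde w_k=(x_k-\rho_1)\,w_k(-r_1,-r_2,-\rho_1,-\rho_2).$$ 3. For $r_2=\frac{N+2}{2}+\rho_1$ with $N$ odd: $$x_k=(-1)^k(r_2-k/2-1/4)-1/4,\qquad \widetilde w_k=(x_k-\rho_1)\,w_k(-r_2,-r_1,-\rho_1,-\rho_2).$$
   Context: Notation: $(a)_n=a(a+1)\cdots(a+n-1)$ is the Pochhammer symbol, ${}_4F_3$ is the generalized hypergeometric function, and $g=\rho_1+\rho_2-r_1-r_2$. The notation $w_k(a,b,c,d)$ means the function $w_k$ with $\rho_1,\rho_2,r_1,r_2$ replaced by $a,b,c,d$ respectively. Formulas are understood for parameter values for which they are defined. The monic Bannai--Ito polynomials $B_n(x)=B_n(x;\rho_1,\rho_2,r_1,r_2)$ are defined by $B_{-1}(x)=0$, $B_0(x)=1$ and $$B_{n+1}(x)+(\rho_1-A_n-C_n)B_n(x)+A_{n-1}C_nB_{n-1}(x)=xB_n(x),$$ with $$A_n=\begin{cases}\dfrac{(n+2\rho_1-2r_1+1)(n+2\rho_1-2r_2+1)}{4(n+g+1)},& n\text{ even},\\[2mm] \dfrac{(n+2g+1)(n+2\rho_1+2\rho_2+1)}{4(n+g+1)},&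 n\text{ odd},\end{cases}$$ $$C_n=\begin{cases}-\dfrac{n(n-2r_1-2r_2)}{4(n+g)},& n\text{ even},\\[2mm] -\dfrac{(n+2\rho_2-2r_2)(n+2\rho_2-2r_1)}{4(n+g)},& n\text{ odd}.\end{cases}$$ The complementary Bannai--Ito polynomials $I_n(x)$ are the monic polynomials of degree $n$ in $x$ defined by $$I_n(x)=\frac{B_{n+1}(x)-A_nB_n(x)}{x-\rho_1}.$$ The recurrence relation for $I_n$ has the initial conditions $I_0=1$ and $I_1=x-\rho_2$.
   Formalization: In (d) the explicit weights (x_k−ρ1)w_k are claimed positive only after multiplication by the sign of x_0−ρ1 (likewise h_n), assuming x_0≠ρ1 and nonzero denominators in w_k for k≤N; as stated, all weights are negative when x_0<ρ1 and the zeroth weight vanishes when x_0=ρ1. *)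

theory Defs
  imports "HOL-Analysis.Analysis" "HOL-Computational_Algebra.Computational_Algebra"
begin

definition bi_g :: "'a::field_char_0 \<Rightarrow> 'a \<Rightarrow> 'a \<Rightarrow> 'a \<Rightarrow> 'a" where
  "bi_g \<rho>1 \<rho>2 r1 r2 = \<rho>1 + \<rho>2 - r1 - r2"

definition bi_A :: "'a::field_char_0 \<Rightarrow> 'a \<Rightarrow> 'a \<Rightarrow> 'a \<Rightarrow> nat \<Rightarrow> 'a" where
  "bi_A \<rho>1 \<rho>2 r1 r2 n =
    (if even n
     then (of_nat n + 2*\<rho>1 - 2*r1 + 1) * (of_nat n + 2*\<rho>1 - 2*r2 + 1)
            / (4 * (of_nat n + bi_g \<rho>1 \<rho>2 r1 r2 + 1))
     else (of_nat n + 2 * bi_g \<rho>1 \<rho>2 r1 r2 + 1) * (of_nat n + 2*\<rho>1 + 2*\<rho>2 + 1)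
            / (4 * (of_nat n + bi_g \<rho>1 \<rho>2 r1 r2 + 1)))"

text \<open>For \<open>n = 0\<close> the numerator vanishes, so \<open>bi_C \<dots> 0 = 0\<close> also when \<open>g = 0\<close>.\<close>

definition bi_C :: "'a::field_char_0 \<Rightarrow> 'a \<Rightarrow> 'a \<Rightarrow> 'a \<Rightarrow> nat \<Rightarrow> 'a" where
  "bi_C \<rho>1 \<rho>2 r1 r2 n =
    (if even n
     then - (of_nat n * (of_nat n - 2*r1 - 2*r2) / (4 * (of_nat n + bi_g \<rho>1 \<rho>2 r1 r2)))
     else - ((of_nat n + 2*\<rho>2 - 2*r2) * (of_nat n + 2*\<rho>2 - 2*r1)
            / (4 * (of_nat n + bi_g \<rho>1 \<rho>2 r1 r2))))"

text \<open>The three-term recurrence solved for \<open>B\<^sub>n\<^sub>+\<^sub>1\<close>; the second equation is the case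
  \<open>n = 0\<close>, where \<open>B\<^sub>-\<^sub>1 = 0\<close>.\<close>

fun BI :: "'a::field_char_0 \<Rightarrow> 'a \<Rightarrow> 'a \<Rightarrow> 'a \<Rightarrow> nat \<Rightarrow> 'a poly" where
  "BI \<rho>1 \<rho>2 r1 r2 0 = 1"
| "BI \<rho>1 \<rho>2 r1 r2 (Suc 0) =
     [:0, 1:] - [:\<rho>1 - bi_A \<rho>1 \<rho>2 r1 r2 0 - bi_C \<rho>1 \<rho>2 r1 r2 0:]"
| "BI \<rho>1 \<rho>2 r1 r2 (Suc (Suc n)) =
     [:0, 1:] * BI \<rho>1 \<rho>2 r1 r2 (Suc n)
     - smult (\<rho>1 - bi_A \<rho>1 \<rho>2 r1 r2 (Suc n) - bi_C \<rho>1 \<rho>2 r1 r2 (Suc n))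
         (BI \<rho>1 \<rho>2 r1 r2 (Suc n))
     - smult (bi_A \<rho>1 \<rho>2 r1 r2 n * bi_C \<rho>1 \<rho>2 r1 r2 (Suc n)) (BI \<rho>1 \<rho>2 r1 r2 n)"

text \<open>The polynomial quotient below is exact, see \<open>CBI_exact\<close> and \<open>CBI_monic\<close>.\<close>

definition CBI :: "'a::field_char_0 \<Rightarrow> 'a \<Rightarrow> 'a \<Rightarrow> 'a \<Rightarrow> nat \<Rightarrow> 'a poly" where
  "CBI \<rho>1 \<rho>2 r1 r2 n =
     (BI \<rho>1 \<rho>2 r1 r2 (Suc n) - smult (bi_A \<rho>1 \<rho>2 r1 r2 n) (BI \<rho>1 \<rho>2 r1 r2 n))
       div [:- \<rho>1, 1:]"

text \<open>The denominators \<open>j + g + 1\<close> of \<open>A\<^sub>0, \<dots>, A\<^sub>n\<^sub>-\<^sub>1\<close> and \<open>j + g\<close> of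
  \<open>C\<^sub>1, \<dots>, C\<^sub>n\<close> are non-zero. Thus \<open>bi_regular (n + 1)\<close> says that all
  coefficients occurring in the definition of \<open>I\<^sub>n\<close> are defined.\<close>

definition bi_regular :: "'a::field_char_0 \<Rightarrow> 'a \<Rightarrow> 'a \<Rightarrow> 'a \<Rightarrow> nat \<Rightarrow> bool" where
  "bi_regular \<rho>1 \<rho>2 r1 r2 n \<longleftrightarrow> (\<forall>j\<in>{1..n}. of_nat j + bi_g \<rho>1 \<rho>2 r1 r2 \<noteq> 0)"

lemma BI_degree_lead:
  "degree (BI \<rho>1 \<rho>2 r1 r2 n) = n \<and> coeff (BI \<rho>1 \<rho>2 r1 r2 n) n = 1"
proof (induction n rule: less_induct)
  case (less n)
  consider "n = 0" | "n = Suc 0" | m where "n = Suc (Suc m)"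
    by (metis not0_implies_Suc)
  then show ?case
  proof cases
    case 3
    let ?B = "BI \<rho>1 \<rho>2 r1 r2"
    have m1: "degree (?B (Suc m)) = Suc m" "coeff (?B (Suc m)) (Suc m) = 1"
      and m0: "degree (?B m) = m"
      using less 3 by auto
    have "coeff (?B n) k = (if k = n then 1 else 0)" if "k \<ge> n" for k
    proof (cases k)
      case (Suc k')
      have "coeff (?B (Suc m)) k = 0" "coeff (?B m) k = 0"
        by (rule coeff_eq_0; use m1 m0 that 3 in simp)+
      moreover have "coeff (?B (Suc m)) k' = (if k = n then 1 else 0)"
      proof (cases "k = n")
        case False
        then have "coeff (?B (Suc m)) k' = 0"
          by (intro coeff_eq_0) (use m1 that 3 Suc in simp)
        then show ?thesis using False by simp
      qed (use m1 3 Suc in simp)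
      ultimately show ?thesis using 3 Suc by (simp add: coeff_pCons)
    qed (use that 3 in simp)
    then have "coeff (?B n) n = 1" "\<forall>k>n. coeff (?B n) k = 0" by auto
    then show ?thesis
      by (metis degree_le le_antisym le_degree one_neq_zero)
  qed simp_all
qed

lemma BI_at_rho1:
  "poly (BI \<rho>1 \<rho>2 r1 r2 (Suc n)) \<rho>1 = bi_A \<rho>1 \<rho>2 r1 r2 n * poly (BI \<rho>1 \<rho>2 r1 r2 n) \<rho>1"
  by (induction n) (simp_all add: bi_C_def[of _ _ _ _ 0] algebra_simps)

lemma CBI_exact:
  "[:- \<rho>1, 1:] * CBI \<rho>1 \<rho>2 r1 r2 n =
     BI \<rho>1 \<rho>2 r1 r2 (Suc n) - smult (bi_A \<rho>1 \<rho>2 r1 r2 n) (BI \<rho>1 \<rho>2 r1 r2 n)"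
proof -
  have "[:- \<rho>1, 1:] dvd
     BI \<rho>1 \<rho>2 r1 r2 (Suc n) - smult (bi_A \<rho>1 \<rho>2 r1 r2 n) (BI \<rho>1 \<rho>2 r1 r2 n)"
    by (simp add: poly_eq_0_iff_dvd[symmetric] BI_at_rho1 del: BI.simps)
  then show ?thesis
    unfolding CBI_def by (rule dvd_mult_div_cancel)
qed

lemma CBI_monic:
  "degree (CBI \<rho>1 \<rho>2 r1 r2 n) = n \<and> lead_coeff (CBI \<rho>1 \<rho>2 r1 r2 n) = 1"
proof -
  let ?p = "BI \<rho>1 \<rho>2 r1 r2 (Suc n) - smult (bi_A \<rho>1 \<rho>2 r1 r2 n) (BI \<rho>1 \<rho>2 r1 r2 n)"
  let ?I = "CBI \<rho>1 \<rho>2 r1 r2 n"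
  have c: "coeff ?p k = (if k = Suc n then 1 else 0)" if "k \<ge> Suc n" for k
    using that BI_degree_lead[of \<rho>1 \<rho>2 r1 r2 n] BI_degree_lead[of \<rho>1 \<rho>2 r1 r2 "Suc n"]
    by (auto simp: coeff_eq_0 simp del: BI.simps)
  then have "coeff ?p (Suc n) = 1" "\<forall>k>Suc n. coeff ?p k = 0" by auto
  then have p: "degree ?p = Suc n" "lead_coeff ?p = 1"
    by (metis degree_le le_antisym le_degree one_neq_zero)+
  have nz: "?I \<noteq> 0"
    using p CBI_exact[of \<rho>1 \<rho>2 r1 r2 n] by (metis degree_0 mult_zero_right nat.distinct(1))
  have "degree ([:- \<rho>1, 1:] * ?I) = Suc (degree ?I)"
    using nz by (subst degree_mult_eq) auto
  moreover have "lead_coeff ([:- \<rho>1, 1:] * ?I) = lead_coeff ?I"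
    by (subst lead_coeff_mult) simp
  ultimately show ?thesis
    using p CBI_exact[of \<rho>1 \<rho>2 r1 r2 n] by (metis nat.inject)
qed

definition cbi_tau :: "'a::field_char_0 \<Rightarrow> 'a \<Rightarrow> 'a \<Rightarrow> 'a \<Rightarrow> nat \<Rightarrow> 'a" where
  "cbi_tau \<rho>1 \<rho>2 r1 r2 k =
    (let n = of_nat (k div 2); g = bi_g \<rho>1 \<rho>2 r1 r2 in
     if even k
     then - (n * (n + \<rho>1 - r1 + 1/2) * (n + \<rho>1 - r2 + 1/2) * (n - r1 - r2)
             / ((2*n + g) * (2*n + g + 1)))
     else - ((n + g + 1) * (n + \<rho>1 + \<rho>2 + 1) * (n + \<rho>2 - r1 + 1/2) * (n + \<rho>2 - r2 + 1/2)
             / ((2*n + g + 1) * (2*n + g + 2))))"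

definition hypergeo :: "'a::{real_normed_field,banach} list \<Rightarrow> 'a list \<Rightarrow> 'a \<Rightarrow> 'a" where
  "hypergeo as bs z = eval_fps (fps_hypergeo as bs 1) z"

definition cbi_eta :: "'a::field_char_0 \<Rightarrow> 'a \<Rightarrow> 'a \<Rightarrow> 'a \<Rightarrow> nat \<Rightarrow> 'a" where
  "cbi_eta \<rho>1 \<rho>2 r1 r2 n =
     pochhammer (\<rho>1 + \<rho>2 + 1) n * pochhammer (\<rho>2 - r1 + 1/2) n * pochhammer (\<rho>2 - r2 + 1/2) n
       / pochhammer (of_nat n + bi_g \<rho>1 \<rho>2 r1 r2 + 1) n"

definition cbi_iota :: "'a::field_char_0 \<Rightarrow> 'a \<Rightarrow> 'a \<Rightarrow> 'a \<Rightarrow> nat \<Rightarrow> 'a" where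
  "cbi_iota \<rho>1 \<rho>2 r1 r2 n =
     pochhammer (\<rho>1 + \<rho>2 + 2) n * pochhammer (\<rho>2 - r1 + 3/2) n * pochhammer (\<rho>2 - r2 + 3/2) n
       / pochhammer (of_nat n + bi_g \<rho>1 \<rho>2 r1 r2 + 2) n"

definition bi_weight_denom :: "nat \<Rightarrow> real \<Rightarrow> real \<Rightarrow> real \<Rightarrow> real \<Rightarrow> real" where
  "bi_weight_denom k \<rho>1 \<rho>2 r1 r2 =
    (let l = k div 2; \<nu> = k mod 2 in
     pochhammer (\<rho>1 + r1 + 1/2) (l + \<nu>) * pochhammer (\<rho>1 + r2 + 1/2) (l + \<nu>)
       * pochhammer (\<rho>1 - \<rho>2 + 1) l)"

definition bi_weight :: "nat \<Rightarrow> real \<Rightarrow> real \<Rightarrow> real \<Rightarrow> real \<Rightarrow> real" where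
  "bi_weight k \<rho>1 \<rho>2 r1 r2 =
    (let l = k div 2; \<nu> = k mod 2 in
     (-1) ^ \<nu> / fact l
       * (pochhammer (\<rho>1 - r1 + 1/2) (l + \<nu>) * pochhammer (\<rho>1 - r2 + 1/2) (l + \<nu>)
          * pochhammer (\<rho>1 + \<rho>2 + 1) l * pochhammer (2*\<rho>1 + 1) l)
       / bi_weight_denom k \<rho>1 \<rho>2 r1 r2)"

definition simple_root_grid :: "real poly \<Rightarrow> nat \<Rightarrow> (nat \<Rightarrow> real) \<Rightarrow> bool" where
  "simple_root_grid p N x \<longleftrightarrow>
     inj_on x {..N} \<and> {z. poly p z = 0} = x ` {..N} \<and> (\<forall>k\<le>N. order (x k) p = 1)"

definition discrete_orthogonal ::
  "(nat \<Rightarrow> real poly) \<Rightarrow> nat \<Rightarrow> (nat \<Rightarrow> real) \<Rightarrow> (nat \<Rightarrow> real) \<Rightarrow> (nat \<Rightarrow> real) \<Rightarrow> bool" where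
  "discrete_orthogonal P N x w h \<longleftrightarrow>
     (\<forall>n\<le>N. \<forall>m\<le>N. (\<Sum>k=0..N. w k * poly (P n) (x k) * poly (P m) (x k))
                      = (if n = m then h n else 0))"

text \<open>An explicitly given grid \<open>x\<close> and weight \<open>w\<close> for \<open>I\<^sub>0, \<dots>, I\<^sub>N\<close>. The weights
  \<open>(x\<^sub>k - \<rho>\<^sub>1) w\<^sub>k\<close> are fixed only up to normalization, and \<open>w\<^sub>0 = 1\<close>, so their common
  sign is that of \<open>x\<^sub>0 - \<rho>\<^sub>1\<close>: they are positive as they stand if \<open>\<rho>\<^sub>1 < x\<^sub>0\<close>, and positive
  after a global change of sign if \<open>x\<^sub>0 < \<rho>\<^sub>1\<close>. For \<open>x\<^sub>0 = \<rho>\<^sub>1\<close> the zeroth weight vanishes.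
  \<open>d\<close> collects the denominators of \<open>w\<close>.\<close>

definition cbi_explicit_orthogonality ::
  "real \<Rightarrow> real \<Rightarrow> real \<Rightarrow> real \<Rightarrow> nat \<Rightarrow> (nat \<Rightarrow> real) \<Rightarrow> (nat \<Rightarrow> real) \<Rightarrow> (nat \<Rightarrow> real) \<Rightarrow> bool" where
  "cbi_explicit_orthogonality \<rho>1 \<rho>2 r1 r2 N x d w \<longleftrightarrow>
     simple_root_grid (CBI \<rho>1 \<rho>2 r1 r2 (N + 1)) N x \<and>
     ((\<forall>k\<le>N. d k \<noteq> 0) \<and> x 0 \<noteq> \<rho>1 \<longrightarrow>
       (\<forall>k\<le>N. sgn (x 0 - \<rho>1) * ((x k - \<rho>1) * w k) > 0) \<and>
       (\<exists>h. (\<forall>n\<le>N. sgn (x 0 - \<rho>1) * h n > 0) \<and>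
            discrete_orthogonal (CBI \<rho>1 \<rho>2 r1 r2) N x (\<lambda>k. (x k - \<rho>1) * w k) h))"

end

theory Submission
  imports Defs
begin

text \<open>
  From \<open>(x - \<rho>\<^sub>1) I\<^sub>n = B\<^sub>n\<^sub>+\<^sub>1 - A\<^sub>n B\<^sub>n\<close> and the recurrence of the \<open>B\<^sub>n\<close> one gets the two first-order
  relations \<open>B\<^sub>n\<^sub>+\<^sub>1 = (x - \<rho>\<^sub>1) I\<^sub>n + A\<^sub>n B\<^sub>n\<close> and \<open>I\<^sub>n = B\<^sub>n + C\<^sub>n I\<^sub>n\<^sub>-\<^sub>1\<close>. Eliminating the \<open>B\<^sub>n\<close> gives a
  three-term recurrence with coefficients \<open>\<rho>\<^sub>1 - A\<^sub>n - C\<^sub>n\<^sub>+\<^sub>1 = (-1)\<^sup>n \<rho>\<^sub>2\<close> and \<open>A\<^sub>n C\<^sub>n = \<tau>\<^sub>n\<close>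
  (lemma \<open>CBI_recurrence\<close>).

  Since the diagonal coefficient only alternates in sign, \<open>I\<^sub>2\<^sub>n = R\<^sub>n(x\<^sup>2)\<close> and
  \<open>I\<^sub>2\<^sub>n\<^sub>+\<^sub>1 = (x - \<rho>\<^sub>2) Q\<^sub>n(x\<^sup>2)\<close>, where \<open>Q\<^sub>n = R\<^sub>n - \<tau>\<^sub>2\<^sub>n Q\<^sub>n\<^sub>-\<^sub>1\<close> and
  \<open>R\<^sub>n\<^sub>+\<^sub>1 = (y - \<rho>\<^sub>2\<^sup>2) Q\<^sub>n - \<tau>\<^sub>2\<^sub>n\<^sub>+\<^sub>1 R\<^sub>n\<close>. These are contiguous relations between the monic Wilson
  polynomials \<open>R\<^sub>n\<close> with parameters \<open>(\<rho>\<^sub>2, \<rho>\<^sub>1 + 1, 1/2 - r\<^sub>1, 1/2 - r\<^sub>2)\<close> and the polynomials \<open>Q\<^sub>n\<close> in which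
  the first parameter is raised by one. Wilson polynomials are symmetric in their four parameters,
  but each expansion in a basis \<open>\<Prod>\<^sub>i (y - (e + i)\<^sup>2)\<close> singles out one of them. The contiguous
  relations are checked coefficientwise for two choices of \<open>e\<close>: the choice \<open>e = \<rho>\<^sub>2\<close> (and
  \<open>\<rho>\<^sub>2 + 1\<close> for \<open>Q\<^sub>n\<close>) yields the stated \<open>\<^sub>4F\<^sub>3\<close> series, the choice \<open>e = 1/2 - r\<^sub>1\<close> is adapted to the
  grids that start at \<open>r\<^sub>1\<close> (lemmas \<open>CBI_wilson_base_rho2\<close> and \<open>CBI_wilson_base_r1\<close>).

  If \<open>\<tau>\<^sub>1, \<dots>, \<tau>\<^sub>N\<close> are positive, the general theory of orthogonal polynomials applies: the zeros of
  \<open>I\<^sub>N\<^sub>+\<^sub>1\<close> are real and simple, \<open>I\<^sub>N I'\<^sub>N\<^sub>+\<^sub>1\<close> is positive at each of them, and weights \<open>w\<^sub>k\<close> make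
  \<open>I\<^sub>0, \<dots>, I\<^sub>N\<close> orthogonal as soon as \<open>w\<^sub>k I\<^sub>N(x\<^sub>k) I'\<^sub>N\<^sub>+\<^sub>1(x\<^sub>k)\<close> does not depend on \<open>k\<close>
  (lemma \<open>gauss_orthogonality\<close>). The sign of all weights is then the sign of \<open>w\<^sub>0\<close>.

  For the explicit grids this criterion is checked directly. The truncation condition says that two
  of the Wilson parameters add up to a nonpositive integer. In the expansion of \<open>I\<^sub>N\<^sub>+\<^sub>1\<close> this kills all
  terms but the last, which displays its zeros (lemma \<open>wilson_truncated\<close>). In the expansion of \<open>I\<^sub>N\<close>
  it cancels an upper against a lower parameter, and the remaining \<open>\<^sub>3F\<^sub>2\<close> is balanced and
  terminates at each grid point, so that Saalschuetz's theorem gives a product formula for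
  \<open>I\<^sub>N(x\<^sub>k)\<close> (lemma \<open>wilson_at_grid\<close>). Everything in \<open>w\<^sub>k I\<^sub>N(x\<^sub>k) I'\<^sub>N\<^sub>+\<^sub>1(x\<^sub>k)\<close> that depends on
  \<open>k\<close> cancels.
\<close>

section \<open>The recurrence of the kernel polynomials\<close>

text \<open>
  The kernel relation multiplied out and combined with the recurrence of the \<open>B\<^sub>n\<close>; the factor
  \<open>x - \<rho>\<^sub>1\<close> cancels. Together with the kernel relation itself this is a factorisation of the
  three-term recurrence into two first-order steps.
\<close>

lemma CBI_Suc_eq_BI_plus_CBI:
  "CBI \<rho>1 \<rho>2 r1 r2 (Suc n) =
     BI \<rho>1 \<rho>2 r1 r2 (Suc n) + smult (bi_C \<rho>1 \<rho>2 r1 r2 (Suc n)) (CBI \<rho>1 \<rho>2 r1 r2 n)"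
    (is "?I' = ?B' + smult ?C ?I")
proof -
  have exact: "(x - \<rho>1) * poly (CBI \<rho>1 \<rho>2 r1 r2 m) x =
      poly (BI \<rho>1 \<rho>2 r1 r2 (Suc m)) x - bi_A \<rho>1 \<rho>2 r1 r2 m * poly (BI \<rho>1 \<rho>2 r1 r2 m) x"
    for m x
    using arg_cong[OF CBI_exact[of \<rho>1 \<rho>2 r1 r2 m], of "\<lambda>p. poly p x"]
    by (simp add: algebra_simps del: BI.simps)
  have "(x - \<rho>1) * poly ?I' x = (x - \<rho>1) * (poly ?B' x + ?C * poly ?I x)" for x
    unfolding distrib_left mult.left_commute[of "x - \<rho>1" ?C] exact
    by (simp add: algebra_simps)
  then have "poly ([:- \<rho>1, 1:] * ?I') = poly ([:- \<rho>1, 1:] * (?B' + smult ?C ?I))"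
    by (intro ext) (simp add: algebra_simps del: BI.simps)
  then have "[:- \<rho>1, 1:] * ?I' = [:- \<rho>1, 1:] * (?B' + smult ?C ?I)"
    by (simp only: poly_eq_poly_eq_iff)
  then show ?thesis
    by (metis mult_left_cancel one_neq_zero pCons_eq_0_iff)
qed

lemma CBI_0 [simp]: "CBI \<rho>1 \<rho>2 r1 r2 0 = 1"
  using CBI_monic[of \<rho>1 \<rho>2 r1 r2 0] by (auto elim!: degree_eq_zeroE)

text \<open>
  Elimination of the \<open>B\<^sub>n\<close> from the two first-order relations.
\<close>

lemma CBI_recurrence_AC:
  "CBI \<rho>1 \<rho>2 r1 r2 (Suc n) =
     [:bi_A \<rho>1 \<rho>2 r1 r2 n + bi_C \<rho>1 \<rho>2 r1 r2 (Suc n) - \<rho>1, 1:] * CBI \<rho>1 \<rho>2 r1 r2 n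
     - smult (bi_A \<rho>1 \<rho>2 r1 r2 n * bi_C \<rho>1 \<rho>2 r1 r2 n)
         (if n = 0 then 0 else CBI \<rho>1 \<rho>2 r1 r2 (n - 1))"
proof -
  have B: "BI \<rho>1 \<rho>2 r1 r2 n = CBI \<rho>1 \<rho>2 r1 r2 n
      - smult (bi_C \<rho>1 \<rho>2 r1 r2 n) (if n = 0 then 0 else CBI \<rho>1 \<rho>2 r1 r2 (n - 1))"
    using CBI_Suc_eq_BI_plus_CBI[of \<rho>1 \<rho>2 r1 r2 "n - 1"] by (cases n) auto
  have "BI \<rho>1 \<rho>2 r1 r2 (Suc n) =
      [:- \<rho>1, 1:] * CBI \<rho>1 \<rho>2 r1 r2 n + smult (bi_A \<rho>1 \<rho>2 r1 r2 n) (BI \<rho>1 \<rho>2 r1 r2 n)"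
    using CBI_exact[of \<rho>1 \<rho>2 r1 r2 n] by (simp only: diff_add_cancel)
  then show ?thesis
    unfolding CBI_Suc_eq_BI_plus_CBI[of _ _ _ _ n] B
    by (simp add: algebra_simps smult_diff_right smult_add_left smult_diff_left)
qed

text \<open>
  Both identities between the coefficients come from splitting by the parity of \<open>n\<close>. At \<open>n = 0\<close>
  the value of \<open>\<tau>\<^sub>0\<close> is immaterial, which is why \<open>g = 0\<close> is admitted there.
\<close>

lemma CBI_recurrence:
  fixes \<rho>1 \<rho>2 r1 r2 :: "'a::field_char_0"
  assumes "of_nat n + bi_g \<rho>1 \<rho>2 r1 r2 + 1 \<noteq> 0" "n = 0 \<or> of_nat n + bi_g \<rho>1 \<rho>2 r1 r2 \<noteq> 0"
  shows "CBI \<rho>1 \<rho>2 r1 r2 (Suc n) = [:- ((-1) ^ n * \<rho>2), 1:] * CBI \<rho>1 \<rho>2 r1 r2 n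
     - smult (cbi_tau \<rho>1 \<rho>2 r1 r2 n) (if n = 0 then 0 else CBI \<rho>1 \<rho>2 r1 r2 (n - 1))"
proof -
  define D where "D = of_nat n + bi_g \<rho>1 \<rho>2 r1 r2 + 1"
  have D: "D \<noteq> 0" "\<rho>1 = D - of_nat n - 1 - \<rho>2 + r1 + r2" 
      "of_nat n + bi_g \<rho>1 \<rho>2 r1 r2 + 1 = D" "bi_g \<rho>1 \<rho>2 r1 r2 = D - of_nat n - 1"
    using assms(1) by (auto simp: D_def bi_g_def)
  have sum: "bi_A \<rho>1 \<rho>2 r1 r2 n + bi_C \<rho>1 \<rho>2 r1 r2 (Suc n) - \<rho>1 = - ((-1) ^ n * \<rho>2)"
  proof (cases "even n")
    case True
    have "(of_nat n + 2*\<rho>1 - 2*r1 + 1) * (of_nat n + 2*\<rho>1 - 2*r2 + 1)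
         - (1 + of_nat n + 2*\<rho>2 - 2*r2) * (1 + of_nat n + 2*\<rho>2 - 2*r1) = 4 * D * (\<rho>1 - \<rho>2)"
      unfolding D_def bi_g_def by (simp add: algebra_simps)
    then have "(of_nat n + 2*\<rho>1 - 2*r1 + 1) * (of_nat n + 2*\<rho>1 - 2*r2 + 1) / (4 * D)
         - (1 + of_nat n + 2*\<rho>2 - 2*r2) * (1 + of_nat n + 2*\<rho>2 - 2*r1) / (4 * D) = \<rho>1 - \<rho>2"
      using D(1) by (simp add: diff_divide_distrib[symmetric])
    then show ?thesis using True
      by (simp add: bi_A_def bi_C_def D_def add_ac)
  next
    case False
    have "(of_nat n + 2 * bi_g \<rho>1 \<rho>2 r1 r2 + 1) * (of_nat n + 2*\<rho>1 + 2*\<rho>2 + 1)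
         - (1 + of_nat n) * (1 + of_nat n - 2*r1 - 2*r2) = 4 * D * (\<rho>1 + \<rho>2)"
      unfolding D_def bi_g_def by (simp add: algebra_simps)
    then have "(of_nat n + 2 * bi_g \<rho>1 \<rho>2 r1 r2 + 1) * (of_nat n + 2*\<rho>1 + 2*\<rho>2 + 1) / (4 * D)
         - (1 + of_nat n) * (1 + of_nat n - 2*r1 - 2*r2) / (4 * D) = \<rho>1 + \<rho>2"
      using D(1) by (simp add: diff_divide_distrib[symmetric])
    then show ?thesis using False
      by (simp add: bi_A_def bi_C_def D_def add_ac)
  qed
  have prod: "bi_A \<rho>1 \<rho>2 r1 r2 n * bi_C \<rho>1 \<rho>2 r1 r2 n = cbi_tau \<rho>1 \<rho>2 r1 r2 n" if "n \<noteq> 0"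
  proof -
    define E where "E = of_nat n + bi_g \<rho>1 \<rho>2 r1 r2"
    have E: "E \<noteq> 0" "E + 1 \<noteq> 0" using assms that by (auto simp: E_def)
    have E8: "8 + E * 8 \<noteq> 0" "4 + E * 4 \<noteq> 0"
    proof -
      have "8 + E * 8 = 8 * (E + 1)" "4 + E * 4 = 4 * (E + 1)" by simp_all
      with E show "8 + E * 8 \<noteq> 0" "4 + E * 4 \<noteq> 0" by (metis mult_eq_0_iff zero_neq_numeral)+
    qed
    obtain m where "n = 2 * m \<or> n = 2 * m + 1" by (metis oddE evenE)
    then show ?thesis
    proof
      assume n: "n = 2 * m"
      have g: "bi_g \<rho>1 \<rho>2 r1 r2 = E - 2 * of_nat m" using n by (simp add: E_def)
      show ?thesis using E E8
        by (simp add: bi_A_def bi_C_def cbi_tau_def n g Let_def divide_simps) (simp add: algebra_simps)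
    next
      assume n: "n = 2 * m + 1"
      have g: "bi_g \<rho>1 \<rho>2 r1 r2 = E - 2 * of_nat m - 1" using n by (simp add: E_def)
      show ?thesis using E E8
        by (simp add: bi_A_def bi_C_def cbi_tau_def n g Let_def divide_simps) (simp add: algebra_simps)
    qed
  qed
  show ?thesis
    unfolding CBI_recurrence_AC[of _ _ _ _ n] sum by (cases "n = 0") (simp_all add: prod)
qed

section \<open>Contiguous relations for the coefficients of Wilson polynomials\<close>

lemma pochhammer_nonzero:
  "(\<And>i. i < m \<Longrightarrow> (a::'a::field_char_0) + of_nat i \<noteq> 0) \<Longrightarrow> pochhammer a m \<noteq> 0"
  by (simp add: pochhammer_prod)

lemma pochhammer_shift:
  "(a::'a::comm_ring_1) * pochhammer (a + 1) m = pochhammer a m * (a + of_nat m)"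
  using pochhammer_rec[of a m] pochhammer_Suc[of a m] by simp

lemma of_nat_choose_Suc_left:
  "(of_nat (Suc (k + m) choose k) :: 'a::field_char_0)
     = of_nat (Suc (k + m)) * of_nat (k + m choose k) / of_nat (Suc m)"
proof -
  have "Suc m * (Suc (k + m) choose k) = Suc (k + m) * (k + m choose k)"
    using binomial_absorb_comp[of "Suc (k + m)" k] by (simp del: binomial_Suc_Suc)
  from arg_cong[OF this, of "of_nat :: nat \<Rightarrow> 'a"] show ?thesis
    by (simp only: of_nat_mult nonzero_eq_divide_eq[OF of_nat_neq_0] mult.commute)
qed

lemma of_nat_choose_Suc_right:
  "(of_nat (Suc (k + m) choose k) :: 'a::field_char_0)
     = of_nat (Suc k) * of_nat (Suc (k + m) choose Suc k) / of_nat (Suc m)"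
proof -
  have "Suc k * (Suc (k + m) choose Suc k) = Suc m * (Suc (k + m) choose k)"
    using binomial_absorb_comp[of "Suc (k + m)" k] binomial_absorption[of k "Suc (k + m)"]
    by (simp del: binomial_Suc_Suc)
  from arg_cong[OF this, of "of_nat :: nat \<Rightarrow> 'a"] show ?thesis
    by (simp only: of_nat_mult nonzero_eq_divide_eq[OF of_nat_neq_0] mult.commute)
qed

text \<open>
  The coefficients of the terminating \<open>\<^sub>4F\<^sub>3\<close> that defines the Wilson polynomials, multiplied by
  \<open>(e + p)\<^sub>n (e + q)\<^sub>n (e + s)\<^sub>n / (n + e + p + q + s - 1)\<^sub>n\<close> and by a sign that makes the polynomials
  monic. As the lower Pochhammer symbols are cancelled against that factor, the sums \<open>e + p\<close>, \<open>e + q\<close>, \<open>e + s\<close> may be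
  nonpositive integers, as happens under the truncation conditions.
\<close>

definition wilson_coeff :: "'a::field_char_0 \<Rightarrow> 'a \<Rightarrow> 'a \<Rightarrow> 'a \<Rightarrow> nat \<Rightarrow> nat \<Rightarrow> 'a" where
  "wilson_coeff e p q s n k = of_nat (n choose k)
     * (pochhammer (e + p + of_nat k) (n - k) * pochhammer (e + q + of_nat k) (n - k)
        * pochhammer (e + s + of_nat k) (n - k))
     / pochhammer (e + p + q + s + of_nat n + of_nat k - 1) (n - k)"

lemma wilson_coeff_top [simp]: "wilson_coeff e p q s n n = 1"
  by (simp add: wilson_coeff_def)

lemma wilson_coeff_beyond [simp]: "n < k \<Longrightarrow> wilson_coeff e p q s n k = 0"
  by (simp add: wilson_coeff_def)

text \<open>
  In each of the four relations below the Pochhammer symbols of the terms differ by a few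
  linear factors only. After extraction of a common multiple \<open>K\<close>, a polynomial identity in
  \<open>e, p, q, s, k\<close> and \<open>m = n - k\<close> remains.

  This relation is \<open>Q\<^sub>n\<^sub>+\<^sub>1 = R\<^sub>n\<^sub>+\<^sub>1 - \<tau> Q\<^sub>n\<close> in a basis that does not move with the raised parameter.
\<close>

lemma wilson_coeff_raise_other_param:
  fixes e p q s :: "'a::field_char_0"
  assumes reg: "\<And>j. j \<le> 2 * n + 2 \<Longrightarrow> e + p + q + s + of_nat j - 1 \<noteq> 0"
  shows "wilson_coeff e (p + 1) q s (Suc n) k = wilson_coeff e p q s (Suc n) k
    + of_nat (Suc n) * (e + q + of_nat n) * (e + s + of_nat n) * (q + s + of_nat n)
      / ((e + p + q + s + 2 * of_nat n) * (e + p + q + s + 2 * of_nat n + 1))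
      * wilson_coeff e (p + 1) q s n k"
proof (cases "k \<le> n")
  case True
  then obtain m where n: "n = k + m" by (metis le_Suc_ex)
  define z where "z = e + p + q + s + of_nat n + of_nat k"
  define A where "A = pochhammer (e + p + of_nat k + 1) m"
  define B where "B = pochhammer (e + q + of_nat k) m"
  define C where "C = pochhammer (e + s + of_nat k) m"
  define D where "D = pochhammer z m"
  define c where "c = (of_nat (n choose k) :: 'a)"
  define u where "u = z + of_nat m"
  have u: "u \<noteq> 0" "u + 1 \<noteq> 0" "z \<noteq> 0"
    using reg[of "2*n+1"] reg[of "2*n+2"] reg[of "n+k+1"] by (auto simp: u_def z_def n algebra_simps)
  have D0: "D \<noteq> 0"
    unfolding D_def
    by (rule pochhammer_nonzero) (use reg[of "n + k + i + 1" for i] n in \<open>simp add: z_def algebra_simps\<close>)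
  have choose: "of_nat (Suc n choose k) = of_nat (Suc n) * c / of_nat (Suc m)"
    by (simp add: n c_def of_nat_choose_Suc_left)
  have d1: "pochhammer (z + 1) (Suc m) = D * u * (u + 1) / z"
    using pochhammer_shift[of z "Suc m"] u by (simp add: D_def u_def pochhammer_Suc field_simps)
  have 1: "wilson_coeff e (p + 1) q s (Suc n) k = of_nat (Suc n) * c / of_nat (Suc m)
      * (A * (e + p + 1 + of_nat n) * (B * (e + q + of_nat n)) * (C * (e + s + of_nat n)))
      / (D * u * (u + 1) / z)"
    unfolding wilson_coeff_def choose d1[symmetric]
    by (simp add: n A_def B_def C_def z_def pochhammer_Suc algebra_simps)
  have 2: "wilson_coeff e p q s (Suc n) k = of_nat (Suc n) * c / of_nat (Suc m)
      * ((e + p + of_nat k) * A * (B * (e + q + of_nat n)) * (C * (e + s + of_nat n))) / (D * u)"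
  proof -
    have "pochhammer (e + p + of_nat k) (Suc m) = (e + p + of_nat k) * A"
      by (simp add: A_def pochhammer_rec)
    moreover have "e + p + q + s + of_nat (Suc n) + of_nat k - 1 = z" by (simp add: z_def)
    moreover have "Suc n - k = Suc m" by (simp add: n)
    ultimately show ?thesis
      unfolding wilson_coeff_def choose
      by (simp add: B_def C_def D_def u_def pochhammer_Suc n add_ac)
  qed
  have 3: "wilson_coeff e (p + 1) q s n k = c * (A * B * C) / D"
    unfolding wilson_coeff_def c_def by (simp add: A_def B_def C_def D_def z_def n algebra_simps)
  have 4: "u = e + p + q + s + 2 * of_nat n" by (simp add: u_def z_def n)
  define K where "K = of_nat (Suc n) * c * A * B * C * (e + q + of_nat n) * (e + s + of_nat n)
    / (of_nat (Suc m) * D * u * (u + 1))"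
  have m1: "of_nat (Suc m) \<noteq> (0::'a)" by (rule of_nat_neq_0)
  have "wilson_coeff e (p + 1) q s (Suc n) k = K * ((e + p + 1 + of_nat n) * z)"
    unfolding 1 K_def using u by (simp add: divide_simps del: of_nat_Suc)
  also have "(e + p + 1 + of_nat n) * z
      = (e + p + of_nat k) * (u + 1) + of_nat (Suc m) * (q + s + of_nat n)"
    by (simp add: u_def z_def n algebra_simps)
  also have "K * \<dots> = wilson_coeff e p q s (Suc n) k
    + of_nat (Suc n) * (e + q + of_nat n) * (e + s + of_nat n) * (q + s + of_nat n)
      / (u * (u + 1)) * wilson_coeff e (p + 1) q s n k"
    unfolding distrib_left[of K] unfolding 2 3 K_def using u m1 D0 by (simp add: divide_simps del: of_nat_Suc)
  finally show ?thesis unfolding 4 by (simp add: add_ac)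
qed (cases "k = Suc n"; simp)

text \<open>
  Here the raised parameter is the base, so that the two sides live in different bases; the
  term with \<open>Suc k\<close> comes from rewriting the old basis in the new one.
\<close>

lemma wilson_coeff_raise_base:
  fixes e p q s :: "'a::field_char_0"
  assumes reg: "\<And>j. j \<le> 2 * n + 2 \<Longrightarrow> e + p + q + s + of_nat j - 1 \<noteq> 0"
  shows "wilson_coeff (e + 1) p q s (Suc n) k = wilson_coeff e p q s (Suc n) k
    + of_nat (Suc k) * (2 * e + of_nat k + 1) * wilson_coeff e p q s (Suc n) (Suc k)
    + of_nat (Suc n) * (p + q + of_nat n) * (p + s + of_nat n) * (q + s + of_nat n)
      / ((e + p + q + s + 2 * of_nat n) * (e + p + q + s + 2 * of_nat n + 1))
      * wilson_coeff (e + 1) p q s n k"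
proof (cases "k \<le> n")
  case True
  then obtain m where n: "n = k + m" by (metis le_Suc_ex)
  define z where "z = e + p + q + s + of_nat n + of_nat k"
  define A where "A = pochhammer (e + p + of_nat k + 1) m"
  define B where "B = pochhammer (e + q + of_nat k + 1) m"
  define C where "C = pochhammer (e + s + of_nat k + 1) m"
  define D where "D = pochhammer z m"
  define c where "c = (of_nat (n choose k) :: 'a)"
  define u where "u = z + of_nat m"
  have u: "u \<noteq> 0" "u + 1 \<noteq> 0" "z \<noteq> 0"
    using reg[of "2*n+1"] reg[of "2*n+2"] reg[of "n+k+1"] by (auto simp: u_def z_def n algebra_simps)
  have D0: "D \<noteq> 0"
    unfolding D_def
    by (rule pochhammer_nonzero) (use reg[of "n + k + i + 1" for i] n in \<open>simp add: z_def algebra_simps\<close>)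
  have m1: "of_nat (Suc m) \<noteq> (0::'a)" "of_nat (Suc k) \<noteq> (0::'a)" by (rule of_nat_neq_0)+
  have choose: "of_nat (Suc n choose k) = of_nat (Suc n) * c / of_nat (Suc m)"
    by (simp add: n c_def of_nat_choose_Suc_left)
  have choose': "of_nat (Suc n choose Suc k) = of_nat (Suc n) * c / of_nat (Suc k)"
    using arg_cong[OF Suc_times_binomial[of k n], of "of_nat :: _ \<Rightarrow> 'a"]
    by (simp only: c_def of_nat_mult nonzero_eq_divide_eq[OF of_nat_neq_0] mult.commute)
  have d1: "pochhammer (z + 1) (Suc m) = D * u * (u + 1) / z"
    using pochhammer_shift[of z "Suc m"] u by (simp add: D_def u_def pochhammer_Suc field_simps)
  have d2: "pochhammer (z + 1) m = D * u / z"
    using pochhammer_shift[of z m] u by (simp add: D_def u_def field_simps)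
  have 1: "wilson_coeff (e + 1) p q s (Suc n) k = of_nat (Suc n) * c / of_nat (Suc m)
      * (A * (e + p + 1 + of_nat n) * (B * (e + q + 1 + of_nat n)) * (C * (e + s + 1 + of_nat n)))
      / (D * u * (u + 1) / z)"
    unfolding wilson_coeff_def choose d1[symmetric]
    by (simp add: n A_def B_def C_def z_def pochhammer_Suc algebra_simps)
  have 2: "wilson_coeff e p q s (Suc n) k = of_nat (Suc n) * c / of_nat (Suc m)
      * ((e + p + of_nat k) * A * ((e + q + of_nat k) * B) * ((e + s + of_nat k) * C)) / (D * u)"
  proof -
    have "pochhammer (e + p + of_nat k) (Suc m) = (e + p + of_nat k) * A"
      "pochhammer (e + q + of_nat k) (Suc m) = (e + q + of_nat k) * B"
      "pochhammer (e + s + of_nat k) (Suc m) = (e + s + of_nat k) * C"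
      by (simp_all add: A_def B_def C_def pochhammer_rec)
    moreover have "e + p + q + s + of_nat (Suc n) + of_nat k - 1 = z" by (simp add: z_def)
    moreover have "Suc n - k = Suc m" by (simp add: n)
    ultimately show ?thesis
      unfolding wilson_coeff_def choose
      by (simp add: D_def u_def pochhammer_Suc n add_ac)
  qed
  have 3: "wilson_coeff (e + 1) p q s n k = c * (A * B * C) / D"
    unfolding wilson_coeff_def c_def by (simp add: A_def B_def C_def D_def z_def n algebra_simps)
  have 4: "u = e + p + q + s + 2 * of_nat n" by (simp add: u_def z_def n)
  have 5: "wilson_coeff e p q s (Suc n) (Suc k) = of_nat (Suc n) * c / of_nat (Suc k)
      * (A * B * C) / (D * u / z)"
    unfolding wilson_coeff_def choose' d2[symmetric]
    by (simp add: A_def B_def C_def z_def n algebra_simps)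
  define K where "K = of_nat (Suc n) * c * A * B * C / (of_nat (Suc m) * D * u * (u + 1))"
  have "wilson_coeff (e + 1) p q s (Suc n) k = K * ((e + p + 1 + of_nat n)
      * (e + q + 1 + of_nat n) * (e + s + 1 + of_nat n) * z)"
    unfolding 1 K_def using u by (simp add: divide_simps del: of_nat_Suc)
  also have "(e + p + 1 + of_nat n) * (e + q + 1 + of_nat n) * (e + s + 1 + of_nat n) * z
      = (e + p + of_nat k) * (e + q + of_nat k) * (e + s + of_nat k) * (u + 1)
        + of_nat (Suc m) * (2 * e + of_nat k + 1) * z * (u + 1)
        + of_nat (Suc m) * (p + q + of_nat n) * (p + s + of_nat n) * (q + s + of_nat n)"
    unfolding u_def z_def n of_nat_add of_nat_Suc by algebra
  also have "K * \<dots> = wilson_coeff e p q s (Suc n) k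
    + of_nat (Suc k) * (2 * e + of_nat k + 1) * wilson_coeff e p q s (Suc n) (Suc k)
    + of_nat (Suc n) * (p + q + of_nat n) * (p + s + of_nat n) * (q + s + of_nat n)
      / (u * (u + 1)) * wilson_coeff (e + 1) p q s n k"
    unfolding distrib_left[of K] unfolding 2 3 5 K_def using u m1 D0 by (simp add: divide_simps del: of_nat_Suc)
  finally show ?thesis unfolding 4 by (simp add: add_ac)
qed (cases "k = Suc n"; simp)

text \<open>
  The relation \<open>R\<^sub>n\<^sub>+\<^sub>1 = (y - e\<^sup>2) Q\<^sub>n - \<tau> R\<^sub>n\<close>: multiplication by \<open>y - e\<^sup>2\<close> carries the basis with
  base \<open>e + 1\<close> to the one with base \<open>e\<close> and shifts the index.
\<close>

lemma wilson_coeff_degree_step_base: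
  fixes e p q s :: "'a::field_char_0"
  assumes reg: "\<And>j. j \<le> 2 * n + 1 \<Longrightarrow> e + p + q + s + of_nat j - 1 \<noteq> 0"
  shows "wilson_coeff e p q s (Suc n) k =
    (if k = 0 then 0 else wilson_coeff (e + 1) p q s n (k - 1))
    + (e + p + q + s + of_nat n - 1)
      * (e + p + of_nat n) * (e + q + of_nat n) * (e + s + of_nat n)
      / ((e + p + q + s + 2 * of_nat n - 1) * (e + p + q + s + 2 * of_nat n))
      * wilson_coeff e p q s n k"
proof (cases "k \<le> n")
  case True
  then obtain m where n: "n = k + m" by (metis le_Suc_ex)
  define z where "z = e + p + q + s + of_nat n + of_nat k - 1"
  define A where "A = pochhammer (e + p + of_nat k) m"
  define B where "B = pochhammer (e + q + of_nat k) m"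
  define C where "C = pochhammer (e + s + of_nat k) m"
  define D where "D = pochhammer z m"
  define c where "c = (of_nat (n choose k) :: 'a)"
  define u where "u = z + of_nat m"
  have u: "u \<noteq> 0" "u + 1 \<noteq> 0" "z \<noteq> 0"
    using reg[of "2*n"] reg[of "2*n+1"] reg[of "n+k"] by (auto simp: u_def z_def n algebra_simps)
  have D0: "D \<noteq> 0"
    unfolding D_def
    by (rule pochhammer_nonzero) (use reg[of "n + k + i" for i] n in \<open>simp add: z_def algebra_simps\<close>)
  have m1: "of_nat (Suc m) \<noteq> (0::'a)" by (rule of_nat_neq_0)
  have choose: "of_nat (Suc n choose k) = of_nat (Suc n) * c / of_nat (Suc m)"
    by (simp add: n c_def of_nat_choose_Suc_left)
  have d1: "pochhammer (z + 1) (Suc m) = D * u * (u + 1) / z"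
    using pochhammer_shift[of z "Suc m"] u by (simp add: D_def u_def pochhammer_Suc field_simps)
  define U where "U = (e + p + of_nat n) * (e + q + of_nat n) * (e + s + of_nat n)"
  have 1: "wilson_coeff e p q s (Suc n) k = of_nat (Suc n) * c / of_nat (Suc m)
      * (A * B * C * U) / (D * u * (u + 1) / z)"
  proof -
    have "e + p + q + s + of_nat (Suc n) + of_nat k - 1 = z + 1" by (simp add: z_def)
    moreover have "Suc n - k = Suc m" by (simp add: n)
    ultimately show ?thesis
      unfolding wilson_coeff_def choose d1[symmetric] U_def
      by (simp add: A_def B_def C_def pochhammer_Suc n add_ac mult_ac)
  qed
  have 2: "(if k = 0 then 0 else wilson_coeff (e + 1) p q s n (k - 1)) =
      of_nat k * c / of_nat (Suc m) * (A * B * C * U) / (D * u)"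
  proof (cases k)
    case (Suc k')
    have choose': "of_nat (n choose k') = of_nat k * c / of_nat (Suc m)"
      using of_nat_choose_Suc_right[where 'a = 'a, of k' m] by (simp add: n Suc c_def)
    have km: "k - 1 = k'" by (simp add: Suc)
    have "n - k' = Suc m" by (simp add: n Suc)
    moreover have "e + 1 + p + q + s + of_nat n + of_nat k' - 1 = z" by (simp add: z_def Suc)
    ultimately show ?thesis
      unfolding wilson_coeff_def km choose'
      by (simp add: A_def B_def C_def D_def pochhammer_Suc n U_def u_def add_ac mult_ac Suc)
  qed simp
  have 3: "wilson_coeff e p q s n k = c * (A * B * C) / D"
    unfolding wilson_coeff_def c_def by (simp add: A_def B_def C_def D_def z_def n algebra_simps)
  have 4: "u = e + p + q + s + 2 * of_nat n - 1" by (simp add: u_def z_def n)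
  define K where "K = c * A * B * C * U / (of_nat (Suc m) * D * u * (u + 1))"
  have "wilson_coeff e p q s (Suc n) k = K * (of_nat (Suc n) * z)"
    unfolding 1 K_def using u by (simp add: divide_simps del: of_nat_Suc)
  also have "of_nat (Suc n) * z
      = of_nat k * (u + 1) + (e + p + q + s + of_nat n - 1) * of_nat (Suc m)"
    unfolding u_def z_def n of_nat_add of_nat_Suc by algebra
  also have "K * \<dots> = (if k = 0 then 0 else wilson_coeff (e + 1) p q s n (k - 1))
    + (e + p + q + s + of_nat n - 1) * U / (u * (u + 1)) * wilson_coeff e p q s n k"
    unfolding distrib_left[of K] unfolding 2 3 K_def using u m1 D0 by (simp add: divide_simps del: of_nat_Suc)
  finally show ?thesis unfolding 4 U_def by (simp add: add_ac mult_ac)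
qed (cases "k = Suc n"; simp)

text \<open>
  The relation \<open>R\<^sub>n\<^sub>+\<^sub>1 = (y - p\<^sup>2) Q\<^sub>n - \<tau> R\<^sub>n\<close> in the basis with base \<open>e\<close>, where
  \<open>y - p\<^sup>2 = (y - (e + k)\<^sup>2) + ((e + k)\<^sup>2 - p\<^sup>2)\<close>.
\<close>

lemma wilson_coeff_degree_step_other_param:
  fixes e p q s :: "'a::field_char_0"
  assumes reg: "\<And>j. j \<le> 2 * n + 1 \<Longrightarrow> e + p + q + s + of_nat j - 1 \<noteq> 0"
  shows "wilson_coeff e p q s (Suc n) k =
    (if k = 0 then 0 else wilson_coeff e (p + 1) q s n (k - 1))
    + ((e + of_nat k)\<^sup>2 - p\<^sup>2) * wilson_coeff e (p + 1) q s n k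
    + (e + p + q + s + of_nat n - 1)
      * (e + p + of_nat n) * (p + q + of_nat n) * (p + s + of_nat n)
      / ((e + p + q + s + 2 * of_nat n - 1) * (e + p + q + s + 2 * of_nat n))
      * wilson_coeff e p q s n k"
proof (cases "k \<le> n")
  case True
  then obtain m where n: "n = k + m" by (metis le_Suc_ex)
  define z where "z = e + p + q + s + of_nat n + of_nat k - 1"
  define A where "A = pochhammer (e + p + of_nat k) m"
  define B where "B = pochhammer (e + q + of_nat k) m"
  define C where "C = pochhammer (e + s + of_nat k) m"
  define D where "D = pochhammer z m"
  define c where "c = (of_nat (n choose k) :: 'a)"
  define u where "u = z + of_nat m"
  have u: "u \<noteq> 0" "u + 1 \<noteq> 0" "z \<noteq> 0"
    using reg[of "2*n"] reg[of "2*n+1"] reg[of "n+k"] by (auto simp: u_def z_def n algebra_simps)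
  have D0: "D \<noteq> 0"
    unfolding D_def
    by (rule pochhammer_nonzero) (use reg[of "n + k + i" for i] n in \<open>simp add: z_def algebra_simps\<close>)
  have m1: "of_nat (Suc m) \<noteq> (0::'a)" by (rule of_nat_neq_0)
  have choose: "of_nat (Suc n choose k) = of_nat (Suc n) * c / of_nat (Suc m)"
    by (simp add: n c_def of_nat_choose_Suc_left)
  have d1: "pochhammer (z + 1) (Suc m) = D * u * (u + 1) / z"
    using pochhammer_shift[of z "Suc m"] u by (simp add: D_def u_def pochhammer_Suc field_simps)
  have d2: "pochhammer (z + 1) m = D * u / z"
    using pochhammer_shift[of z m] u by (simp add: D_def u_def field_simps)
  define U where "U = (e + p + of_nat n)"
  have 1: "wilson_coeff e p q s (Suc n) k = of_nat (Suc n) * c / of_nat (Suc m)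
      * (A * B * C * (U * (e + q + of_nat n) * (e + s + of_nat n))) / (D * u * (u + 1) / z)"
  proof -
    have "e + p + q + s + of_nat (Suc n) + of_nat k - 1 = z + 1" by (simp add: z_def)
    moreover have "Suc n - k = Suc m" by (simp add: n)
    ultimately show ?thesis
      unfolding wilson_coeff_def choose d1[symmetric] U_def
      by (simp add: A_def B_def C_def pochhammer_Suc n add_ac mult_ac)
  qed
  have 2: "(if k = 0 then 0 else wilson_coeff e (p + 1) q s n (k - 1)) =
      of_nat k * c / of_nat (Suc m) * (A * U * ((e + q + of_nat k - 1) * B)
        * ((e + s + of_nat k - 1) * C)) / (D * u)"
  proof (cases k)
    case (Suc k')
    have choose': "of_nat (n choose k') = of_nat k * c / of_nat (Suc m)"
      using of_nat_choose_Suc_right[where 'a = 'a, of k' m] by (simp add: n Suc c_def)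
    have km: "k - 1 = k'" by (simp add: Suc)
    have "n - k' = Suc m" by (simp add: n Suc)
    moreover have "e + (p + 1) + q + s + of_nat n + of_nat k' - 1 = z" by (simp add: z_def Suc)
    moreover have "pochhammer (e + (p + 1) + of_nat k') (Suc m) = A * U"
      by (simp add: A_def U_def pochhammer_Suc Suc n add_ac)
    moreover have "pochhammer (e + q + of_nat k') (Suc m) = (e + q + of_nat k - 1) * B"
      "pochhammer (e + s + of_nat k') (Suc m) = (e + s + of_nat k - 1) * C"
      by (simp_all add: B_def C_def pochhammer_rec Suc add_ac)
    ultimately show ?thesis
      unfolding wilson_coeff_def km choose'
      by (simp add: D_def pochhammer_Suc u_def Suc)
  qed simp
  have 3: "wilson_coeff e p q s n k = c * (A * B * C) / D"
    unfolding wilson_coeff_def c_def by (simp add: A_def B_def C_def D_def z_def n algebra_simps)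
  have 4: "u = e + p + q + s + 2 * of_nat n - 1" by (simp add: u_def z_def n)
  have 5: "((e + of_nat k)\<^sup>2 - p\<^sup>2) * wilson_coeff e (p + 1) q s n k
      = (e + of_nat k - p) * c * (A * U * B * C) / (D * u / z)"
  proof -
    have "(e + of_nat k + p) * pochhammer (e + (p + 1) + of_nat k) m = A * U"
      using pochhammer_shift[of "e + p + of_nat k" m] by (simp add: A_def U_def n add_ac)
    moreover have "wilson_coeff e (p + 1) q s n k
        = c * (pochhammer (e + (p + 1) + of_nat k) m * B * C) / (D * u / z)"
      unfolding wilson_coeff_def d2[symmetric] c_def B_def C_def
      by (simp add: n z_def add_ac)
    moreover have "(e + of_nat k)\<^sup>2 - p\<^sup>2 = (e + of_nat k - p) * (e + of_nat k + p)"
      by (simp add: power2_eq_square algebra_simps)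
    ultimately have "((e + of_nat k)\<^sup>2 - p\<^sup>2) * wilson_coeff e (p + 1) q s n k
        = (e + of_nat k - p) * c * ((A * U) * B * C) / (D * u / z)"
      by (simp add: mult_ac)
    then show ?thesis .
  qed
  define K where "K = c * A * B * C * U / (of_nat (Suc m) * D * u * (u + 1))"
  have "wilson_coeff e p q s (Suc n) k
      = K * (of_nat (Suc n) * z * (e + q + of_nat n) * (e + s + of_nat n))"
    unfolding 1 K_def using u by (simp add: divide_simps del: of_nat_Suc)
  also have "of_nat (Suc n) * z * (e + q + of_nat n) * (e + s + of_nat n)
      = of_nat k * (e + q + of_nat k - 1) * (e + s + of_nat k - 1) * (u + 1)
        + (e + of_nat k - p) * z * (u + 1) * of_nat (Suc m)
        + (e + p + q + s + of_nat n - 1) * (p + q + of_nat n) * (p + s + of_nat n) * of_nat (Suc m)"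
    unfolding u_def z_def n of_nat_add of_nat_Suc by algebra
  also have "K * \<dots> = (if k = 0 then 0 else wilson_coeff e (p + 1) q s n (k - 1))
    + ((e + of_nat k)\<^sup>2 - p\<^sup>2) * wilson_coeff e (p + 1) q s n k
    + (e + p + q + s + of_nat n - 1) * U * (p + q + of_nat n) * (p + s + of_nat n)
       / (u * (u + 1)) * wilson_coeff e p q s n k"
    unfolding distrib_left[of K] unfolding 2 3 5 K_def using u m1 D0 by (simp add: divide_simps del: of_nat_Suc)
  finally show ?thesis unfolding 4 U_def by (simp add: add_ac mult_ac)
qed (cases "k = Suc n"; simp)

section \<open>Wilson polynomials\<close>

definition wilson_basis :: "'a::field_char_0 \<Rightarrow> nat \<Rightarrow> 'a poly" where
  "wilson_basis e k = (\<Prod>i<k. [:- (e + of_nat i)\<^sup>2, 1:])"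

text \<open>
  The monic Wilson polynomials in the variable \<open>y = x\<^sup>2\<close>, with \<open>i x\<close> in place of the usual
  argument, expanded about the first parameter.
\<close>

definition wilson :: "'a::field_char_0 \<Rightarrow> 'a \<Rightarrow> 'a \<Rightarrow> 'a \<Rightarrow> nat \<Rightarrow> 'a poly" where
  "wilson e p q s n = (\<Sum>k\<le>n. smult (wilson_coeff e p q s n k) (wilson_basis e k))"

lemma wilson_basis_0 [simp]: "wilson_basis e 0 = 1"
  by (simp add: wilson_basis_def)

lemma wilson_basis_Suc:
  "wilson_basis e (Suc k) = [:- (e + of_nat k)\<^sup>2, 1:] * wilson_basis e k"
  by (simp add: wilson_basis_def mult.commute)

lemma wilson_basis_Suc_shift:
  "wilson_basis e (Suc k) = [:- e\<^sup>2, 1:] * wilson_basis (e + 1) k"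
  unfolding wilson_basis_def by (simp only: prod.lessThan_Suc_shift) (simp add: o_def add_ac)

lemma poly_wilson_basis: "poly (wilson_basis e k) y = (\<Prod>i<k. y - (e + of_nat i)\<^sup>2)"
  by (simp add: wilson_basis_def poly_prod)

lemma wilson_0 [simp]: "wilson e p q s 0 = 1"
  by (simp add: wilson_def)

lemma wilson_extend:
  "wilson e p q s n = (\<Sum>k\<le>Suc n. smult (wilson_coeff e p q s n k) (wilson_basis e k))"
  by (simp add: wilson_def)

lemma smult_sum_right: "smult a (\<Sum>k\<in>A. f k) = (\<Sum>k\<in>A. smult a (f k))"
  by (induction A rule: infinite_finite_induct) (simp_all add: smult_add_right)

lemma sum_drop_zero_shift:
  fixes f :: "nat \<Rightarrow> 'a::comm_ring_1" and B :: "nat \<Rightarrow> 'a poly"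
  shows "(\<Sum>k\<le>Suc n. smult (if k = 0 then 0 else f (k - 1)) (B k)) = (\<Sum>k\<le>n. smult (f k) (B (Suc k)))"
  by (subst sum.atMost_Suc_shift) simp

lemma wilson_raise_other_param:
  fixes e p q s :: "'a::field_char_0"
  assumes "\<And>j. j \<le> 2 * n + 2 \<Longrightarrow> e + p + q + s + of_nat j - 1 \<noteq> 0"
  shows "wilson e (p + 1) q s (Suc n) = wilson e p q s (Suc n)
    + smult (of_nat (Suc n) * (e + q + of_nat n) * (e + s + of_nat n) * (q + s + of_nat n)
        / ((e + p + q + s + 2 * of_nat n) * (e + p + q + s + 2 * of_nat n + 1)))
        (wilson e (p + 1) q s n)"
  unfolding wilson_extend[of _ _ _ _ n] unfolding wilson_def smult_sum_right
  by (simp only: sum.distrib[symmetric] smult_smult smult_add_left[symmetric]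
      wilson_coeff_raise_other_param[OF assms])

lemma wilson_degree_step_other_param:
  fixes e p q s :: "'a::field_char_0"
  assumes "\<And>j. j \<le> 2 * n + 1 \<Longrightarrow> e + p + q + s + of_nat j - 1 \<noteq> 0"
  shows "wilson e p q s (Suc n) = [:- p\<^sup>2, 1:] * wilson e (p + 1) q s n
    + smult ((e + p + q + s + of_nat n - 1)
      * (e + p + of_nat n) * (p + q + of_nat n) * (p + s + of_nat n)
      / ((e + p + q + s + 2 * of_nat n - 1) * (e + p + q + s + 2 * of_nat n)))
      (wilson e p q s n)" (is "_ = ?lin * ?Q + smult ?t ?R")
proof -
  let ?q = "wilson_coeff e (p + 1) q s n"
  have lin: "?lin * wilson_basis e k
      = wilson_basis e (Suc k) + smult ((e + of_nat k)\<^sup>2 - p\<^sup>2) (wilson_basis e k)" for k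
    unfolding wilson_basis_Suc by (simp add: algebra_simps smult_diff_left)
  have "?lin * ?Q = (\<Sum>k\<le>n. smult (?q k) (?lin * wilson_basis e k))"
    by (simp only: wilson_def sum_distrib_left mult_smult_right)
  also have "\<dots> = (\<Sum>k\<le>n. smult (?q k) (wilson_basis e (Suc k)))
      + (\<Sum>k\<le>n. smult (((e + of_nat k)\<^sup>2 - p\<^sup>2) * ?q k) (wilson_basis e k))"
    unfolding lin smult_add_right sum.distrib smult_smult by (simp add: mult.commute)
  also have "\<dots> = (\<Sum>k\<le>Suc n. smult (if k = 0 then 0 else ?q (k - 1)) (wilson_basis e k))
      + (\<Sum>k\<le>Suc n. smult (((e + of_nat k)\<^sup>2 - p\<^sup>2) * ?q k) (wilson_basis e k))"
    by (simp add: sum_drop_zero_shift del: sum.atMost_Suc) simp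
  finally have "?lin * ?Q + smult ?t ?R = (\<Sum>k\<le>Suc n. smult (if k = 0 then 0 else ?q (k - 1)) (wilson_basis e k))
      + (\<Sum>k\<le>Suc n. smult (((e + of_nat k)\<^sup>2 - p\<^sup>2) * ?q k) (wilson_basis e k))
      + (\<Sum>k\<le>Suc n. smult (?t * wilson_coeff e p q s n k) (wilson_basis e k))"
    by (simp only: wilson_extend[of _ _ _ _ n] smult_sum_right smult_smult)
  then show ?thesis
    unfolding wilson_def[of _ _ _ _ "Suc n"]
    by (simp only: sum.distrib[symmetric] smult_add_left[symmetric]
      wilson_coeff_degree_step_other_param[OF assms])
qed

lemma wilson_raise_base:
  fixes e p q s :: "'a::field_char_0"
  assumes "\<And>j. j \<le> 2 * n + 2 \<Longrightarrow> e + p + q + s + of_nat j - 1 \<noteq> 0"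
  shows "wilson (e + 1) p q s (Suc n) = wilson e p q s (Suc n)
    + smult (of_nat (Suc n) * (p + q + of_nat n) * (p + s + of_nat n) * (q + s + of_nat n)
      / ((e + p + q + s + 2 * of_nat n) * (e + p + q + s + 2 * of_nat n + 1)))
      (wilson (e + 1) p q s n)" (is "_ = _ + smult ?t ?Q")
proof -
  let ?r = "wilson_coeff e p q s (Suc n)"
  have basis: "wilson_basis e (Suc k) = wilson_basis (e + 1) (Suc k)
      + smult (of_nat (Suc k) * (2 * e + of_nat k + 1)) (wilson_basis (e + 1) k)" for k
    unfolding wilson_basis_Suc_shift[of e] wilson_basis_Suc[of "e + 1"]
    by (simp add: algebra_simps smult_diff_left[symmetric] smult_add_left[symmetric] power2_eq_square
        del: smult_diff_left smult_add_left)
  have "wilson e p q s (Suc n)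
      = smult (?r 0) (wilson_basis (e + 1) 0) + (\<Sum>k\<le>n. smult (?r (Suc k)) (wilson_basis (e + 1) (Suc k)))
      + (\<Sum>k\<le>n. smult (of_nat (Suc k) * (2 * e + of_nat k + 1) * ?r (Suc k)) (wilson_basis (e + 1) k))"
    unfolding wilson_def sum.atMost_Suc_shift basis
    by (simp only: smult_add_right sum.distrib smult_smult wilson_basis_0 mult.commute add.assoc)
  also have "\<dots> = (\<Sum>k\<le>Suc n. smult (?r k) (wilson_basis (e + 1) k))
      + (\<Sum>k\<le>Suc n. smult (of_nat (Suc k) * (2 * e + of_nat k + 1) * ?r (Suc k)) (wilson_basis (e + 1) k))"
    unfolding sum.atMost_Suc_shift[of "\<lambda>k. smult (?r k) (wilson_basis (e + 1) k)" n] by simp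
  finally have "wilson e p q s (Suc n) + smult ?t ?Q = (\<Sum>k\<le>Suc n. smult (?r k) (wilson_basis (e + 1) k))
      + (\<Sum>k\<le>Suc n. smult (of_nat (Suc k) * (2 * e + of_nat k + 1) * ?r (Suc k)) (wilson_basis (e + 1) k))
      + (\<Sum>k\<le>Suc n. smult (?t * wilson_coeff (e + 1) p q s n k) (wilson_basis (e + 1) k))"
    by (simp only: wilson_extend[of _ _ _ _ n] smult_sum_right smult_smult)
  then show ?thesis
    unfolding wilson_def[of "e + 1" _ _ _ "Suc n"]
    by (simp only: sum.distrib[symmetric] smult_add_left[symmetric]
      wilson_coeff_raise_base[OF assms])
qed

lemma wilson_degree_step_base:
  fixes e p q s :: "'a::field_char_0"
  assumes "\<And>j. j \<le> 2 * n + 1 \<Longrightarrow> e + p + q + s + of_nat j - 1 \<noteq> 0"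
  shows "wilson e p q s (Suc n) = [:- e\<^sup>2, 1:] * wilson (e + 1) p q s n
    + smult ((e + p + q + s + of_nat n - 1)
      * (e + p + of_nat n) * (e + q + of_nat n) * (e + s + of_nat n)
      / ((e + p + q + s + 2 * of_nat n - 1) * (e + p + q + s + 2 * of_nat n)))
      (wilson e p q s n)" (is "_ = ?lin * ?Q + smult ?t ?R")
proof -
  let ?q = "wilson_coeff (e + 1) p q s n"
  have "?lin * ?Q = (\<Sum>k\<le>n. smult (?q k) (?lin * wilson_basis (e + 1) k))"
    by (simp only: wilson_def sum_distrib_left mult_smult_right)
  also have "\<dots> = (\<Sum>k\<le>Suc n. smult (if k = 0 then 0 else ?q (k - 1)) (wilson_basis e k))"
    by (simp only: wilson_basis_Suc_shift[symmetric] sum_drop_zero_shift)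
  finally have "?lin * ?Q + smult ?t ?R
      = (\<Sum>k\<le>Suc n. smult (if k = 0 then 0 else ?q (k - 1)) (wilson_basis e k))
      + (\<Sum>k\<le>Suc n. smult (?t * wilson_coeff e p q s n k) (wilson_basis e k))"
    by (simp only: wilson_extend[of _ _ _ _ n] smult_sum_right smult_smult)
  then show ?thesis
    unfolding wilson_def[of _ _ _ _ "Suc n"]
    by (simp only: sum.distrib[symmetric] smult_add_left[symmetric]
      wilson_coeff_degree_step_base[OF assms])
qed

section \<open>The even and odd parts of the complementary Bannai--Ito polynomials\<close>

lemma bi_regular_mono: "bi_regular \<rho>1 \<rho>2 r1 r2 n \<Longrightarrow> m \<le> n \<Longrightarrow> bi_regular \<rho>1 \<rho>2 r1 r2 m"
  by (auto simp: bi_regular_def)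

lemma bi_regularD:
  "bi_regular \<rho>1 \<rho>2 r1 r2 n \<Longrightarrow> 1 \<le> j \<Longrightarrow> j \<le> n \<Longrightarrow> of_nat j + bi_g \<rho>1 \<rho>2 r1 r2 \<noteq> 0"
  by (auto simp: bi_regular_def)

lemma CBI_recurrence_regular:
  assumes "bi_regular \<rho>1 \<rho>2 r1 r2 (n + 1)"
  shows "CBI \<rho>1 \<rho>2 r1 r2 (Suc n) = [:- ((-1) ^ n * \<rho>2), 1:] * CBI \<rho>1 \<rho>2 r1 r2 n
     - smult (cbi_tau \<rho>1 \<rho>2 r1 r2 n) (if n = 0 then 0 else CBI \<rho>1 \<rho>2 r1 r2 (n - 1))"
  by (rule CBI_recurrence) (use bi_regularD[OF assms, of "n + 1"] bi_regularD[OF assms, of n] in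
      \<open>auto simp: add_ac\<close>)

text \<open>
  The two-step form of the recurrence: any solution of the coupled relations for \<open>R\<close> and \<open>Q\<close>
  gives the even and odd polynomials, since \<open>(x + \<rho>\<^sub>2) (x - \<rho>\<^sub>2) = x\<^sup>2 - \<rho>\<^sub>2\<^sup>2\<close>.
\<close>

lemma CBI_by_parity:
  fixes \<rho>1 \<rho>2 r1 r2 :: "'a::field_char_0" and R Q :: "nat \<Rightarrow> 'a poly"
  assumes init: "R 0 = 1" "Q 0 = 1"
    and R: "\<And>n. bi_regular \<rho>1 \<rho>2 r1 r2 (2 * n + 2) \<Longrightarrow>
      R (Suc n) = [:- \<rho>2\<^sup>2, 1:] * Q n - smult (cbi_tau \<rho>1 \<rho>2 r1 r2 (2 * n + 1)) (R n)"
    and Q: "\<And>n. bi_regular \<rho>1 \<rho>2 r1 r2 (2 * n + 3) \<Longrightarrow>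
      Q (Suc n) = R (Suc n) - smult (cbi_tau \<rho>1 \<rho>2 r1 r2 (2 * n + 2)) (Q n)"
  shows "(bi_regular \<rho>1 \<rho>2 r1 r2 (2 * n) \<longrightarrow>
            poly (CBI \<rho>1 \<rho>2 r1 r2 (2 * n)) x = poly (R n) (x\<^sup>2)) \<and>
         (bi_regular \<rho>1 \<rho>2 r1 r2 (2 * n + 1) \<longrightarrow>
            poly (CBI \<rho>1 \<rho>2 r1 r2 (2 * n + 1)) x = (x - \<rho>2) * poly (Q n) (x\<^sup>2))"
proof (induction n)
  case 0
  show ?case using CBI_recurrence_regular[of \<rho>1 \<rho>2 r1 r2 0] by (auto simp: init)
next
  case (Suc n)
  have even: "poly (CBI \<rho>1 \<rho>2 r1 r2 (2 * Suc n)) x = poly (R (Suc n)) (x\<^sup>2)"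
    if reg: "bi_regular \<rho>1 \<rho>2 r1 r2 (2 * Suc n)"
  proof -
    have "bi_regular \<rho>1 \<rho>2 r1 r2 (2 * n + 1 + 1)" "bi_regular \<rho>1 \<rho>2 r1 r2 (2 * n + 2)"
      "bi_regular \<rho>1 \<rho>2 r1 r2 (2 * n + 1)" "bi_regular \<rho>1 \<rho>2 r1 r2 (2 * n)"
      using reg by (auto elim: bi_regular_mono)
    then have "poly (CBI \<rho>1 \<rho>2 r1 r2 (2 * n)) x = poly (R n) (x\<^sup>2)"
      "poly (CBI \<rho>1 \<rho>2 r1 r2 (2 * n + 1)) x = (x - \<rho>2) * poly (Q n) (x\<^sup>2)"
      and "poly (CBI \<rho>1 \<rho>2 r1 r2 (2 * Suc n)) x = (x + \<rho>2) * poly (CBI \<rho>1 \<rho>2 r1 r2 (2 * n + 1)) x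
        - cbi_tau \<rho>1 \<rho>2 r1 r2 (2 * n + 1) * poly (CBI \<rho>1 \<rho>2 r1 r2 (2 * n)) x"
      and "R (Suc n) = [:- \<rho>2\<^sup>2, 1:] * Q n - smult (cbi_tau \<rho>1 \<rho>2 r1 r2 (2 * n + 1)) (R n)"
      using Suc.IH CBI_recurrence_regular[of \<rho>1 \<rho>2 r1 r2 "2 * n + 1"] R[of n]
      by (simp_all add: distrib_right add.commute)
    then show ?thesis
      by (simp only: poly_diff poly_mult poly_smult) (simp add: algebra_simps power2_eq_square)
  qed
  have odd: "poly (CBI \<rho>1 \<rho>2 r1 r2 (2 * Suc n + 1)) x = (x - \<rho>2) * poly (Q (Suc n)) (x\<^sup>2)"
    if reg: "bi_regular \<rho>1 \<rho>2 r1 r2 (2 * Suc n + 1)"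
  proof -
    have "bi_regular \<rho>1 \<rho>2 r1 r2 (2 * n + 2 + 1)" "bi_regular \<rho>1 \<rho>2 r1 r2 (2 * n + 3)"
      "bi_regular \<rho>1 \<rho>2 r1 r2 (2 * n + 1)" "bi_regular \<rho>1 \<rho>2 r1 r2 (2 * Suc n)"
      using reg by (auto elim: bi_regular_mono)
    then have "poly (CBI \<rho>1 \<rho>2 r1 r2 (2 * Suc n)) x = poly (R (Suc n)) (x\<^sup>2)"
      "poly (CBI \<rho>1 \<rho>2 r1 r2 (2 * n + 1)) x = (x - \<rho>2) * poly (Q n) (x\<^sup>2)"
      and "poly (CBI \<rho>1 \<rho>2 r1 r2 (2 * Suc n + 1)) x = (x - \<rho>2) * poly (CBI \<rho>1 \<rho>2 r1 r2 (2 * Suc n)) x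
        - cbi_tau \<rho>1 \<rho>2 r1 r2 (2 * n + 2) * poly (CBI \<rho>1 \<rho>2 r1 r2 (2 * n + 1)) x"
      and "Q (Suc n) = R (Suc n) - smult (cbi_tau \<rho>1 \<rho>2 r1 r2 (2 * n + 2)) (Q n)"
      using Suc.IH CBI_recurrence_regular[of \<rho>1 \<rho>2 r1 r2 "2 * n + 2"] Q[of n] even
      by (simp_all add: left_diff_distrib)
    then show ?thesis
      by (simp only: poly_diff poly_mult poly_smult) (simp add: algebra_simps)
  qed
  show ?case using even odd by blast
qed

text \<open>
  In the parameters \<open>a = \<rho>\<^sub>2\<close>, \<open>b = \<rho>\<^sub>1 + 1\<close>, \<open>c = 1/2 - r\<^sub>1\<close>, \<open>d = 1/2 - r\<^sub>2\<close>, whose sum is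
  \<open>g + 2\<close>, the coefficients \<open>\<tau>\<^sub>n\<close> are those of the contiguous relations.
\<close>

lemma cbi_tau_odd_wilson:
  fixes \<rho>1 \<rho>2 r1 r2 :: "'a::field_char_0"
  defines "a \<equiv> \<rho>2" and "b \<equiv> \<rho>1 + 1" and "c \<equiv> 1/2 - r1" and "d \<equiv> 1/2 - r2"
  shows "cbi_tau \<rho>1 \<rho>2 r1 r2 (2 * n + 1) = - ((a + b + c + d + of_nat n - 1)
      * (a + b + of_nat n) * (a + c + of_nat n) * (a + d + of_nat n)
      / ((a + b + c + d + 2 * of_nat n - 1) * (a + b + c + d + 2 * of_nat n)))"
proof -
  have "of_nat n + bi_g \<rho>1 \<rho>2 r1 r2 + 1 = a + b + c + d + of_nat n - 1"
    "2 * of_nat n + bi_g \<rho>1 \<rho>2 r1 r2 + 1 = a + b + c + d + 2 * of_nat n - 1"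
    "2 * of_nat n + bi_g \<rho>1 \<rho>2 r1 r2 + 2 = a + b + c + d + 2 * of_nat n"
    "of_nat n + \<rho>1 + \<rho>2 + 1 = a + b + of_nat n"
    "of_nat n + \<rho>2 - r1 + 1/2 = a + c + of_nat n"
    "of_nat n + \<rho>2 - r2 + 1/2 = a + d + of_nat n"
    by (simp_all add: a_def b_def c_def d_def bi_g_def)
  moreover have "(2 * n + 1) div 2 = n" "even (2 * n + 1) = False" by simp_all
  ultimately show ?thesis unfolding cbi_tau_def Let_def by (simp only: if_False)
qed

lemma cbi_tau_even_wilson:
  fixes \<rho>1 \<rho>2 r1 r2 :: "'a::field_char_0"
  defines "a \<equiv> \<rho>2" and "b \<equiv> \<rho>1 + 1" and "c \<equiv> 1/2 - r1" and "d \<equiv> 1/2 - r2"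
  shows "cbi_tau \<rho>1 \<rho>2 r1 r2 (2 * n + 2) = - (of_nat (Suc n)
      * (b + c + of_nat n) * (b + d + of_nat n) * (c + d + of_nat n)
      / ((a + b + c + d + 2 * of_nat n) * (a + b + c + d + 2 * of_nat n + 1)))"
proof -
  have "2 * of_nat (Suc n) + bi_g \<rho>1 \<rho>2 r1 r2 = a + b + c + d + 2 * of_nat n"
    "of_nat (Suc n) + \<rho>1 - r1 + 1/2 = b + c + of_nat n"
    "of_nat (Suc n) + \<rho>1 - r2 + 1/2 = b + d + of_nat n"
    "of_nat (Suc n) - r1 - r2 = c + d + of_nat n"
    by (simp_all add: a_def b_def c_def d_def bi_g_def)
  moreover have "(2 * n + 2) div 2 = Suc n" "even (2 * n + 2)" by simp_all
  ultimately show ?thesis unfolding cbi_tau_def Let_def by (simp only: if_True)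
qed

lemma CBI_wilson_base_rho2:
  fixes \<rho>1 \<rho>2 r1 r2 :: "'a::field_char_0"
  shows "(bi_regular \<rho>1 \<rho>2 r1 r2 (2 * n) \<longrightarrow> poly (CBI \<rho>1 \<rho>2 r1 r2 (2 * n)) x
            = poly (wilson \<rho>2 (\<rho>1 + 1) (1/2 - r1) (1/2 - r2) n) (x\<^sup>2)) \<and>
         (bi_regular \<rho>1 \<rho>2 r1 r2 (2 * n + 1) \<longrightarrow> poly (CBI \<rho>1 \<rho>2 r1 r2 (2 * n + 1)) x
            = (x - \<rho>2) * poly (wilson (\<rho>2 + 1) (\<rho>1 + 1) (1/2 - r1) (1/2 - r2) n) (x\<^sup>2))"
proof (rule CBI_by_parity)
  have nz: "\<rho>2 + (\<rho>1 + 1) + (1/2 - r1) + (1/2 - r2) + of_nat j - 1 \<noteq> 0"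
    if "bi_regular \<rho>1 \<rho>2 r1 r2 m" "Suc j \<le> m" for j m
    using bi_regularD[OF that(1), of "Suc j"] that(2) by (simp add: bi_g_def algebra_simps)
  fix n
  show "wilson \<rho>2 (\<rho>1 + 1) (1/2 - r1) (1/2 - r2) (Suc n)
      = [:- \<rho>2\<^sup>2, 1:] * wilson (\<rho>2 + 1) (\<rho>1 + 1) (1/2 - r1) (1/2 - r2) n
        - smult (cbi_tau \<rho>1 \<rho>2 r1 r2 (2 * n + 1)) (wilson \<rho>2 (\<rho>1 + 1) (1/2 - r1) (1/2 - r2) n)"
    if "bi_regular \<rho>1 \<rho>2 r1 r2 (2 * n + 2)"
    unfolding cbi_tau_odd_wilson
    by (subst wilson_degree_step_base, rule nz[OF that]) simp_all
  show "wilson (\<rho>2 + 1) (\<rho>1 + 1) (1/2 - r1) (1/2 - r2) (Suc n)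
      = wilson \<rho>2 (\<rho>1 + 1) (1/2 - r1) (1/2 - r2) (Suc n)
        - smult (cbi_tau \<rho>1 \<rho>2 r1 r2 (2 * n + 2)) (wilson (\<rho>2 + 1) (\<rho>1 + 1) (1/2 - r1) (1/2 - r2) n)"
    if "bi_regular \<rho>1 \<rho>2 r1 r2 (2 * n + 3)"
    unfolding cbi_tau_even_wilson
    by (subst wilson_raise_base, rule nz[OF that]) simp_all
qed simp_all

text \<open>
  The same polynomials expanded about \<open>1/2 - r\<^sub>1\<close>. The parameter \<open>\<rho>\<^sub>2\<close>, which is raised in the odd
  case, is no longer the base.
\<close>

lemma CBI_wilson_base_r1:
  fixes \<rho>1 \<rho>2 r1 r2 :: "'a::field_char_0"
  shows "(bi_regular \<rho>1 \<rho>2 r1 r2 (2 * n) \<longrightarrow> poly (CBI \<rho>1 \<rho>2 r1 r2 (2 * n)) x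
            = poly (wilson (1/2 - r1) \<rho>2 (\<rho>1 + 1) (1/2 - r2) n) (x\<^sup>2)) \<and>
         (bi_regular \<rho>1 \<rho>2 r1 r2 (2 * n + 1) \<longrightarrow> poly (CBI \<rho>1 \<rho>2 r1 r2 (2 * n + 1)) x
            = (x - \<rho>2) * poly (wilson (1/2 - r1) (\<rho>2 + 1) (\<rho>1 + 1) (1/2 - r2) n) (x\<^sup>2))"
proof (rule CBI_by_parity)
  have nz: "(1/2 - r1) + \<rho>2 + (\<rho>1 + 1) + (1/2 - r2) + of_nat j - 1 \<noteq> 0"
    if "bi_regular \<rho>1 \<rho>2 r1 r2 m" "Suc j \<le> m" for j m
    using bi_regularD[OF that(1), of "Suc j"] that(2) by (simp add: bi_g_def algebra_simps)
  define b c d where "b = \<rho>1 + 1" and "c = 1/2 - r1" and "d = 1/2 - r2"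
  note fold = b_def[symmetric] c_def[symmetric] d_def[symmetric]
  fix n
  show "wilson (1/2 - r1) \<rho>2 (\<rho>1 + 1) (1/2 - r2) (Suc n)
      = [:- \<rho>2\<^sup>2, 1:] * wilson (1/2 - r1) (\<rho>2 + 1) (\<rho>1 + 1) (1/2 - r2) n
        - smult (cbi_tau \<rho>1 \<rho>2 r1 r2 (2 * n + 1)) (wilson (1/2 - r1) \<rho>2 (\<rho>1 + 1) (1/2 - r2) n)"
    if "bi_regular \<rho>1 \<rho>2 r1 r2 (2 * n + 2)"
    unfolding cbi_tau_odd_wilson fold
    by (subst wilson_degree_step_other_param, rule nz[OF that, unfolded fold]) (simp_all add: add_ac mult_ac)
  show "wilson (1/2 - r1) (\<rho>2 + 1) (\<rho>1 + 1) (1/2 - r2) (Suc n)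
      = wilson (1/2 - r1) \<rho>2 (\<rho>1 + 1) (1/2 - r2) (Suc n)
        - smult (cbi_tau \<rho>1 \<rho>2 r1 r2 (2 * n + 2)) (wilson (1/2 - r1) (\<rho>2 + 1) (\<rho>1 + 1) (1/2 - r2) n)"
    if "bi_regular \<rho>1 \<rho>2 r1 r2 (2 * n + 3)"
    unfolding cbi_tau_even_wilson fold
    by (subst wilson_raise_other_param, rule nz[OF that, unfolded fold]) (simp_all add: add_ac mult_ac)
qed simp_all

section \<open>Terminating hypergeometric series\<close>

lemma hypergeo_terminating:
  fixes as bs :: "'a::{real_normed_field,banach} list"
  assumes "- of_nat n \<in> set as"
  shows "hypergeo as bs 1 = (\<Sum>k\<le>n. (\<Prod>a\<leftarrow>as. pochhammer a k) / ((\<Prod>b\<leftarrow>bs. pochhammer b k) * fact k))"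
proof -
  have fold: "foldl (\<lambda>r a. r * pochhammer a k) c xs = c * (\<Prod>a\<leftarrow>xs. pochhammer a k)" for k xs and c :: 'a
    by (induction xs arbitrary: c) (simp_all add: mult.assoc)
  have coeff: "fps_nth (fps_hypergeo as bs 1) k
      = (\<Prod>a\<leftarrow>as. pochhammer a k) / ((\<Prod>b\<leftarrow>bs. pochhammer b k) * fact k)" for k
    by (simp add: fold mult.commute)
  have "(\<Prod>a\<leftarrow>as. pochhammer a k) = 0" if "k \<notin> {..n}" for k
    using assms that by (force simp: prod_list_zero_iff image_iff pochhammer_of_nat_eq_0_iff)
  then show ?thesis
    unfolding hypergeo_def eval_fps_def
    by (subst suminf_finite[of "{..n}"]) (auto simp: coeff simp del: fps_hypergeo_nth)
qed

text \<open>
  Splitting each Pochhammer symbol of length \<open>n\<close> at \<open>k\<close> turns the normalised coefficients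
  into those of the \<open>\<^sub>4F\<^sub>3\<close>; \<open>(e + x)\<^sub>k (e - x)\<^sub>k\<close> is the basis polynomial up to the sign \<open>(-1)\<^sup>k\<close>.
\<close>

lemma wilson_hypergeo:
  fixes e p q s x :: "'a::{real_normed_field,banach}"
  assumes reg: "\<And>j. j < n \<Longrightarrow> of_nat n + (e + p + q + s - 1) + of_nat j \<noteq> 0"
    and nz: "\<And>j. j < n \<Longrightarrow> e + p + of_nat j \<noteq> 0" "\<And>j. j < n \<Longrightarrow> e + q + of_nat j \<noteq> 0"
      "\<And>j. j < n \<Longrightarrow> e + s + of_nat j \<noteq> 0"
  shows "poly (wilson e p q s n) (x\<^sup>2) =
    pochhammer (e + p) n * pochhammer (e + q) n * pochhammer (e + s) n
      / pochhammer (of_nat n + (e + p + q + s - 1)) n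
    * hypergeo [- of_nat n, of_nat n + (e + p + q + s - 1), e + x, e - x] [e + p, e + q, e + s] 1"
    (is "_ = ?H * _")
proof -
  let ?u = "of_nat n + (e + p + q + s - 1)"
  have split: "pochhammer a n = pochhammer a k * pochhammer (a + of_nat k) (n - k)" if "k \<le> n"
    for a :: 'a and k using that by (rule pochhammer_product)
  have basis: "(-1) ^ k * poly (wilson_basis e k) (x\<^sup>2) = pochhammer (e + x) k * pochhammer (e - x) k" for k
    by (induction k) (simp_all add: wilson_basis_Suc pochhammer_Suc algebra_simps power2_eq_square)
  have summand: "wilson_coeff e p q s n k * poly (wilson_basis e k) (x\<^sup>2) = ?H *
      (pochhammer (- of_nat n) k * (pochhammer ?u k * (pochhammer (e + x) k * pochhammer (e - x) k))
        / (pochhammer (e + p) k * (pochhammer (e + q) k * pochhammer (e + s) k) * fact k))"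
    if k: "k \<le> n" for k
  proof -
    have 0: "pochhammer (e + p) k \<noteq> 0" "pochhammer (e + q) k \<noteq> 0" "pochhammer (e + s) k \<noteq> 0"
        "pochhammer ?u k \<noteq> 0" "pochhammer (?u + of_nat k) (n - k) \<noteq> 0"
      using k reg[of "k + j" for j] reg[of j for j]
      by (auto intro!: pochhammer_nonzero nz simp only: add.assoc of_nat_add less_diff_conv2 add.commute)
    have choose: "of_nat (n choose k) = (-1) ^ k * pochhammer (- of_nat n) k / (fact k :: 'a)"
      by (simp add: binomial_gbinomial gbinomial_pochhammer)
    have u: "e + p + q + s + of_nat n + of_nat k - 1 = ?u + of_nat k" by simp
    show ?thesis
      unfolding wilson_coeff_def u choose basis[symmetric] split[OF k]
      using 0 by (simp add: field_simps)
  qed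
  show ?thesis
    by (subst hypergeo_terminating[where n = n])
      (simp_all add: wilson_def poly_sum summand sum_distrib_left mult_ac)
qed

section \<open>Finite orthogonality from a positive three-term recurrence\<close>

text \<open>
  The setting of Favard's theorem for finitely many polynomials: a monic three-term recurrence
  with real diagonal and positive off-diagonal coefficients up to index \<open>N\<close>.
\<close>

locale positive_recurrence =
  fixes p :: "nat \<Rightarrow> real poly" and b t :: "nat \<Rightarrow> real" and N :: nat
  assumes degree: "degree (p n) = n" and monic: "coeff (p n) n = 1"
    and recurrence: "n \<le> N \<Longrightarrow>
      p (Suc n) = [:- b n, 1:] * p n - smult (t n) (if n = 0 then 0 else p (n - 1))"
    and positive: "1 \<le> n \<Longrightarrow> n \<le> N \<Longrightarrow> 0 < t n"
begin

lemma p_0: "p 0 = 1"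
  using degree[of 0] monic[of 0] by (auto elim!: degree_eq_zeroE)

text \<open>
  The confluent Christoffel--Darboux expression satisfies \<open>D\<^sub>n\<^sub>+\<^sub>1 = p\<^sub>n\<^sub>+\<^sub>1\<^sup>2 + t\<^sub>n\<^sub>+\<^sub>1 D\<^sub>n\<close> with
  \<open>D\<^sub>0 = 1\<close>. Its positivity shows that zeros are simple and fixes the sign of the Gauss weights.
\<close>

lemma christoffel_darboux_confluent:
  "n \<le> N \<Longrightarrow> 0 < poly (pderiv (p (Suc n))) x * poly (p n) x - poly (pderiv (p n)) x * poly (p (Suc n)) x"
proof (induction n)
  case 0
  show ?case using recurrence[of 0] by (simp add: p_0 pderiv_pCons)
next
  case (Suc n)
  have "poly (pderiv (p (Suc (Suc n)))) x * poly (p (Suc n)) x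
        - poly (pderiv (p (Suc n))) x * poly (p (Suc (Suc n))) x
      = (poly (p (Suc n)) x)\<^sup>2 + t (Suc n) * (poly (pderiv (p (Suc n))) x * poly (p n) x
        - poly (pderiv (p n)) x * poly (p (Suc n)) x)"
    unfolding recurrence[OF Suc.prems]
    by (simp add: pderiv_mult pderiv_add pderiv_diff pderiv_smult pderiv_pCons algebra_simps power2_eq_square)
  also have "\<dots> > 0"
    using Suc positive[of "Suc n"] by (intro add_nonneg_pos mult_pos_pos) auto
  finally show ?case .
qed

text \<open>
  Real-rootedness is proved over the complex numbers, where the number of zeros is known.
\<close>

abbreviation P :: "nat \<Rightarrow> complex poly" where "P n \<equiv> map_poly complex_of_real (p n)"

lemma poly_P_of_real: "poly (map_poly complex_of_real q) (of_real x) = of_real (poly q x)"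
  by (induction q) (simp_all add: map_poly_pCons)

lemma pderiv_P: "pderiv (map_poly complex_of_real q) = map_poly complex_of_real (pderiv q)"
  by (rule poly_eqI) (simp add: coeff_pderiv coeff_map_poly)

lemma degree_P: "degree (P n) = n"
  by (simp add: degree_map_poly degree)

lemma recurrence_P:
  assumes "n \<le> N"
  shows "poly (P (Suc n)) z = (z - of_real (b n)) * poly (P n) z
    - of_real (t n) * (if n = 0 then 0 else poly (P (n - 1)) z)"
proof -
  have P: "P (Suc n) = [:- of_real (b n), 1:] * P n
      - smult (of_real (t n)) (if n = 0 then 0 else P (n - 1))"
    unfolding recurrence[OF assms]
    by (rule poly_eqI) (simp add: coeff_map_poly coeff_pCons split: nat.split)
  show ?thesis unfolding P by (simp add: algebra_simps)
qed

text \<open>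
  The Christoffel--Darboux argument at a point and its complex conjugate. The consequence used
  below is that the polynomials have no zero off the real line.
\<close>

lemma Im_consecutive:
  "n \<le> N \<Longrightarrow> \<exists>S>0. Im (poly (P (Suc n)) z * cnj (poly (P n) z)) = Im z * S"
proof (induction n)
  case 0
  show ?case using recurrence_P[of 0 z] by (intro exI[of _ 1]) (simp add: p_0 map_poly_1)
next
  case (Suc n)
  let ?q = "\<lambda>n. poly (P n) z"
  obtain S where S: "S > 0" "Im (?q (Suc n) * cnj (?q n)) = Im z * S"
    using Suc by auto
  have "?q (Suc (Suc n)) * cnj (?q (Suc n)) = (z - of_real (b (Suc n))) * (?q (Suc n) * cnj (?q (Suc n)))
      - of_real (t (Suc n)) * cnj (?q (Suc n) * cnj (?q n))"
    unfolding recurrence_P[OF Suc.prems] by (simp add: algebra_simps)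
  then have "?q (Suc (Suc n)) * cnj (?q (Suc n))
      = (z - of_real (b (Suc n))) * of_real ((cmod (?q (Suc n)))\<^sup>2)
        - of_real (t (Suc n)) * cnj (?q (Suc n) * cnj (?q n))"
    by (simp only: complex_norm_square)
  moreover have "Im ((z - of_real \<beta>) * of_real r - of_real \<tau> * cnj w) = Im z * r + \<tau> * Im w" for \<beta> r \<tau> w
    by simp
  ultimately have "Im (?q (Suc (Suc n)) * cnj (?q (Suc n)))
      = Im z * (cmod (?q (Suc n)))\<^sup>2 + t (Suc n) * Im (?q (Suc n) * cnj (?q n))"
    by (simp only:)
  also have "\<dots> = Im z * ((cmod (?q (Suc n)))\<^sup>2 + t (Suc n) * S)"
    unfolding S(2) by (simp add: algebra_simps)
  finally show ?case
    using S(1) Suc.prems positive[of "Suc n"]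
    by (intro exI[of _ "(cmod (?q (Suc n)))\<^sup>2 + t (Suc n) * S"]) (auto intro!: add_nonneg_pos)
qed

lemma rsquarefree_last: "rsquarefree (p (Suc N))"
  unfolding rsquarefree_roots using christoffel_darboux_confluent[of N] by (metis diff_self le_refl less_irrefl mult_zero_left mult_zero_right)

text \<open>
  All complex zeros are real, and they are simple, so their number equals the degree.
\<close>

lemma card_roots_last: "card {x. poly (p (Suc N)) x = 0} = Suc N"
proof -
  let ?Z = "{z. poly (P (Suc N)) z = 0}" and ?X = "{x. poly (p (Suc N)) x = 0}"
  have "p (Suc N) \<noteq> 0" using degree[of "Suc N"] by auto
  then have finX: "finite ?X" and le: "card ?X \<le> Suc N"
    using poly_roots_finite[of "p (Suc N)"] card_poly_roots_bound[of "p (Suc N)"] degree by auto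
  have real: "z \<in> of_real ` ?X" if "z \<in> ?Z" for z
  proof -
    have "Im z = 0" using Im_consecutive[of N z] that by auto
    then have "z = of_real (Re z)" by (simp add: complex_eq_iff)
    with that show ?thesis
      by (metis (mono_tags, lifting) imageI mem_Collect_eq of_real_eq_0_iff poly_P_of_real)
  qed
  have "rsquarefree (P (Suc N))"
    unfolding rsquarefree_roots
  proof (intro allI notI, elim conjE)
    fix z assume z: "poly (P (Suc N)) z = 0" "poly (pderiv (P (Suc N))) z = 0"
    then obtain x where "z = of_real x" "poly (p (Suc N)) x = 0" using real[of z] by auto
    with z have "poly (pderiv (p (Suc N))) x = 0" "poly (p (Suc N)) x = 0"
      by (simp_all add: pderiv_P poly_P_of_real)
    then show False using rsquarefree_last unfolding rsquarefree_roots by blast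
  qed
  then have "smult (lead_coeff (P (Suc N))) (\<Prod>z\<in>?Z. [:- z, 1:]) = P (Suc N)"
    by (rule complex_poly_decompose_rsquarefree)
  then have "degree (P (Suc N)) \<le> degree (\<Prod>z\<in>?Z. [:- z, 1:])"
    by (metis degree_smult_le)
  also have "\<dots> = card ?Z" by (subst degree_prod_eq_sum_degree) auto
  also have "\<dots> \<le> card (complex_of_real ` ?X)"
    using real finX by (intro card_mono) auto
  also have "\<dots> \<le> card ?X" by (rule card_image_le[OF finX])
  finally show ?thesis using le by (simp add: degree_P)
qed

text \<open>
  As the number of zeros is known, a list of \<open>N + 1\<close> points that contains all zeros has no
  repetitions and no superfluous points.
\<close>

lemma simple_root_gridI:
  assumes "\<And>z. poly (p (Suc N)) z = 0 \<Longrightarrow> z \<in> x ` {..N}"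
  shows "simple_root_grid (p (Suc N)) N x"
proof -
  let ?X = "{z. poly (p (Suc N)) z = 0}"
  have sub: "?X \<subseteq> x ` {..N}" using assms by auto
  have "card (x ` {..N}) \<le> card ?X"
    using card_image_le[of "{..N}" x] card_roots_last by simp
  then have eq: "?X = x ` {..N}" using sub by (intro card_seteq) auto
  have "card (x ` {..N}) = card {..N}" using card_roots_last eq by simp
  then have "inj_on x {..N}" by (intro eq_card_imp_inj_on) auto
  moreover have "order (x k) (p (Suc N)) = 1" if "k \<le> N" for k
    using rsquarefree_root_order[OF rsquarefree_last] eq that degree[of "Suc N"] by fastforce
  ultimately show ?thesis using eq by (simp add: simple_root_grid_def)
qed

lemma ex_simple_root_grid: "\<exists>x. simple_root_grid (p (Suc N)) N x"
proof -
  have "finite {z. poly (p (Suc N)) z = 0}" using card_roots_last card.infinite by fastforce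
  from ex_bij_betw_nat_finite[OF this] obtain x
    where "bij_betw x {0..<Suc N} {z. poly (p (Suc N)) z = 0}" by (auto simp: card_roots_last)
  then have "x ` {..N} = {z. poly (p (Suc N)) z = 0}"
    by (simp add: bij_betw_def atLeast0LessThan lessThan_Suc_atMost)
  then show ?thesis by (intro exI[of _ x] simple_root_gridI) auto
qed

lemma prod_t_pos: "0 < (\<Prod>i\<in>{n<..N}. t i)"
  by (rule prod_pos) (auto intro: positive)

context
  fixes x :: "nat \<Rightarrow> real"
  assumes grid: "simple_root_grid (p (Suc N)) N x"
begin

lemma grid_root: "k \<le> N \<Longrightarrow> poly (p (Suc N)) (x k) = 0"
  using grid by (auto simp: simple_root_grid_def)

lemma grid_inj: "inj_on x {..N}"
  using grid by (auto simp: simple_root_grid_def)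

lemma last_times_derivative_pos:
  "k \<le> N \<Longrightarrow> 0 < poly (p N) (x k) * poly (pderiv (p (Suc N))) (x k)"
  using christoffel_darboux_confluent[of N "x k"] grid_root[of k] by (simp add: mult.commute)

text \<open>
  The leading coefficient in Lagrange's interpolation formula on the zeros of \<open>p\<^sub>N\<^sub>+\<^sub>1\<close>.
\<close>

lemma lagrange_leading_coeff:
  assumes f: "degree f \<le> N"
  shows "(\<Sum>k\<le>N. poly f (x k) / poly (pderiv (p (Suc N))) (x k)) = coeff f N"
proof -
  let ?D = "\<lambda>k. poly (pderiv (p (Suc N))) (x k)"
  have "\<exists>q. p (Suc N) = [:- x k, 1:] * q" if "k \<le> N" for k
    using grid_root[OF that] by (simp add: poly_eq_0_iff_dvd dvd_def)
  then obtain q where q: "\<And>k. k \<le> N \<Longrightarrow> p (Suc N) = [:- x k, 1:] * q k" by metis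
  have q_diag: "poly (q k) (x k) = ?D k" if "k \<le> N" for k
    unfolding q[OF that] by (simp add: pderiv_add pderiv_diff pderiv_smult pderiv_pCons)
  have q_off: "poly (q k) (x j) = 0" if "k \<le> N" "j \<le> N" "j \<noteq> k" for j k
  proof -
    have "(x j - x k) * poly (q k) (x j) = 0"
      using grid_root[OF that(2)] unfolding q[OF that(1)] by (simp add: algebra_simps)
    moreover have "x j \<noteq> x k" using grid_inj that by (auto simp: inj_on_def)
    ultimately show ?thesis by simp
  qed
  have q_deg: "degree (q k) = N" and q_lead: "coeff (q k) N = 1" if "k \<le> N" for k
  proof -
    have "q k \<noteq> 0" using q[OF that] degree[of "Suc N"] by auto
    then have "degree ([:- x k, 1:] * q k) = Suc (degree (q k))" by (subst degree_mult_eq) auto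
    then show "degree (q k) = N" using q[OF that] degree[of "Suc N"] by simp
    then have "coeff (p (Suc N)) (Suc N) = coeff (q k) N"
      unfolding q[OF that] by (simp add: coeff_eq_0)
    then show "coeff (q k) N = 1" using monic[of "Suc N"] by simp
  qed
  define F where "F = (\<Sum>k\<le>N. smult (poly f (x k) / ?D k) (q k))"
  have "f = F"
  proof (rule poly_eqI_degree[of "x ` {..N}"])
    fix y assume "y \<in> x ` {..N}"
    then obtain j where j: "j \<le> N" "y = x j" by auto
    have "poly F y = (\<Sum>k\<le>N. poly f (x k) / ?D k * poly (q k) (x j))"
      by (simp add: F_def poly_sum j)
    also have "\<dots> = (\<Sum>k\<le>N. if k = j then poly f (x j) else 0)"
      using q_off q_diag last_times_derivative_pos[OF j(1)] j(1) by (intro sum.cong) auto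
    also have "\<dots> = poly f y" using j by simp
    finally show "poly f y = poly F y" by simp
  next
    have "card (x ` {..N}) = Suc N" using card_image[OF grid_inj] by simp
    moreover have "degree F \<le> N"
      unfolding F_def by (intro degree_sum_le) (auto simp: q_deg intro: order.trans[OF degree_smult_le])
    ultimately show "degree f < card (x ` {..N})" "degree F < card (x ` {..N})" using f by auto
  qed
  then have "coeff f N = coeff F N" by simp
  also have "\<dots> = (\<Sum>k\<le>N. poly f (x k) / ?D k)"
    by (simp add: F_def coeff_sum q_lead)
  finally show ?thesis by simp
qed

text \<open>
  For \<open>n = N\<close> the sum over the grid is a Lagrange sum, because the factor \<open>p\<^sub>N(x\<^sub>k)\<close> cancels
  against the weight. Multiplication by \<open>x\<close> is symmetric for the bilinear form \<open>M\<close>, so the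
  recurrence carries orthogonality from \<open>n + 1\<close> and \<open>n + 2\<close> down to \<open>n\<close>, multiplying the norm by
  \<open>1 / t\<^sub>n\<^sub>+\<^sub>1\<close>.
\<close>

lemma gauss_orthogonality:
  assumes w: "\<And>k. k \<le> N \<Longrightarrow> w k * (poly (p N) (x k) * poly (pderiv (p (Suc N))) (x k)) = \<gamma>"
  shows "discrete_orthogonal p N x w (\<lambda>n. \<gamma> / (\<Prod>i\<in>{n<..N}. t i))"
proof -
  define M where "M n m = (\<Sum>k\<le>N. w k * poly (p n) (x k) * poly (p m) (x k))" for n m
  define H where "H n = \<gamma> / (\<Prod>i\<in>{n<..N}. t i)" for n
  have H_step: "t (Suc n) * H n = H (Suc n)" if "n < N" for n
  proof -
    have "{n<..N} = insert (Suc n) {Suc n<..N}" using that by auto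
    then show ?thesis using positive[of "Suc n"] that by (simp add: H_def)
  qed
  have M_last: "M (Suc N) m = 0" "M m (Suc N) = 0" for m
    by (simp_all add: M_def grid_root)
  have rec: "x k * poly (p n) (x k) = poly (p (Suc n)) (x k) + b n * poly (p n) (x k)
      + t n * (if n = 0 then 0 else poly (p (n - 1)) (x k))" if "n \<le> N" for n k
    unfolding recurrence[OF that] by (simp add: algebra_simps)
  have M_rec: "M (Suc n) m + b n * M n m + (if n = 0 then 0 else t n * M (n - 1) m)
      = M n (Suc m) + b m * M n m + (if m = 0 then 0 else t m * M n (m - 1))"
    if "n \<le> N" "m \<le> N" for n m
  proof -
    have "(\<Sum>k\<le>N. w k * (x k * poly (p n) (x k)) * poly (p m) (x k))
        = (\<Sum>k\<le>N. w k * poly (p n) (x k) * (x k * poly (p m) (x k)))"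
      by (simp add: mult_ac)
    then show ?thesis
      unfolding rec[OF that(1)] rec[OF that(2)]
      by (cases "n = 0"; cases "m = 0")
        (simp_all add: M_def ring_distribs sum.distrib sum_distrib_left mult_ac)
  qed
  \<comment> \<open>row \<open>n\<close> of the Gram matrix is as claimed; row \<open>N + 1\<close> vanishes on the grid, which starts the descent\<close>
  define C where "C n \<longleftrightarrow> (\<forall>m\<le>N. M n m = (if n = m then H n else 0))" for n
  have C_last: "C (Suc N)" by (simp add: C_def M_last)
  have C_N: "C N"
    unfolding C_def
  proof (intro allI impI)
    fix m assume m: "m \<le> N"
    have "M N m = (\<Sum>k\<le>N. \<gamma> * (poly (p m) (x k) / poly (pderiv (p (Suc N))) (x k)))"
      unfolding M_def
    proof (intro sum.cong refl)
      fix k assume "k \<in> {..N}"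
      then have "k \<le> N" by simp
      from w[OF this] last_times_derivative_pos[OF this]
      show "w k * poly (p N) (x k) * poly (p m) (x k)
          = \<gamma> * (poly (p m) (x k) / poly (pderiv (p (Suc N))) (x k))"
        by (auto simp: field_simps)
    qed
    also have "\<dots> = \<gamma> * coeff (p m) N"
      by (simp only: sum_distrib_left[symmetric] lagrange_leading_coeff[of "p m"] degree m)
    also have "\<dots> = (if N = m then H N else 0)"
      using m monic[of N] by (auto simp: H_def coeff_eq_0 degree)
    finally show "M N m = (if N = m then H N else 0)" .
  qed
  have C_step: "C n" if "C (Suc n)" "C (Suc (Suc n))" "n < N" for n
    unfolding C_def
  proof (intro allI impI)
    fix m assume m: "m \<le> N"
    have up: "M (Suc n) (Suc m) = (if n = m then H (Suc n) else 0)"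
      using that m M_last by (cases "m = N") (auto simp: C_def)
    have "t (Suc n) * M n m = (if n = m then H (Suc n) else 0)"
      using M_rec[of "Suc n" m] that m up H_step[of "Suc n"]
      by (cases m) (auto simp: C_def split: if_splits)
    also have "\<dots> = t (Suc n) * (if n = m then H n else 0)"
      using H_step[OF that(3)] by auto
    finally show "M n m = (if n = m then H n else 0)"
      using positive[of "Suc n"] that(3) by simp
  qed
  have "d \<le> N \<Longrightarrow> C (N - d) \<and> C (Suc (N - d))" for d
  proof (induction d)
    case (Suc d)
    then have "Suc (N - Suc d) = N - d" by simp
    with Suc show ?case using C_step[of "N - Suc d"] by simp
  qed (use C_N C_last in simp)
  then have "C n" if "n \<le> N" for n using that by (metis diff_diff_cancel diff_le_self)
  then show ?thesis
    by (simp add: discrete_orthogonal_def C_def M_def H_def atLeast0AtMost)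
qed

end

end

section \<open>Values of truncated Wilson polynomials on their grids\<close>

text \<open>
  The Pfaff--Saalschuetz sum with all denominators cleared. Induction on \<open>n\<close> works term by term:
  with \<open>d = c - a - b\<close> the factor that is new on the right-hand side splits for every \<open>k\<close> as
  \<open>(c - a + n) (c - b + n) = (c + n + k) (d + n - k) + (a + k) (b + k)\<close>, and the two parts
  contribute to the terms with index \<open>k\<close> and \<open>k + 1\<close> of the next sum.
\<close>

lemma saalschuetz:
  fixes a b c :: "'a::field_char_0"
  shows "(\<Sum>k\<le>n. of_nat (n choose k) * pochhammer a k * pochhammer b k
      * pochhammer (c + of_nat k) (n - k) * pochhammer (c - a - b) (n - k))
    = pochhammer (c - a) n * pochhammer (c - b) n"
proof (induction n)
  case (Suc n)
  define d where "d = c - a - b"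
  define T where "T n k = of_nat (n choose k) * pochhammer a k * pochhammer b k
      * pochhammer (c + of_nat k) (n - k) * pochhammer d (n - k)" for n k
  have step: "T (Suc n) k = T n k * ((c + of_nat n + of_nat k) * (d + of_nat n - of_nat k))
      + (if k = 0 then 0 else T n (k - 1) * ((a + of_nat (k - 1)) * (b + of_nat (k - 1))))"
    if "k \<le> Suc n" for k
  proof (cases "k = Suc n")
    case True
    then show ?thesis by (simp add: T_def pochhammer_Suc)
  next
    case False
    with that obtain m where n: "n = k + m" by (metis le_SucE le_Suc_ex)
    define U where "U = pochhammer a k * pochhammer b k * pochhammer (c + of_nat k) m * pochhammer d m"
    have sub: "Suc n - k = Suc m" "n - k = m" by (simp_all add: n)
    have 1: "T (Suc n) k = of_nat (Suc n choose k) * U * ((c + of_nat n) * (d + of_nat m))"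
      unfolding T_def U_def sub by (simp add: pochhammer_Suc n add_ac)
    have 2: "T n k = of_nat (n choose k) * U"
      unfolding T_def U_def sub by simp
    have 3: "(if k = 0 then 0 else T n (k - 1) * ((a + of_nat (k - 1)) * (b + of_nat (k - 1))))
        = of_nat k * of_nat (n choose k) / of_nat (Suc m) * U * ((c + of_nat k - 1) * (d + of_nat m))"
    proof (cases k)
      case (Suc k')
      have choose: "of_nat (n choose k') = of_nat k * of_nat (n choose k) / (of_nat (Suc m) :: 'a)"
        using of_nat_choose_Suc_right[where 'a = 'a, of k' m] by (simp add: n Suc)
      have k': "k - 1 = k'" "n - k' = Suc m" by (simp_all add: n Suc)
      have "pochhammer (c + of_nat k') (Suc m) = (c + of_nat k - 1) * pochhammer (c + of_nat k) m"
        by (simp add: pochhammer_rec Suc add_ac)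
      then show ?thesis
        unfolding T_def k' choose U_def by (simp add: pochhammer_Suc Suc)
    qed simp
    have 4: "of_nat (Suc n choose k) = of_nat (Suc n) * of_nat (n choose k) / (of_nat (Suc m) :: 'a)"
      by (simp add: n of_nat_choose_Suc_left)
    have m: "of_nat (Suc m) \<noteq> (0::'a)" by (rule of_nat_neq_0)
    define C where "C = of_nat (n choose k) * U * (d + of_nat m) / of_nat (Suc m)"
    have "T (Suc n) k = C * (of_nat (Suc n) * (c + of_nat n))"
      unfolding 1 4 C_def using m by (simp add: divide_simps del: of_nat_Suc)
    also have "of_nat (Suc n) * (c + of_nat n)
        = (c + of_nat n + of_nat k) * of_nat (Suc m) + of_nat k * (c + of_nat k - 1)"
      unfolding n of_nat_add of_nat_Suc by algebra
    also have "d + of_nat m = d + of_nat n - of_nat k" by (simp add: n)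
    then have "C * ((c + of_nat n + of_nat k) * of_nat (Suc m) + of_nat k * (c + of_nat k - 1))
        = T n k * ((c + of_nat n + of_nat k) * (d + of_nat n - of_nat k))
        + (if k = 0 then 0 else T n (k - 1) * ((a + of_nat (k - 1)) * (b + of_nat (k - 1))))"
      unfolding distrib_left[of C] unfolding 2 3 C_def using m
      by (simp add: divide_simps del: of_nat_Suc)
    finally show ?thesis .
  qed
  have T_beyond: "T n (Suc n) = 0" by (simp add: T_def)
  have "(\<Sum>k\<le>Suc n. T (Suc n) k)
      = (\<Sum>k\<le>Suc n. T n k * ((c + of_nat n + of_nat k) * (d + of_nat n - of_nat k)))
      + (\<Sum>k\<le>Suc n. if k = 0 then 0 else T n (k - 1) * ((a + of_nat (k - 1)) * (b + of_nat (k - 1))))"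
    unfolding sum.distrib[symmetric] by (intro sum.cong refl step) simp
  also have "(\<Sum>k\<le>Suc n. if k = 0 then 0 else T n (k - 1) * ((a + of_nat (k - 1)) * (b + of_nat (k - 1))))
      = (\<Sum>k\<le>n. T n k * ((a + of_nat k) * (b + of_nat k)))"
    by (subst sum.atMost_Suc_shift) simp
  also have "(\<Sum>k\<le>Suc n. T n k * ((c + of_nat n + of_nat k) * (d + of_nat n - of_nat k)))
      = (\<Sum>k\<le>n. T n k * ((c + of_nat n + of_nat k) * (d + of_nat n - of_nat k)))"
    by (simp add: T_beyond)
  also have "\<dots> + (\<Sum>k\<le>n. T n k * ((a + of_nat k) * (b + of_nat k)))
      = (\<Sum>k\<le>n. T n k) * ((c - a + of_nat n) * (c - b + of_nat n))"
    unfolding sum.distrib[symmetric] sum_distrib_right d_def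
    by (intro sum.cong refl) (simp add: algebra_simps)
  also have "(\<Sum>k\<le>n. T n k) = pochhammer (c - a) n * pochhammer (c - b) n"
    using Suc.IH by (simp add: T_def d_def)
  finally show ?case
    unfolding T_def d_def by (simp only: pochhammer_Suc mult_ac)
qed simp

text \<open>
  The binomial coefficient makes the expansion terminate at \<open>k = j\<close> on the grid point \<open>e + j\<close>.
\<close>

lemma poly_wilson_basis_grid:
  "poly (wilson_basis e k) ((e + of_nat j)\<^sup>2)
     = fact k * of_nat (j choose k) * pochhammer (2 * e + of_nat j) k"
proof (induction k)
  case (Suc k)
  have choose: "fact (Suc k) * (of_nat j gchoose Suc k)
      = fact k * (of_nat j gchoose k) * (of_nat j - of_nat k :: 'a)"
    using gbinomial_mult_fact[of "Suc k" "of_nat j :: 'a"] gbinomial_mult_fact[of k "of_nat j :: 'a"]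
    by simp
  have "poly (wilson_basis e (Suc k)) ((e + of_nat j)\<^sup>2)
      = ((e + of_nat j)\<^sup>2 - (e + of_nat k)\<^sup>2) * poly (wilson_basis e k) ((e + of_nat j)\<^sup>2)"
    by (simp add: wilson_basis_Suc algebra_simps)
  also have "(e + of_nat j)\<^sup>2 - (e + of_nat k)\<^sup>2
      = (of_nat j - of_nat k) * (2 * e + of_nat j + of_nat k)"
    by (simp add: power2_eq_square algebra_simps)
  finally show ?case
    unfolding Suc pochhammer_Suc binomial_gbinomial choose by (simp only: mult_ac)
qed simp

text \<open>
  Since \<open>e + p = - M\<close>, the upper parameter \<open>- M\<close> of the \<open>\<^sub>4F\<^sub>3\<close> cancels against a lower one. At
  \<open>x = e + j\<close> the rest is a balanced \<open>\<^sub>3F\<^sub>2\<close> with upper parameters \<open>- j\<close>, \<open>2 e + j\<close>, \<open>q + s - 1\<close>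
  and lower parameters \<open>e + q\<close>, \<open>e + s\<close>.
\<close>

lemma wilson_at_grid:
  fixes e p q s :: "'a::field_char_0"
  assumes p: "e + p = - of_nat M" and j: "j \<le> M" and nz: "pochhammer (q + s - 1) M \<noteq> 0"
  shows "poly (wilson e p q s M) ((e + of_nat j)\<^sup>2) = (-1) ^ M * fact M / pochhammer (q + s - 1) M
    * (pochhammer (e + q + of_nat j) (M - j) * pochhammer (e + s + of_nat j) (M - j))
    * (pochhammer (e - q + 1) j * pochhammer (e - s + 1) j)"
proof -
  define F where "F = (-1) ^ M * fact M / pochhammer (q + s - 1) M
    * (pochhammer (e + q + of_nat j) (M - j) * pochhammer (e + s + of_nat j) (M - j))"
  have summand: "wilson_coeff e p q s M k * poly (wilson_basis e k) ((e + of_nat j)\<^sup>2)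
      = F * (-1) ^ j * (of_nat (j choose k) * pochhammer (2 * e + of_nat j) k * pochhammer (q + s - 1) k
        * pochhammer (e + q + of_nat k) (j - k) * pochhammer (e + q - (2 * e + of_nat j) - (q + s - 1)) (j - k))"
    if k: "k \<le> j" for k
  proof -
    have "k \<le> M" using k j by simp
    have choose: "of_nat (M choose k) * pochhammer (e + p + of_nat k) (M - k) * fact k
        = (-1) ^ (M - k) * (fact M :: 'a)"
    proof -
      have "e + p + of_nat k = - of_nat (M - k)" using \<open>k \<le> M\<close> by (simp add: p of_nat_diff)
      then have "pochhammer (e + p + of_nat k) (M - k) = (-1) ^ (M - k) * fact (M - k)"
        by (simp only: pochhammer_same)
      moreover have "fact k * fact (M - k) * of_nat (M choose k) = (fact M :: 'a)"
        by (rule binomial_fact_lemma[OF \<open>k \<le> M\<close>, THEN arg_cong[where f = "of_nat :: nat \<Rightarrow> 'a"], simplified])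
      ultimately show ?thesis by (simp add: mult_ac)
    qed
    have split: "pochhammer (x + of_nat k) (M - k)
        = pochhammer (x + of_nat k) (j - k) * pochhammer (x + of_nat j) (M - j)" for x :: 'a
      using pochhammer_product[of "j - k" "M - k" "x + of_nat k"] k j
      by (simp add: of_nat_diff)
    have qs: "pochhammer (q + s - 1) M = pochhammer (q + s - 1) k * pochhammer (q + s - 1 + of_nat k) (M - k)"
      by (rule pochhammer_product[OF \<open>k \<le> M\<close>])
    have den: "e + p + q + s + of_nat M + of_nat k - 1 = q + s - 1 + of_nat k"
      by (simp add: p)
    have neg: "pochhammer (e + q - (2 * e + of_nat j) - (q + s - 1)) (j - k)
        = (-1) ^ (j - k) * pochhammer (e + s + of_nat k) (j - k)"
      using pochhammer_minus[of "e + s + of_nat j - 1" "j - k"] k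
      by (simp add: of_nat_diff algebra_simps)
    have sign: "(-1) ^ (M - k) = (-1) ^ M * (-1) ^ j * (-1 :: 'a) ^ (j - k)"
      using k j by (simp add: power_add[symmetric] minus_one_power_iff)
    have "wilson_coeff e p q s M k * poly (wilson_basis e k) ((e + of_nat j)\<^sup>2)
      = (of_nat (M choose k) * pochhammer (e + p + of_nat k) (M - k) * fact k)
        * (of_nat (j choose k) * pochhammer (2 * e + of_nat j) k)
        * (pochhammer (e + q + of_nat k) (M - k) * pochhammer (e + s + of_nat k) (M - k))
        / pochhammer (q + s - 1 + of_nat k) (M - k)"
      unfolding wilson_coeff_def den poly_wilson_basis_grid by (simp add: mult_ac)
    also have "\<dots> = F * (-1) ^ j * (of_nat (j choose k) * pochhammer (2 * e + of_nat j) k * pochhammer (q + s - 1) k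
        * pochhammer (e + q + of_nat k) (j - k) * ((-1) ^ (j - k) * pochhammer (e + s + of_nat k) (j - k)))"
      unfolding choose sign F_def split[of "e + q"] split[of "e + s"] qs
      using nz[unfolded qs] by (simp add: divide_simps)
    finally show ?thesis unfolding neg .
  qed
  have "poly (wilson e p q s M) ((e + of_nat j)\<^sup>2)
      = (\<Sum>k\<le>M. wilson_coeff e p q s M k * poly (wilson_basis e k) ((e + of_nat j)\<^sup>2))"
    by (simp add: wilson_def poly_sum)
  also have "\<dots> = (\<Sum>k\<le>j. wilson_coeff e p q s M k * poly (wilson_basis e k) ((e + of_nat j)\<^sup>2))"
    by (rule sum.mono_neutral_right) (use j in \<open>auto simp: poly_wilson_basis_grid\<close>)
  also have "\<dots> = F * (-1) ^ j * (pochhammer (e + q - (2 * e + of_nat j)) j * pochhammer (e + q - (q + s - 1)) j)"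
    unfolding saalschuetz[symmetric] sum_distrib_left by (intro sum.cong refl summand) simp
  also have "pochhammer (e + q - (2 * e + of_nat j)) j = (-1) ^ j * pochhammer (e - q + 1) j"
    using pochhammer_minus[of "e - q + of_nat j" j] by (simp add: algebra_simps)
  also have "e + q - (q + s - 1) = e - s + 1" by simp
  finally show ?thesis unfolding F_def by (simp add: power_add[symmetric] mult_ac)
qed

text \<open>
  This is the derivative at \<open>x = e + j\<close> of \<open>\<Prod>\<^sub>i (x\<^sup>2 - (e + i)\<^sup>2)\<close>. The product of
  the \<open>2 e + i + j\<close> over \<open>i \<noteq> j\<close> is a Pochhammer symbol without the factor \<open>2 (e + j)\<close>, which the
  inner derivative supplies.
\<close>

lemma prod_grid_differences:
  fixes e :: "'a::field_char_0"
  assumes "j \<le> M"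
  shows "2 * (e + of_nat j) * (\<Prod>i\<in>{..M} - {j}. (e + of_nat j)\<^sup>2 - (e + of_nat i)\<^sup>2)
    = (-1) ^ (M - j) * fact j * fact (M - j) * pochhammer (2 * e + of_nat j) (Suc M)"
proof -
  have diff: "(\<Prod>i\<in>{..M} - {j}. of_nat j - of_nat i) = (-1) ^ (M - j) * fact j * (fact (M - j) :: 'a)"
    using assms
  proof (induction M rule: dec_induct)
    case base
    have "{..j} - {j} = {..<j}" by auto
    moreover have "(\<Prod>i<j. of_nat j - of_nat i) = (fact j :: 'a)"
      unfolding fact_prod_rev by (auto simp: atLeast0LessThan of_nat_diff intro!: prod.cong)
    ultimately show ?case by simp
  next
    case (step M)
    have "{..Suc M} - {j} = insert (Suc M) ({..M} - {j})" using step.hyps by auto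
    moreover have "of_nat j - of_nat (Suc M) = - (of_nat (Suc M - j) :: 'a)"
      using step.hyps by (simp add: of_nat_diff)
    ultimately show ?case
      using step by (simp add: Suc_diff_le del: of_nat_Suc of_nat_diff)
  qed
  have "(\<Prod>i\<in>{..M} - {j}. (e + of_nat j)\<^sup>2 - (e + of_nat i)\<^sup>2)
      = (\<Prod>i\<in>{..M} - {j}. of_nat j - of_nat i) * (\<Prod>i\<in>{..M} - {j}. 2 * e + of_nat j + of_nat i)"
    unfolding prod.distrib[symmetric]
    by (intro prod.cong refl) (simp add: power2_eq_square algebra_simps)
  moreover have "pochhammer (2 * e + of_nat j) (Suc M)
      = 2 * (e + of_nat j) * (\<Prod>i\<in>{..M} - {j}. 2 * e + of_nat j + of_nat i)"
    unfolding pochhammer_Suc_prod atLeast0AtMost using assms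
    by (subst prod.remove[of _ j]) (auto simp: algebra_simps)
  ultimately show ?thesis by (simp add: diff)
qed

lemma prod_grid_differences_shifted:
  fixes e :: "'a::field_char_0"
  assumes "1 \<le> j" "j \<le> M"
  shows "2 * (e + of_nat j) * (\<Prod>i\<in>{1..M} - {j}. (e + of_nat j)\<^sup>2 - (e + of_nat i)\<^sup>2)
    = (-1) ^ (M - j) * fact (j - 1) * fact (M - j) * pochhammer (2 * e + of_nat j + 1) M"
proof -
  obtain j' M' where j: "j = Suc j'" and M: "M = Suc M'" using assms by (metis Suc_le_D One_nat_def le_trans)
  have "{1..M} - {j} = Suc ` ({..M'} - {j'})"
    unfolding M j image_set_diff[OF inj_Suc] by (simp add: image_Suc_atMost)
  then have "(\<Prod>i\<in>{1..M} - {j}. (e + of_nat j)\<^sup>2 - (e + of_nat i)\<^sup>2)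
      = (\<Prod>i\<in>{..M'} - {j'}. (e + 1 + of_nat j')\<^sup>2 - (e + 1 + of_nat i)\<^sup>2)"
    by (simp add: prod.reindex j add_ac)
  then show ?thesis
    using prod_grid_differences[of j' M' "e + 1"] assms by (simp add: j M algebra_simps)
qed

text \<open>
  The factor that the weights at the two grid points \<open>e + j\<close> and \<open>- (e + j)\<close> have in common.
\<close>

definition wilson_weight :: "'a::field_char_0 \<Rightarrow> 'a \<Rightarrow> 'a \<Rightarrow> 'a \<Rightarrow> nat \<Rightarrow> 'a" where
  "wilson_weight e p q s j =
    pochhammer (e + p) j * pochhammer (e + q) j * pochhammer (e + s) j
    / (pochhammer (e - p + 1) j * pochhammer (e - q + 1) j * pochhammer (e - s + 1) j)"

text \<open>
  The products in the weight and in the value at the grid point merge to Pochhammer symbols of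
  length \<open>M\<close>. The remaining dependence on \<open>j\<close> is what the derivative of the next polynomial
  compensates.
\<close>

lemma wilson_weight_times_value_aux:
  fixes e p q s :: "'a::field_char_0"
  assumes p: "e + p = - of_nat M"
    and reg: "pochhammer (e + p + q + s + of_nat M - 1) M \<noteq> 0"
    and nz: "pochhammer (e - p + 1) M \<noteq> 0" "pochhammer (e - q + 1) M \<noteq> 0" "pochhammer (e - s + 1) M \<noteq> 0"
  shows "\<exists>\<Gamma>. \<forall>j\<le>M. (-1) ^ (M - j) * fact (M - j) * pochhammer (2 * e + of_nat M + 1) j
      * (wilson_weight e p q s j * poly (wilson e p q s M) ((e + of_nat j)\<^sup>2)) = \<Gamma>"
proof (intro exI allI impI)
  fix j assume j: "j \<le> M"
  have qs: "pochhammer (q + s - 1) M \<noteq> 0" using reg by (simp add: p)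
  have nz': "pochhammer (e - p + 1) j \<noteq> 0" "pochhammer (e - q + 1) j \<noteq> 0" "pochhammer (e - s + 1) j \<noteq> 0"
    using nz pochhammer_neq_0_mono[OF _ j] by blast+
  have p': "2 * e + of_nat M + 1 = e - p + 1"
  proof -
    have "of_nat M = - (e + p)" by (simp add: p)
    then show ?thesis by simp
  qed
  have fact: "(-1) ^ (M - j) * fact (M - j) * pochhammer (e + p) j = (-1) ^ M * (fact M :: 'a)"
  proof -
    have "pochhammer (- of_nat M :: 'a) M = pochhammer (- of_nat M) j * pochhammer (- of_nat M + of_nat j) (M - j)"
      by (rule pochhammer_product[OF j])
    moreover have "- of_nat M + of_nat j = - (of_nat (M - j) :: 'a)" using j by (simp add: of_nat_diff)
    ultimately show ?thesis by (simp add: p pochhammer_same mult_ac)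
  qed
  have split: "pochhammer x M = pochhammer x j * pochhammer (x + of_nat j) (M - j)" for x :: 'a
    by (rule pochhammer_product[OF j])
  have "(-1) ^ (M - j) * fact (M - j) * pochhammer (2 * e + of_nat M + 1) j
      * (wilson_weight e p q s j * poly (wilson e p q s M) ((e + of_nat j)\<^sup>2))
    = ((-1) ^ (M - j) * fact (M - j) * pochhammer (e + p) j) * ((-1) ^ M * fact M / pochhammer (q + s - 1) M
      * (pochhammer (e + q) M * pochhammer (e + s) M))"
    unfolding wilson_at_grid[OF p j qs] wilson_weight_def p' split[of "e + q"] split[of "e + s"]
    using nz' by (simp add: divide_simps)
  then show "(-1) ^ (M - j) * fact (M - j) * pochhammer (2 * e + of_nat M + 1) j
      * (wilson_weight e p q s j * poly (wilson e p q s M) ((e + of_nat j)\<^sup>2))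
    = (-1) ^ M * fact M * ((-1) ^ M * fact M / pochhammer (q + s - 1) M
      * (pochhammer (e + q) M * pochhammer (e + s) M))"
    unfolding fact .
qed

lemma wilson_swap12: "wilson e q p s n = wilson e p q s n"
  by (simp add: wilson_def wilson_coeff_def add_ac mult_ac)

lemma wilson_swap13: "wilson e s q p n = wilson e p q s n"
  by (simp add: wilson_def wilson_coeff_def add_ac mult_ac)

lemma wilson_weight_times_value:
  fixes e p q s :: "'a::field_char_0"
  assumes "e + p = - of_nat M \<or> e + q = - of_nat M \<or> e + s = - of_nat M"
    and reg: "pochhammer (e + p + q + s + of_nat M - 1) M \<noteq> 0"
    and nz: "pochhammer (e - p + 1) M \<noteq> 0" "pochhammer (e - q + 1) M \<noteq> 0" "pochhammer (e - s + 1) M \<noteq> 0"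
  shows "\<exists>\<Gamma>. \<forall>j\<le>M. (-1) ^ (M - j) * fact (M - j) * pochhammer (2 * e + of_nat M + 1) j
      * (wilson_weight e p q s j * poly (wilson e p q s M) ((e + of_nat j)\<^sup>2)) = \<Gamma>"
  using assms(1)
proof (elim disjE)
  assume "e + p = - of_nat M"
  then show ?thesis by (rule wilson_weight_times_value_aux[OF _ reg nz])
next
  assume "e + q = - of_nat M"
  from wilson_weight_times_value_aux[OF this _ nz(2,1,3)] reg
  show ?thesis by (simp add: wilson_swap12[of e q p] wilson_weight_def add_ac mult_ac)
next
  assume "e + s = - of_nat M"
  from wilson_weight_times_value_aux[OF this _ nz(3,2,1)] reg
  show ?thesis by (simp add: wilson_swap13[of e s q p] wilson_weight_def add_ac mult_ac)
qed

text \<open>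
  For \<open>k < n\<close> the Pochhammer symbol that belongs to the sum \<open>1 - n\<close> contains the factor \<open>0\<close>, so only
  the leading term is left.
\<close>

lemma wilson_truncated:
  fixes e p q s :: "'a::field_char_0"
  assumes "e + p = 1 - of_nat n \<or> e + q = 1 - of_nat n \<or> e + s = 1 - of_nat n"
  shows "wilson e p q s n = wilson_basis e n"
proof -
  have "wilson_coeff e p q s n k = 0" if "k < n" for k
  proof -
    have "pochhammer (1 - of_nat n + of_nat k :: 'a) (n - k) = 0"
      unfolding pochhammer_eq_0_iff using that
      by (intro exI[of _ "n - k - 1"]) (simp add: of_nat_diff)
    then show ?thesis using assms unfolding wilson_coeff_def by auto
  qed
  then have "wilson e p q s n = (\<Sum>k\<le>n. if k = n then wilson_basis e n else 0)"
    unfolding wilson_def by (intro sum.cong refl) auto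
  then show ?thesis by simp
qed

section \<open>Explicit grids and weights\<close>

lemma pderiv_at_root:
  fixes p :: "real poly"
  assumes "\<And>y. poly p y = (y - x) * f y" "isCont f x"
  shows "poly (pderiv p) x = f x"
proof -
  have "DERIV (poly p) x :> f x"
    unfolding CARAT_DERIV using assms by (intro exI[of _ f]) (simp add: mult.commute)
  with poly_DERIV show ?thesis by (rule DERIV_unique)
qed

text \<open>
  Weights that make \<open>w\<^sub>k p\<^sub>N(x\<^sub>k) p'\<^sub>N\<^sub>+\<^sub>1(x\<^sub>k)\<close> constant all have the sign of that constant.
\<close>

lemma (in positive_recurrence) explicit_weights:
  assumes grid: "simple_root_grid (p (Suc N)) N x"
    and w: "\<And>k. k \<le> N \<Longrightarrow> w k * (poly (p N) (x k) * poly (pderiv (p (Suc N))) (x k)) = \<gamma>"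
    and "w 0 \<noteq> 0"
  shows "(\<forall>k\<le>N. sgn (w 0) * w k > 0) \<and>
    (\<exists>h. (\<forall>n\<le>N. sgn (w 0) * h n > 0) \<and> discrete_orthogonal p N x w h)"
proof -
  let ?c = "\<lambda>k. poly (p N) (x k) * poly (pderiv (p (Suc N))) (x k)"
  have c: "0 < ?c k" if "k \<le> N" for k
    using last_times_derivative_pos[OF grid that] .
  have sgn: "sgn (w 0) = sgn \<gamma>"
    unfolding w[of 0, symmetric, simplified] sgn_mult using c[of 0] by (simp add: sgn_mult[symmetric])
  have "\<gamma> \<noteq> 0" using assms(3) w[of 0] c[of 0] by auto
  then have "0 < sgn \<gamma> * \<gamma>" by (simp add: sgn_if)
  moreover have "w k = \<gamma> / ?c k" if "k \<le> N" for k
    unfolding w[OF that, symmetric]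
    by (rule nonzero_mult_div_cancel_right[OF less_imp_neq[OF c[OF that], symmetric], symmetric])
  ultimately show ?thesis
    unfolding sgn using c prod_t_pos gauss_orthogonality[OF grid w]
    by (intro conjI exI[of _ "\<lambda>n. \<gamma> / (\<Prod>i\<in>{n<..N}. t i)"]) auto
qed

lemma positive_recurrence_CBI:
  assumes "bi_regular \<rho>1 \<rho>2 r1 r2 (N + 2)" "\<forall>n\<in>{1..N}. cbi_tau \<rho>1 \<rho>2 r1 r2 n > 0"
  shows "positive_recurrence (CBI \<rho>1 \<rho>2 r1 r2) (\<lambda>n. (-1) ^ n * \<rho>2) (cbi_tau \<rho>1 \<rho>2 r1 r2) N"
proof
  fix n
  show "degree (CBI \<rho>1 \<rho>2 r1 r2 n) = n" "coeff (CBI \<rho>1 \<rho>2 r1 r2 n) n = 1"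
    using CBI_monic[of \<rho>1 \<rho>2 r1 r2 n] by metis+
  show "CBI \<rho>1 \<rho>2 r1 r2 (Suc n) = [:- ((-1) ^ n * \<rho>2), 1:] * CBI \<rho>1 \<rho>2 r1 r2 n
     - smult (cbi_tau \<rho>1 \<rho>2 r1 r2 n) (if n = 0 then 0 else CBI \<rho>1 \<rho>2 r1 r2 (n - 1))" if "n \<le> N"
    by (rule CBI_recurrence_regular) (use assms that in \<open>auto elim: bi_regular_mono\<close>)
  show "0 < cbi_tau \<rho>1 \<rho>2 r1 r2 n" if "1 \<le> n" "n \<le> N" using assms that by auto
qed

lemma bi_weight_0 [simp]: "bi_weight 0 \<rho>1 \<rho>2 r1 r2 = 1"
  by (simp add: bi_weight_def bi_weight_denom_def)

lemma cbi_explicitI: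
  assumes pos: "positive_recurrence (CBI \<rho>1 \<rho>2 r1 r2) b t N"
    and roots: "\<And>z. poly (CBI \<rho>1 \<rho>2 r1 r2 (N + 1)) z = 0 \<Longrightarrow> z \<in> x ` {..N}"
    and w0: "w 0 = 1"
    and const: "inj_on x {..N} \<Longrightarrow> \<forall>k\<le>N. d k \<noteq> 0 \<Longrightarrow> x 0 \<noteq> \<rho>1 \<Longrightarrow>
      \<exists>\<gamma>. \<forall>k\<le>N. (x k - \<rho>1) * w k * (poly (CBI \<rho>1 \<rho>2 r1 r2 N) (x k)
          * poly (pderiv (CBI \<rho>1 \<rho>2 r1 r2 (N + 1))) (x k)) = \<gamma>"
  shows "cbi_explicit_orthogonality \<rho>1 \<rho>2 r1 r2 N x d w"
proof -
  interpret positive_recurrence "CBI \<rho>1 \<rho>2 r1 r2" b t N by (rule pos)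
  have grid: "simple_root_grid (CBI \<rho>1 \<rho>2 r1 r2 (Suc N)) N x"
    using roots by (intro simple_root_gridI) simp
  show ?thesis
    unfolding cbi_explicit_orthogonality_def
  proof (intro conjI[OF _ impI], goal_cases)
    case 1
    show ?case using grid by simp
  next
    case 2
    then obtain \<gamma> where "\<And>k. k \<le> N \<Longrightarrow> (x k - \<rho>1) * w k * (poly (CBI \<rho>1 \<rho>2 r1 r2 N) (x k)
          * poly (pderiv (CBI \<rho>1 \<rho>2 r1 r2 (Suc N))) (x k)) = \<gamma>"
      using const[OF grid_inj[OF grid]] by auto
    from explicit_weights[OF grid, of "\<lambda>k. (x k - \<rho>1) * w k", OF this] show ?case
      using 2 by (simp add: w0)
  qed
qed

text \<open>
  The factor \<open>x\<^sub>k - \<rho>\<^sub>1\<close> cancels the last factor of \<open>(\<rho>\<^sub>2 - \<rho>\<^sub>1 + 1)\<^sub>l\<close> in the denominator at even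
  \<open>k\<close>, and prolongs \<open>(\<rho>\<^sub>1 + \<rho>\<^sub>2 + 1)\<^sub>l\<close> by one factor at odd \<open>k\<close>. Either way the Pochhammer symbols
  of \<open>wilson_weight\<close> appear, up to the constant \<open>\<rho>\<^sub>2 - \<rho>\<^sub>1\<close>.
\<close>

lemma bi_weight_rho2_even:
  fixes \<rho>1 \<rho>2 r1 r2 :: real
  defines "V \<equiv> wilson_weight \<rho>2 (\<rho>1 + 1) (1/2 - r1) (1/2 - r2)"
  assumes d: "bi_weight_denom (2 * l) \<rho>2 \<rho>1 r1 r2 \<noteq> 0" and "\<rho>2 \<noteq> \<rho>1"
  shows "(\<rho>2 + of_nat l - \<rho>1) * bi_weight (2 * l) \<rho>2 \<rho>1 r1 r2
    = (\<rho>2 - \<rho>1) * V l * pochhammer (2 * \<rho>2 + 1) l / fact l"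
proof -
  have sh: "(\<rho>2 - \<rho>1) * pochhammer (\<rho>2 - \<rho>1 + 1) l = pochhammer (\<rho>2 - \<rho>1) l * (\<rho>2 - \<rho>1 + of_nat l)"
    by (rule pochhammer_shift)
  then have nz: "pochhammer (\<rho>2 - \<rho>1) l * (\<rho>2 - \<rho>1 + of_nat l) \<noteq> 0"
    using d \<open>\<rho>2 \<noteq> \<rho>1\<close> by (auto simp: bi_weight_denom_def)
  have q: "pochhammer (\<rho>2 - \<rho>1 + 1) l = pochhammer (\<rho>2 - \<rho>1) l * (\<rho>2 - \<rho>1 + of_nat l) / (\<rho>2 - \<rho>1)"
    using sh \<open>\<rho>2 \<noteq> \<rho>1\<close> by (simp add: field_simps)
  have args: "\<rho>2 + (\<rho>1 + 1) = \<rho>2 + \<rho>1 + 1" "\<rho>2 + (1/2 - r1) = \<rho>2 - r1 + 1/2" "\<rho>2 + (1/2 - r2) = \<rho>2 - r2 + 1/2"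
    "\<rho>2 - (\<rho>1 + 1) + 1 = \<rho>2 - \<rho>1" "\<rho>2 - (1/2 - r1) + 1 = \<rho>2 + r1 + 1/2" "\<rho>2 - (1/2 - r2) + 1 = \<rho>2 + r2 + 1/2"
    by simp_all
  have nz': "pochhammer (\<rho>2 + r1 + 1/2) l \<noteq> 0" "pochhammer (\<rho>2 + r2 + 1/2) l \<noteq> 0"
    using d by (auto simp: bi_weight_denom_def)
  have x: "\<rho>2 + of_nat l - \<rho>1 = \<rho>2 - \<rho>1 + of_nat l" by simp
  show ?thesis
    unfolding V_def wilson_weight_def args bi_weight_def bi_weight_denom_def Let_def x
    using nz nz' \<open>\<rho>2 \<noteq> \<rho>1\<close> by (simp add: q divide_simps)
qed

lemma bi_weight_rho2_odd:
  fixes \<rho>1 \<rho>2 r1 r2 :: real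
  defines "V \<equiv> wilson_weight \<rho>2 (\<rho>1 + 1) (1/2 - r1) (1/2 - r2)"
  assumes d: "bi_weight_denom (2 * l + 1) \<rho>2 \<rho>1 r1 r2 \<noteq> 0" and "\<rho>2 \<noteq> \<rho>1"
  shows "(- (\<rho>2 + of_nat (Suc l)) - \<rho>1) * bi_weight (2 * l + 1) \<rho>2 \<rho>1 r1 r2
    = (\<rho>2 - \<rho>1) * V (Suc l) * pochhammer (2 * \<rho>2 + 1) l / fact l"
proof -
  have q: "pochhammer (\<rho>2 - \<rho>1) (Suc l) = (\<rho>2 - \<rho>1) * pochhammer (\<rho>2 - \<rho>1 + 1) l"
    by (rule pochhammer_rec)
  have args: "\<rho>2 + (\<rho>1 + 1) = \<rho>2 + \<rho>1 + 1" "\<rho>2 + (1/2 - r1) = \<rho>2 - r1 + 1/2" "\<rho>2 + (1/2 - r2) = \<rho>2 - r2 + 1/2"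
    "\<rho>2 - (\<rho>1 + 1) + 1 = \<rho>2 - \<rho>1" "\<rho>2 - (1/2 - r1) + 1 = \<rho>2 + r1 + 1/2" "\<rho>2 - (1/2 - r2) + 1 = \<rho>2 + r2 + 1/2"
    by simp_all
  have nz: "pochhammer (\<rho>2 + r1 + 1/2) (Suc l) \<noteq> 0" "pochhammer (\<rho>2 + r2 + 1/2) (Suc l) \<noteq> 0"
    "pochhammer (\<rho>2 - \<rho>1 + 1) l \<noteq> 0"
    using d by (auto simp: bi_weight_denom_def)
  define Y where "Y = \<rho>2 + \<rho>1 + 1 + of_nat l"
  have x: "- (\<rho>2 + of_nat (Suc l)) - \<rho>1 = - Y" by (simp add: Y_def)
  have k: "(2 * l + 1) div 2 = l" "(2 * l + 1) mod 2 = 1" "l + 1 = Suc l" by simp_all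
  have s: "pochhammer (\<rho>2 + \<rho>1 + 1) (Suc l) = pochhammer (\<rho>2 + \<rho>1 + 1) l * Y"
    unfolding Y_def by (rule pochhammer_Suc)
  show ?thesis
    unfolding V_def wilson_weight_def args bi_weight_def bi_weight_denom_def Let_def x k q s
    using nz \<open>\<rho>2 \<noteq> \<rho>1\<close> by (simp add: divide_simps)
qed

text \<open>
  Now \<open>I\<^sub>N\<close> is of odd degree and contains the factor \<open>x - \<rho>\<^sub>2\<close>. It is included on the left, because
  only together with it the weights take the same form at both signs.
\<close>

lemma bi_weight_r1_even:
  fixes \<rho>1 \<rho>2 r1 r2 :: real
  defines "e \<equiv> 1/2 - r1"
  defines "V \<equiv> wilson_weight e (\<rho>2 + 1) (\<rho>1 + 1) (1/2 - r2)"
  assumes d: "bi_weight_denom (2 * l) (- r1) (- r2) (- \<rho>1) (- \<rho>2) \<noteq> 0"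
  shows "(- (e + of_nat l) - \<rho>1) * bi_weight (2 * l) (- r1) (- r2) (- \<rho>1) (- \<rho>2) * (- (e + of_nat l) - \<rho>2)
    = (e + \<rho>1) * (e + \<rho>2) * V l * pochhammer (2 * e) l / fact l"
proof -
  have args: "- r1 - - \<rho>1 + 1/2 = e + \<rho>1" "- r1 - - \<rho>2 + 1/2 = e + \<rho>2"
    "- r1 + - r2 + 1 = e + (1/2 - r2)" "2 * - r1 + 1 = 2 * e"
    "- r1 + - \<rho>1 + 1/2 = e - (\<rho>1 + 1) + 1" "- r1 + - \<rho>2 + 1/2 = e - (\<rho>2 + 1) + 1"
    "- r1 - - r2 + 1 = e - (1/2 - r2) + 1"
    by (simp_all add: e_def)
  have k: "(2 * l) div 2 = l" "(2 * l) mod 2 = 0" "l + 0 = l" by simp_all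
  define Y1 Y2 where "Y1 = e + \<rho>1 + of_nat l" and "Y2 = e + \<rho>2 + of_nat l"
  have x: "- (e + of_nat l) - \<rho>1 = - Y1" "- (e + of_nat l) - \<rho>2 = - Y2"
    by (simp_all add: Y1_def Y2_def)
  have s: "pochhammer (e + y) l * (e + y + of_nat l) = (e + y) * pochhammer (e + (y + 1)) l" for y
    using pochhammer_shift[of "e + y" l] by (simp add: add_ac)
  have nz: "pochhammer (e - (\<rho>1 + 1) + 1) l \<noteq> 0" "pochhammer (e - (\<rho>2 + 1) + 1) l \<noteq> 0"
    "pochhammer (e - (1/2 - r2) + 1) l \<noteq> 0"
    using d unfolding bi_weight_denom_def Let_def args k by auto
  have "(- (e + of_nat l) - \<rho>1) * bi_weight (2 * l) (- r1) (- r2) (- \<rho>1) (- \<rho>2) * (- (e + of_nat l) - \<rho>2)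
    = (pochhammer (e + \<rho>1) l * Y1) * (pochhammer (e + \<rho>2) l * Y2)
      * pochhammer (e + (1/2 - r2)) l * pochhammer (2 * e) l / fact l
      / (pochhammer (e - (\<rho>1 + 1) + 1) l * pochhammer (e - (\<rho>2 + 1) + 1) l * pochhammer (e - (1/2 - r2) + 1) l)"
    unfolding bi_weight_def bi_weight_denom_def Let_def args k x by (simp add: mult_ac)
  then show ?thesis
    unfolding Y1_def Y2_def s V_def wilson_weight_def by (simp add: mult_ac)
qed

lemma bi_weight_r1_odd:
  fixes \<rho>1 \<rho>2 r1 r2 :: real
  defines "e \<equiv> 1/2 - r1"
  defines "V \<equiv> wilson_weight e (\<rho>2 + 1) (\<rho>1 + 1) (1/2 - r2)"
  assumes d: "bi_weight_denom (2 * l + 1) (- r1) (- r2) (- \<rho>1) (- \<rho>2) \<noteq> 0"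
  shows "(e + of_nat l - \<rho>1) * bi_weight (2 * l + 1) (- r1) (- r2) (- \<rho>1) (- \<rho>2) * (e + of_nat l - \<rho>2)
    = - ((e + \<rho>1) * (e + \<rho>2) * V l * pochhammer (2 * e) l / fact l)"
proof -
  have args: "- r1 - - \<rho>1 + 1/2 = e + \<rho>1" "- r1 - - \<rho>2 + 1/2 = e + \<rho>2"
    "- r1 + - r2 + 1 = e + (1/2 - r2)" "2 * - r1 + 1 = 2 * e"
    "- r1 + - \<rho>1 + 1/2 = e - (\<rho>1 + 1) + 1" "- r1 + - \<rho>2 + 1/2 = e - (\<rho>2 + 1) + 1"
    "- r1 - - r2 + 1 = e - (1/2 - r2) + 1"
    by (simp_all add: e_def)
  have k: "(2 * l + 1) div 2 = l" "(2 * l + 1) mod 2 = 1" "l + 1 = Suc l" by simp_all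
  have x: "e + of_nat l - y = e - (y + 1) + 1 + of_nat l" for y by simp
  have s: "pochhammer (e + y) (Suc l) = (e + y) * pochhammer (e + (y + 1)) l" for y
    by (simp add: pochhammer_rec add_ac)
  have s': "pochhammer (e - (y + 1) + 1) (Suc l) = pochhammer (e - (y + 1) + 1) l * (e - (y + 1) + 1 + of_nat l)" for y
    by (rule pochhammer_Suc)
  have nz: "pochhammer (e - (\<rho>1 + 1) + 1) l * (e - (\<rho>1 + 1) + 1 + of_nat l) \<noteq> 0"
    "pochhammer (e - (\<rho>2 + 1) + 1) l * (e - (\<rho>2 + 1) + 1 + of_nat l) \<noteq> 0"
    "pochhammer (e - (1/2 - r2) + 1) l \<noteq> 0"
    using d unfolding bi_weight_denom_def Let_def args k s' by auto
  define A1 A2 where "A1 = e - (\<rho>1 + 1) + 1 + of_nat l" and "A2 = e - (\<rho>2 + 1) + 1 + of_nat l"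
  show ?thesis
    unfolding bi_weight_def bi_weight_denom_def Let_def args k s s' V_def wilson_weight_def x
    using nz unfolding A1_def[symmetric] A2_def[symmetric] by (simp add: divide_simps)
qed


lemma wilson_basis_root:
  "poly (wilson_basis e n) (z\<^sup>2) = 0 \<Longrightarrow> \<exists>i<n. z = e + of_nat i \<or> z = - (e + of_nat i)"
  by (auto simp: poly_wilson_basis power2_eq_iff)

text \<open>
  Here \<open>N = 2 n\<close>, and the truncation condition makes one of the sums of \<open>\<rho>\<^sub>2\<close> with another Wilson
  parameter equal to \<open>- n\<close>. The grid consists of \<open>\<rho>\<^sub>2\<close> and the points \<open>\<plusminus>(\<rho>\<^sub>2 + j)\<close> with
  \<open>1 \<le> j \<le> n\<close>.
\<close>

lemma cbi_explicit_even:
  fixes \<rho>1 \<rho>2 r1 r2 :: real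
  assumes pos: "positive_recurrence (CBI \<rho>1 \<rho>2 r1 r2) b t (2 * n)"
    and reg: "bi_regular \<rho>1 \<rho>2 r1 r2 (2 * n + 2)"
    and trunc: "r1 = (2 * real n + 1) / 2 + \<rho>2 \<or> r2 = (2 * real n + 1) / 2 + \<rho>2 \<or>
      \<rho>1 = - ((2 * real n + 2) / 2) - \<rho>2"
  shows "cbi_explicit_orthogonality \<rho>1 \<rho>2 r1 r2 (2 * n)
    (\<lambda>k. (-1) ^ k * (\<rho>2 + real k / 2 + 1/4) - 1/4)
    (\<lambda>k. bi_weight_denom k \<rho>2 \<rho>1 r1 r2) (\<lambda>k. bi_weight k \<rho>2 \<rho>1 r1 r2)"
    (is "cbi_explicit_orthogonality _ _ _ _ _ ?x _ _")
proof (rule cbi_explicitI[OF pos])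
  let ?R = "wilson \<rho>2 (\<rho>1 + 1) (1/2 - r1) (1/2 - r2) n"
  let ?I = "CBI \<rho>1 \<rho>2 r1 r2 (2 * n + 1)"
  have x_even: "?x (2 * j) = \<rho>2 + real j" and x_odd: "?x (2 * j + 1) = - (\<rho>2 + real (Suc j))" for j
    by (simp_all add: field_simps)
  have R: "poly (CBI \<rho>1 \<rho>2 r1 r2 (2 * n)) y = poly ?R (y\<^sup>2)" for y
    using CBI_wilson_base_rho2[of \<rho>1 \<rho>2 r1 r2 n y] bi_regular_mono[OF reg] by simp
  have "wilson (\<rho>2 + 1) (\<rho>1 + 1) (1/2 - r1) (1/2 - r2) n = wilson_basis (\<rho>2 + 1) n"
    by (rule wilson_truncated) (use trunc in \<open>auto simp: field_simps\<close>)
  then have I: "poly ?I y = (y - \<rho>2) * poly (wilson_basis (\<rho>2 + 1) n) (y\<^sup>2)" for y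
    using CBI_wilson_base_rho2[of \<rho>1 \<rho>2 r1 r2 n y] bi_regular_mono[OF reg] by simp
  have I_prod: "poly ?I y = (y - \<rho>2) * (\<Prod>i\<in>{1..n}. y\<^sup>2 - (\<rho>2 + of_nat i)\<^sup>2)" for y
    unfolding I poly_wilson_basis
    by (rule arg_cong[where f = "(*) (y - \<rho>2)"], rule prod.reindex_bij_witness[of _ "\<lambda>i. i - 1" Suc])
      (auto simp: add_ac)
  show "z \<in> ?x ` {..2 * n}" if "poly ?I z = 0" for z
  proof -
    have "z = \<rho>2 \<or> poly (wilson_basis (\<rho>2 + 1) n) (z\<^sup>2) = 0" using that unfolding I by simp
    then consider "z = \<rho>2" | i where "i < n" "z = \<rho>2 + 1 + of_nat i" | i where "i < n" "z = - (\<rho>2 + 1 + of_nat i)"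
      using wilson_basis_root[of "\<rho>2 + 1" n z] by blast
    then show ?thesis
    proof cases
      case 1
      then show ?thesis using x_even[of 0] by (intro image_eqI[of _ _ 0]) auto
    next
      case 2
      then show ?thesis using x_even[of "Suc i"] by (intro image_eqI[of _ _ "2 * Suc i"]) auto
    next
      case 3
      then show ?thesis using x_odd[of i] by (intro image_eqI[of _ _ "2 * i + 1"]) auto
    qed
  qed
  show "bi_weight 0 \<rho>2 \<rho>1 r1 r2 = 1" by simp
  assume d: "\<forall>k\<le>2 * n. bi_weight_denom k \<rho>2 \<rho>1 r1 r2 \<noteq> 0" and "?x 0 \<noteq> \<rho>1"
  then have ne: "\<rho>2 \<noteq> \<rho>1" by simp
  define V where "V = wilson_weight \<rho>2 (\<rho>1 + 1) (1/2 - r1) (1/2 - r2)"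
  have "\<exists>\<Gamma>. \<forall>j\<le>n. (-1) ^ (n - j) * fact (n - j) * pochhammer (2 * \<rho>2 + of_nat n + 1) j
      * (V j * poly ?R ((\<rho>2 + of_nat j)\<^sup>2)) = \<Gamma>"
    unfolding V_def
  proof (rule wilson_weight_times_value)
    show "\<rho>2 + (\<rho>1 + 1) = - of_nat n \<or> \<rho>2 + (1/2 - r1) = - of_nat n \<or> \<rho>2 + (1/2 - r2) = - of_nat n"
      using trunc by (auto simp: field_simps)
    show "pochhammer (\<rho>2 + (\<rho>1 + 1) + (1/2 - r1) + (1/2 - r2) + of_nat n - 1) n \<noteq> 0"
    proof (rule pochhammer_nonzero)
      fix i assume "i < n"
      then show "\<rho>2 + (\<rho>1 + 1) + (1/2 - r1) + (1/2 - r2) + of_nat n - 1 + of_nat i \<noteq> 0"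
        using bi_regularD[OF reg, of "n + i + 1"] by (simp add: bi_g_def algebra_simps)
    qed
    have "bi_weight_denom (2 * n) \<rho>2 \<rho>1 r1 r2 \<noteq> 0" using d by simp
    then have *: "pochhammer (\<rho>2 + r1 + 1/2) n \<noteq> 0" "pochhammer (\<rho>2 + r2 + 1/2) n \<noteq> 0"
        "pochhammer (\<rho>2 - \<rho>1 + 1) n \<noteq> 0"
      by (auto simp: bi_weight_denom_def)
    then show "pochhammer (\<rho>2 - (1/2 - r1) + 1) n \<noteq> 0" "pochhammer (\<rho>2 - (1/2 - r2) + 1) n \<noteq> 0"
      by (simp_all add: algebra_simps)
    have "pochhammer (\<rho>2 - \<rho>1) (Suc n) \<noteq> 0"
      using * ne by (simp add: pochhammer_rec)
    then show "pochhammer (\<rho>2 - (\<rho>1 + 1) + 1) n \<noteq> 0"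
      by (simp add: pochhammer_Suc)
  qed
  then obtain \<Gamma> where \<Gamma>: "\<And>j. j \<le> n \<Longrightarrow> (-1) ^ (n - j) * fact (n - j)
      * pochhammer (2 * \<rho>2 + of_nat n + 1) j * (V j * poly ?R ((\<rho>2 + of_nat j)\<^sup>2)) = \<Gamma>"
    by blast
  \<comment> \<open>both sides are \<open>(2\<rho>\<^sub>2 + 1)\<^sub>n\<^sub>+\<^sub>j\<close>; this is where the dependence on \<open>j\<close> disappears\<close>
  have poch: "pochhammer (2 * \<rho>2 + 1) j * pochhammer (2 * \<rho>2 + of_nat j + 1) n
      = pochhammer (2 * \<rho>2 + of_nat n + 1) j * pochhammer (2 * \<rho>2 + 1) n" for j
    using pochhammer_product'[of "2 * \<rho>2 + 1" j n] pochhammer_product'[of "2 * \<rho>2 + 1" n j]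
    by (simp add: add_ac mult_ac)
  have deriv: "poly (pderiv ?I) y = (y - \<rho>2) * (2 * y) * (\<Prod>i\<in>{1..n} - {j}. (\<rho>2 + of_nat j)\<^sup>2 - (\<rho>2 + of_nat i)\<^sup>2)"
    if "1 \<le> j" "j \<le> n" "y\<^sup>2 = (\<rho>2 + of_nat j)\<^sup>2" for j y
  proof -
    have "poly (pderiv ?I) y = (y - \<rho>2) * (y + y) * (\<Prod>i\<in>{1..n} - {j}. y\<^sup>2 - (\<rho>2 + of_nat i)\<^sup>2)"
    proof (rule pderiv_at_root[where
          f = "\<lambda>u. (u - \<rho>2) * (u + y) * (\<Prod>i\<in>{1..n} - {j}. u\<^sup>2 - (\<rho>2 + of_nat i)\<^sup>2)"])
      fix u
      have "(\<Prod>i\<in>{1..n}. u\<^sup>2 - (\<rho>2 + of_nat i)\<^sup>2)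
          = (u\<^sup>2 - y\<^sup>2) * (\<Prod>i\<in>{1..n} - {j}. u\<^sup>2 - (\<rho>2 + of_nat i)\<^sup>2)"
        unfolding that(3) using that by (intro prod.remove) auto
      also have "u\<^sup>2 - y\<^sup>2 = (u - y) * (u + y)"
        by (simp add: power2_eq_square algebra_simps)
      finally show "poly ?I u = (u - y) * ((u - \<rho>2) * (u + y) * (\<Prod>i\<in>{1..n} - {j}. u\<^sup>2 - (\<rho>2 + of_nat i)\<^sup>2))"
        unfolding I_prod by (simp only: mult_ac)
    qed (intro continuous_intros)
    then show ?thesis by (simp add: that(3))
  qed
  have plus: "(\<rho>2 + of_nat j - \<rho>1) * bi_weight (2 * j) \<rho>2 \<rho>1 r1 r2
      * (poly ?R ((\<rho>2 + of_nat j)\<^sup>2) * poly (pderiv ?I) (\<rho>2 + of_nat j))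
      = (\<rho>2 - \<rho>1) * pochhammer (2 * \<rho>2 + 1) n * \<Gamma>" if j: "j \<le> n" for j
  proof -
    have deriv_plus: "poly (pderiv ?I) (\<rho>2 + of_nat j)
        = (-1) ^ (n - j) * fact j * fact (n - j) * pochhammer (2 * \<rho>2 + of_nat j + 1) n"
    \<comment> \<open>at \<open>j = 0\<close> the zero \<open>\<rho>\<^sub>2\<close> comes from the linear factor, and \<open>\<rho>\<^sub>2 = 0\<close> is possible\<close>
    proof (cases "j = 0")
      case True
      have "poly (pderiv ?I) \<rho>2 = (\<Prod>i\<in>{1..n}. \<rho>2\<^sup>2 - (\<rho>2 + of_nat i)\<^sup>2)"
        by (rule pderiv_at_root[OF I_prod]) (intro continuous_intros)
      also have "\<dots> = (\<Prod>i<n. - 1 * real (Suc i) * (2 * \<rho>2 + 1 + of_nat i))"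
        by (rule prod.reindex_bij_witness[of _ Suc "\<lambda>i. i - 1"])
          (auto simp: power2_eq_square algebra_simps)
      also have "\<dots> = (-1) ^ n * fact n * pochhammer (2 * \<rho>2 + 1) n"
        unfolding prod.distrib by (simp add: pochhammer_prod fact_prod_Suc atLeast0LessThan)
      finally show ?thesis using True by simp
    next
      case False
      then have "1 \<le> j" by simp
      have "poly (pderiv ?I) (\<rho>2 + of_nat j)
          = of_nat j * (2 * (\<rho>2 + of_nat j) * (\<Prod>i\<in>{1..n} - {j}. (\<rho>2 + of_nat j)\<^sup>2 - (\<rho>2 + of_nat i)\<^sup>2))"
        using deriv[OF \<open>1 \<le> j\<close> j, of "\<rho>2 + of_nat j"] by (simp add: mult_ac)
      also have "\<dots> = (of_nat j * fact (j - 1)) * (-1) ^ (n - j) * fact (n - j) * pochhammer (2 * \<rho>2 + of_nat j + 1) n"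
        unfolding prod_grid_differences_shifted[OF \<open>1 \<le> j\<close> j] by (simp add: mult_ac)
      also have "of_nat j * fact (j - 1) = (fact j :: real)"
        using \<open>1 \<le> j\<close> by (simp add: fact_reduce)
      finally show ?thesis by (simp add: mult_ac)
    qed
    have "bi_weight_denom (2 * j) \<rho>2 \<rho>1 r1 r2 \<noteq> 0" using d j by simp
    from bi_weight_rho2_even[OF this ne]
    have "(\<rho>2 + of_nat j - \<rho>1) * bi_weight (2 * j) \<rho>2 \<rho>1 r1 r2
      * (poly ?R ((\<rho>2 + of_nat j)\<^sup>2) * poly (pderiv ?I) (\<rho>2 + of_nat j))
      = (\<rho>2 - \<rho>1) * ((pochhammer (2 * \<rho>2 + 1) j * pochhammer (2 * \<rho>2 + of_nat j + 1) n)
        * ((-1) ^ (n - j) * fact (n - j)) * (V j * poly ?R ((\<rho>2 + of_nat j)\<^sup>2)))"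
      unfolding deriv_plus V_def by simp
    then show ?thesis
      unfolding poch \<Gamma>[OF j, symmetric] by (simp only: mult_ac)
  qed
  have minus: "(- (\<rho>2 + of_nat (Suc l)) - \<rho>1) * bi_weight (2 * l + 1) \<rho>2 \<rho>1 r1 r2
      * (poly ?R ((\<rho>2 + of_nat (Suc l))\<^sup>2) * poly (pderiv ?I) (- (\<rho>2 + of_nat (Suc l))))
      = (\<rho>2 - \<rho>1) * pochhammer (2 * \<rho>2 + 1) n * \<Gamma>" if l: "Suc l \<le> n" for l
  proof -
    let ?j = "Suc l"
    let ?P = "\<Prod>i\<in>{1..n} - {?j}. (\<rho>2 + of_nat ?j)\<^sup>2 - (\<rho>2 + of_nat i)\<^sup>2"
    have "poly (pderiv ?I) (- (\<rho>2 + of_nat ?j))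
        = (- (\<rho>2 + of_nat ?j) - \<rho>2) * (2 * - (\<rho>2 + of_nat ?j)) * ?P"
      by (rule deriv[OF _ l power2_minus]) simp
    also have "(- (\<rho>2 + of_nat ?j) - \<rho>2) * (2 * - (\<rho>2 + of_nat ?j))
        = (2 * \<rho>2 + of_nat ?j) * (2 * (\<rho>2 + of_nat ?j))"
      by (simp add: algebra_simps)
    also have "\<dots> * ?P = (2 * \<rho>2 + of_nat ?j) * (2 * (\<rho>2 + of_nat ?j) * ?P)"
      by (rule mult.assoc)
    also have "\<dots> = (2 * \<rho>2 + of_nat ?j) * ((-1) ^ (n - ?j) * fact l * fact (n - ?j) * pochhammer (2 * \<rho>2 + of_nat ?j + 1) n)"
      using prod_grid_differences_shifted[of ?j n \<rho>2] l by (simp only: diff_Suc_1)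
    finally have deriv_minus: "poly (pderiv ?I) (- (\<rho>2 + of_nat ?j))
      = (2 * \<rho>2 + of_nat ?j) * ((-1) ^ (n - ?j) * fact l * fact (n - ?j) * pochhammer (2 * \<rho>2 + of_nat ?j + 1) n)" .
    have poch_Suc: "pochhammer (2 * \<rho>2 + 1) ?j = pochhammer (2 * \<rho>2 + 1) l * (2 * \<rho>2 + of_nat ?j)"
      by (simp add: pochhammer_Suc)
    have "bi_weight_denom (2 * l + 1) \<rho>2 \<rho>1 r1 r2 \<noteq> 0" using d l by simp
    from bi_weight_rho2_odd[OF this ne]
    have "(- (\<rho>2 + of_nat ?j) - \<rho>1) * bi_weight (2 * l + 1) \<rho>2 \<rho>1 r1 r2
      * (poly ?R ((\<rho>2 + of_nat ?j)\<^sup>2) * poly (pderiv ?I) (- (\<rho>2 + of_nat ?j)))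
      = (\<rho>2 - \<rho>1) * ((pochhammer (2 * \<rho>2 + 1) ?j * pochhammer (2 * \<rho>2 + of_nat ?j + 1) n)
        * ((-1) ^ (n - ?j) * fact (n - ?j)) * (V ?j * poly ?R ((\<rho>2 + of_nat ?j)\<^sup>2)))"
      unfolding deriv_minus V_def poch_Suc by (simp del: of_nat_Suc)
    then show ?thesis
      unfolding poch \<Gamma>[OF l, symmetric] by (simp only: mult_ac)
  qed
  show "\<exists>\<gamma>. \<forall>k\<le>2 * n. (?x k - \<rho>1) * bi_weight k \<rho>2 \<rho>1 r1 r2
      * (poly (CBI \<rho>1 \<rho>2 r1 r2 (2 * n)) (?x k) * poly (pderiv ?I) (?x k)) = \<gamma>"
  proof (intro exI allI impI)
    fix k assume k: "k \<le> 2 * n"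
    consider j where "k = 2 * j" | l where "k = 2 * l + 1" by (metis evenE oddE)
    then show "(?x k - \<rho>1) * bi_weight k \<rho>2 \<rho>1 r1 r2
      * (poly (CBI \<rho>1 \<rho>2 r1 r2 (2 * n)) (?x k) * poly (pderiv ?I) (?x k))
      = (\<rho>2 - \<rho>1) * pochhammer (2 * \<rho>2 + 1) n * \<Gamma>"
    proof cases
      case 1
      then show ?thesis using plus[of j] k unfolding R 1 x_even by simp
    next
      case 2
      then show ?thesis using minus[of l] k unfolding R 2 x_odd power2_minus by simp
    qed
  qed
qed

text \<open>
  Here \<open>N = 2 M + 1\<close>, the base is \<open>e = 1/2 - r\<^sub>1\<close>, and the grid consists of the points \<open>\<plusminus>(e + j)\<close>
  with \<open>0 \<le> j \<le> M\<close>.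
\<close>

lemma cbi_explicit_odd:
  fixes \<rho>1 \<rho>2 r1 r2 :: real
  assumes pos: "positive_recurrence (CBI \<rho>1 \<rho>2 r1 r2) b t (2 * M + 1)"
    and reg: "bi_regular \<rho>1 \<rho>2 r1 r2 (2 * M + 3)"
    and trunc: "r1 = (2 * real M + 3) / 2 + \<rho>1 \<or> r1 = real M + 1 - r2"
  shows "cbi_explicit_orthogonality \<rho>1 \<rho>2 r1 r2 (2 * M + 1)
    (\<lambda>k. (-1) ^ k * (r1 - real k / 2 - 1/4) - 1/4)
    (\<lambda>k. bi_weight_denom k (- r1) (- r2) (- \<rho>1) (- \<rho>2)) (\<lambda>k. bi_weight k (- r1) (- r2) (- \<rho>1) (- \<rho>2))"
    (is "cbi_explicit_orthogonality _ _ _ _ _ ?x ?d ?w")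
proof (rule cbi_explicitI[OF pos])
  define e where "e = 1/2 - r1"
  let ?Q = "wilson e (\<rho>2 + 1) (\<rho>1 + 1) (1/2 - r2) M"
  let ?I = "CBI \<rho>1 \<rho>2 r1 r2 (2 * M + 1 + 1)"
  have x_even: "?x (2 * j) = - (e + real j)" and x_odd: "?x (2 * j + 1) = e + real j" for j
    by (simp_all add: e_def)
  have Q: "poly (CBI \<rho>1 \<rho>2 r1 r2 (2 * M + 1)) y = (y - \<rho>2) * poly ?Q (y\<^sup>2)" for y
    using CBI_wilson_base_r1[of \<rho>1 \<rho>2 r1 r2 M y] bi_regular_mono[OF reg] by (simp add: e_def)
  have "wilson e \<rho>2 (\<rho>1 + 1) (1/2 - r2) (M + 1) = wilson_basis e (M + 1)"
    by (rule wilson_truncated) (use trunc in \<open>auto simp: e_def field_simps\<close>)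
  then have I: "poly ?I y = poly (wilson_basis e (M + 1)) (y\<^sup>2)" for y
    using CBI_wilson_base_r1[of \<rho>1 \<rho>2 r1 r2 "M + 1" y] bi_regular_mono[OF reg] by (simp add: e_def)
  have I_prod: "poly ?I y = (\<Prod>i\<in>{..M}. y\<^sup>2 - (e + of_nat i)\<^sup>2)" for y
    unfolding I poly_wilson_basis by (simp add: lessThan_Suc_atMost)
  show "z \<in> ?x ` {..2 * M + 1}" if z: "poly ?I z = 0" for z
  proof -
    obtain i where i: "i < M + 1" and "z = e + of_nat i \<or> z = - (e + of_nat i)"
      using wilson_basis_root[of e "M + 1" z] z unfolding I by blast
    then have "z = ?x (2 * i + 1) \<or> z = ?x (2 * i)" unfolding x_odd x_even by blast
    moreover have "2 * i + 1 \<in> {..2 * M + 1}" "2 * i \<in> {..2 * M + 1}" using i by auto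
    ultimately show ?thesis by blast
  qed
  show "?w 0 = 1" by simp
  assume d: "\<forall>k\<le>2 * M + 1. ?d k \<noteq> 0"
  define V where "V = wilson_weight e (\<rho>2 + 1) (\<rho>1 + 1) (1/2 - r2)"
  have "\<exists>\<Gamma>. \<forall>j\<le>M. (-1) ^ (M - j) * fact (M - j) * pochhammer (2 * e + of_nat M + 1) j
      * (V j * poly ?Q ((e + of_nat j)\<^sup>2)) = \<Gamma>"
    unfolding V_def
  proof (rule wilson_weight_times_value)
    show "e + (\<rho>2 + 1) = - of_nat M \<or> e + (\<rho>1 + 1) = - of_nat M \<or> e + (1/2 - r2) = - of_nat M"
      using trunc by (auto simp: e_def field_simps)
    show "pochhammer (e + (\<rho>2 + 1) + (\<rho>1 + 1) + (1/2 - r2) + of_nat M - 1) M \<noteq> 0"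
    proof (rule pochhammer_nonzero)
      fix i assume "i < M"
      then show "e + (\<rho>2 + 1) + (\<rho>1 + 1) + (1/2 - r2) + of_nat M - 1 + of_nat i \<noteq> 0"
        using bi_regularD[OF reg, of "M + i + 2"] by (simp add: bi_g_def e_def algebra_simps)
    qed
    have "?d (2 * M) \<noteq> 0" using d by simp
    then show "pochhammer (e - (\<rho>2 + 1) + 1) M \<noteq> 0" "pochhammer (e - (\<rho>1 + 1) + 1) M \<noteq> 0"
        "pochhammer (e - (1/2 - r2) + 1) M \<noteq> 0"
      by (auto simp: bi_weight_denom_def e_def algebra_simps)
  qed
  then obtain \<Gamma> where \<Gamma>: "\<And>j. j \<le> M \<Longrightarrow> (-1) ^ (M - j) * fact (M - j)
      * pochhammer (2 * e + of_nat M + 1) j * (V j * poly ?Q ((e + of_nat j)\<^sup>2)) = \<Gamma>"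
    by blast
  \<comment> \<open>both sides are \<open>(2e)\<^sub>M\<^sub>+\<^sub>1\<^sub>+\<^sub>j\<close>\<close>
  have poch: "pochhammer (2 * e) j * pochhammer (2 * e + of_nat j) (Suc M)
      = pochhammer (2 * e + of_nat M + 1) j * pochhammer (2 * e) (Suc M)" for j
    using pochhammer_product'[of "2 * e" j "Suc M"] pochhammer_product'[of "2 * e" "Suc M" j]
    by (simp add: add_ac mult_ac)
  have deriv: "poly (pderiv ?I) y = 2 * y * (\<Prod>i\<in>{..M} - {j}. (e + of_nat j)\<^sup>2 - (e + of_nat i)\<^sup>2)"
    if "j \<le> M" "y\<^sup>2 = (e + of_nat j)\<^sup>2" for j y
  proof -
    have "poly (pderiv ?I) y = (y + y) * (\<Prod>i\<in>{..M} - {j}. y\<^sup>2 - (e + of_nat i)\<^sup>2)"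
    proof (rule pderiv_at_root[where
          f = "\<lambda>u. (u + y) * (\<Prod>i\<in>{..M} - {j}. u\<^sup>2 - (e + of_nat i)\<^sup>2)"])
      fix u
      have "(\<Prod>i\<in>{..M}. u\<^sup>2 - (e + of_nat i)\<^sup>2)
          = (u\<^sup>2 - y\<^sup>2) * (\<Prod>i\<in>{..M} - {j}. u\<^sup>2 - (e + of_nat i)\<^sup>2)"
        unfolding that(2) using that by (intro prod.remove) auto
      also have "u\<^sup>2 - y\<^sup>2 = (u - y) * (u + y)"
        by (simp add: power2_eq_square algebra_simps)
      finally show "poly ?I u = (u - y) * ((u + y) * (\<Prod>i\<in>{..M} - {j}. u\<^sup>2 - (e + of_nat i)\<^sup>2))"
        unfolding I_prod by (simp only: mult_ac)
    qed (intro continuous_intros)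
    then show ?thesis by (simp add: that(2))
  qed
  define \<gamma> where "\<gamma> = - ((e + \<rho>1) * (e + \<rho>2) * pochhammer (2 * e) (Suc M) * \<Gamma>)"
  have deriv_plus: "poly (pderiv ?I) (e + of_nat j)
      = (-1) ^ (M - j) * fact j * fact (M - j) * pochhammer (2 * e + of_nat j) (Suc M)" if "j \<le> M" for j
    using deriv[OF that, of "e + of_nat j"] prod_grid_differences[OF that, of e] by simp
  have deriv_minus: "poly (pderiv ?I) (- (e + of_nat j)) = - poly (pderiv ?I) (e + of_nat j)" if "j \<le> M" for j
    using deriv[OF that, of "e + of_nat j"] deriv[OF that, of "- (e + of_nat j)"]
    by (simp only: power2_minus)
  have const: "(e + \<rho>1) * (e + \<rho>2) * V j * pochhammer (2 * e) j / fact j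
      * (poly ?Q ((e + of_nat j)\<^sup>2) * poly (pderiv ?I) (e + of_nat j)) = - \<gamma>" if "j \<le> M" for j
  proof -
    have "(e + \<rho>1) * (e + \<rho>2) * V j * pochhammer (2 * e) j / fact j
      * (poly ?Q ((e + of_nat j)\<^sup>2) * poly (pderiv ?I) (e + of_nat j))
      = (e + \<rho>1) * (e + \<rho>2) * ((pochhammer (2 * e) j * pochhammer (2 * e + of_nat j) (Suc M))
        * ((-1) ^ (M - j) * fact (M - j)) * (V j * poly ?Q ((e + of_nat j)\<^sup>2)))"
      unfolding deriv_plus[OF that] by (simp del: pochhammer_Suc)
    then show ?thesis
      unfolding poch \<gamma>_def \<Gamma>[OF that, symmetric] by (simp only: mult_ac minus_minus)
  qed
  show "\<exists>\<gamma>. \<forall>k\<le>2 * M + 1. (?x k - \<rho>1) * ?w k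
      * (poly (CBI \<rho>1 \<rho>2 r1 r2 (2 * M + 1)) (?x k) * poly (pderiv ?I) (?x k)) = \<gamma>"
  proof (intro exI[of _ \<gamma>] allI impI)
    fix k assume k: "k \<le> 2 * M + 1"
    consider j where "k = 2 * j" | j where "k = 2 * j + 1" by (metis evenE oddE)
    then show "(?x k - \<rho>1) * ?w k
      * (poly (CBI \<rho>1 \<rho>2 r1 r2 (2 * M + 1)) (?x k) * poly (pderiv ?I) (?x k)) = \<gamma>"
    proof cases
      case 1
      then have j: "j \<le> M" and "?d (2 * j) \<noteq> 0" using k d by auto
      have "(- (e + real j) - \<rho>1) * ?w (2 * j) * ((- (e + real j) - \<rho>2) * poly ?Q ((e + real j)\<^sup>2)
          * poly (pderiv ?I) (- (e + real j)))
        = - (((- (e + real j) - \<rho>1) * ?w (2 * j) * (- (e + real j) - \<rho>2))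
          * (poly ?Q ((e + real j)\<^sup>2) * poly (pderiv ?I) (e + real j)))"
        unfolding deriv_minus[OF j] by simp
      also have "\<dots> = \<gamma>"
        using bi_weight_r1_even[OF \<open>?d (2 * j) \<noteq> 0\<close>] const[OF j] by (simp add: V_def e_def)
      finally show ?thesis unfolding 1 x_even Q power2_minus .
    next
      case 2
      then have j: "j \<le> M" and "?d (2 * j + 1) \<noteq> 0" using k d by auto
      have "(e + real j - \<rho>1) * ?w (2 * j + 1) * ((e + real j - \<rho>2) * poly ?Q ((e + real j)\<^sup>2)
          * poly (pderiv ?I) (e + real j))
        = ((e + real j - \<rho>1) * ?w (2 * j + 1) * (e + real j - \<rho>2))
          * (poly ?Q ((e + real j)\<^sup>2) * poly (pderiv ?I) (e + real j))"
        by simp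
      also have "\<dots> = \<gamma>"
        using bi_weight_r1_odd[OF \<open>?d (2 * j + 1) \<noteq> 0\<close>] const[OF j] by (simp add: V_def e_def)
      finally show ?thesis unfolding 2 x_odd Q .
    qed
  qed
qed

section \<open>Interchanging the last two parameters\<close>

text \<open>
  The polynomials do not change when \<open>r\<^sub>1\<close> and \<open>r\<^sub>2\<close> are interchanged, which reduces the grid that starts
  at \<open>r\<^sub>2\<close> to the one that starts at \<open>r\<^sub>1\<close>.
\<close>

lemma bi_g_swap_r: "bi_g \<rho>1 \<rho>2 r2 r1 = bi_g \<rho>1 \<rho>2 r1 r2"
  by (simp add: bi_g_def)

lemma bi_A_swap_r: "bi_A \<rho>1 \<rho>2 r2 r1 n = bi_A \<rho>1 \<rho>2 r1 r2 n"
  unfolding bi_A_def bi_g_swap_r[of \<rho>1 \<rho>2 r2 r1] by (simp add: mult.commute)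

lemma bi_C_swap_r: "bi_C \<rho>1 \<rho>2 r2 r1 n = bi_C \<rho>1 \<rho>2 r1 r2 n"
proof -
  have "of_nat n - 2 * r2 - 2 * r1 = of_nat n - 2 * r1 - 2 * r2" by simp
  then show ?thesis
    unfolding bi_C_def bi_g_swap_r[of \<rho>1 \<rho>2 r2 r1] by (simp add: mult.commute)
qed

lemma BI_swap_r: "BI \<rho>1 \<rho>2 r2 r1 n = BI \<rho>1 \<rho>2 r1 r2 n"
  by (induction n rule: induct_nat_012)
    (simp_all add: bi_A_swap_r[of \<rho>1 \<rho>2 r2 r1] bi_C_swap_r[of \<rho>1 \<rho>2 r2 r1])

lemma CBI_swap_r: "CBI \<rho>1 \<rho>2 r2 r1 = CBI \<rho>1 \<rho>2 r1 r2"
  by (intro ext)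
    (simp only: CBI_def BI_swap_r[of \<rho>1 \<rho>2 r2 r1] bi_A_swap_r[of \<rho>1 \<rho>2 r2 r1])

lemma bi_regular_swap_r: "bi_regular \<rho>1 \<rho>2 r2 r1 n = bi_regular \<rho>1 \<rho>2 r1 r2 n"
  by (simp add: bi_regular_def bi_g_swap_r[of \<rho>1 \<rho>2 r2 r1])

lemma cbi_explicit_swap_r:
  "cbi_explicit_orthogonality \<rho>1 \<rho>2 r2 r1 = cbi_explicit_orthogonality \<rho>1 \<rho>2 r1 r2"
  by (intro ext) (simp add: cbi_explicit_orthogonality_def CBI_swap_r[of \<rho>1 \<rho>2 r2 r1])

section \<open>Kernel form, recurrence, hypergeometric form and orthogonality\<close>

lemma CBI_kernel_polynomial:
  fixes \<rho>1 \<rho>2 r1 r2 :: "'a::field_char_0"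
  assumes "poly (BI \<rho>1 \<rho>2 r1 r2 n) \<rho>1 \<noteq> 0" "x \<noteq> \<rho>1"
  shows "poly (CBI \<rho>1 \<rho>2 r1 r2 n) x = inverse (x - \<rho>1) * (poly (BI \<rho>1 \<rho>2 r1 r2 (n + 1)) x
    - poly (BI \<rho>1 \<rho>2 r1 r2 (n + 1)) \<rho>1 / poly (BI \<rho>1 \<rho>2 r1 r2 n) \<rho>1 * poly (BI \<rho>1 \<rho>2 r1 r2 n) x)"
proof -
  have "(x - \<rho>1) * poly (CBI \<rho>1 \<rho>2 r1 r2 n) x
      = poly (BI \<rho>1 \<rho>2 r1 r2 (Suc n)) x - bi_A \<rho>1 \<rho>2 r1 r2 n * poly (BI \<rho>1 \<rho>2 r1 r2 n) x"
    using arg_cong[OF CBI_exact[of \<rho>1 \<rho>2 r1 r2 n], of "\<lambda>p. poly p x"]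
    by (simp add: algebra_simps del: BI.simps)
  moreover have "poly (BI \<rho>1 \<rho>2 r1 r2 (Suc n)) \<rho>1 / poly (BI \<rho>1 \<rho>2 r1 r2 n) \<rho>1 = bi_A \<rho>1 \<rho>2 r1 r2 n"
    unfolding BI_at_rho1 using assms(1) by simp
  ultimately show ?thesis using assms(2) by (simp add: field_simps del: BI.simps)
qed

lemma CBI_three_term:
  fixes \<rho>1 \<rho>2 r1 r2 :: "'a::field_char_0"
  assumes "bi_regular \<rho>1 \<rho>2 r1 r2 (n + 1)"
  shows "CBI \<rho>1 \<rho>2 r1 r2 (n + 1) + smult ((-1) ^ n * \<rho>2) (CBI \<rho>1 \<rho>2 r1 r2 n)
        + smult (cbi_tau \<rho>1 \<rho>2 r1 r2 n) (if n = 0 then 0 else CBI \<rho>1 \<rho>2 r1 r2 (n - 1))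
      = [:0, 1:] * CBI \<rho>1 \<rho>2 r1 r2 n"
  using CBI_recurrence_regular[OF assms] by simp

lemma CBI_even_hypergeo:
  fixes \<rho>1 \<rho>2 r1 r2 :: "'a::{real_normed_field,banach}"
  assumes reg: "bi_regular \<rho>1 \<rho>2 r1 r2 (2 * n)"
    and nz: "\<forall>j<n. \<rho>1 + \<rho>2 + 1 + of_nat j \<noteq> 0 \<and> \<rho>2 - r1 + 1/2 + of_nat j \<noteq> 0 \<and>
                \<rho>2 - r2 + 1/2 + of_nat j \<noteq> 0"
  shows "\<exists>R. (\<forall>x. poly (CBI \<rho>1 \<rho>2 r1 r2 (2*n)) x = poly R (x\<^sup>2)) \<and>
           (\<forall>x. poly R (x\<^sup>2) = cbi_eta \<rho>1 \<rho>2 r1 r2 n *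
              hypergeo [- of_nat n, of_nat n + bi_g \<rho>1 \<rho>2 r1 r2 + 1, \<rho>2 + x, \<rho>2 - x]
                       [\<rho>1 + \<rho>2 + 1, \<rho>2 - r1 + 1/2, \<rho>2 - r2 + 1/2] 1)"
proof -
  have params: "\<rho>2 + (\<rho>1 + 1) = \<rho>1 + \<rho>2 + 1" "\<rho>2 + (1/2 - r1) = \<rho>2 - r1 + 1/2"
      "\<rho>2 + (1/2 - r2) = \<rho>2 - r2 + 1/2"
      "of_nat n + (\<rho>2 + (\<rho>1 + 1) + (1/2 - r1) + (1/2 - r2) - 1) = of_nat n + bi_g \<rho>1 \<rho>2 r1 r2 + 1"
    by (simp_all add: bi_g_def)
  have "poly (wilson \<rho>2 (\<rho>1 + 1) (1/2 - r1) (1/2 - r2) n) (x\<^sup>2) = cbi_eta \<rho>1 \<rho>2 r1 r2 n *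
      hypergeo [- of_nat n, of_nat n + bi_g \<rho>1 \<rho>2 r1 r2 + 1, \<rho>2 + x, \<rho>2 - x]
        [\<rho>1 + \<rho>2 + 1, \<rho>2 - r1 + 1/2, \<rho>2 - r2 + 1/2] 1" for x
    unfolding cbi_eta_def params[symmetric]
  proof (rule wilson_hypergeo)
    fix j assume j: "j < n"
    show "of_nat n + (\<rho>2 + (\<rho>1 + 1) + (1/2 - r1) + (1/2 - r2) - 1) + of_nat j \<noteq> 0"
      unfolding params(4) using bi_regularD[OF reg, of "n + j + 1"] j by (simp add: algebra_simps)
    show "\<rho>2 + (\<rho>1 + 1) + of_nat j \<noteq> 0" "\<rho>2 + (1/2 - r1) + of_nat j \<noteq> 0"
        "\<rho>2 + (1/2 - r2) + of_nat j \<noteq> 0"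
      unfolding params using nz j by blast+
  qed
  then show ?thesis using CBI_wilson_base_rho2[of \<rho>1 \<rho>2 r1 r2 n] reg by blast
qed

lemma CBI_odd_hypergeo:
  fixes \<rho>1 \<rho>2 r1 r2 :: "'a::{real_normed_field,banach}"
  assumes reg: "bi_regular \<rho>1 \<rho>2 r1 r2 (2 * n + 1)"
    and nz: "\<forall>j<n. \<rho>1 + \<rho>2 + 2 + of_nat j \<noteq> 0 \<and> \<rho>2 - r1 + 3/2 + of_nat j \<noteq> 0 \<and>
                \<rho>2 - r2 + 3/2 + of_nat j \<noteq> 0"
  shows "\<exists>Q. (\<forall>x. poly (CBI \<rho>1 \<rho>2 r1 r2 (2*n + 1)) x = (x - \<rho>2) * poly Q (x\<^sup>2)) \<and>
           (\<forall>x. poly Q (x\<^sup>2) = cbi_iota \<rho>1 \<rho>2 r1 r2 n *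
              hypergeo [- of_nat n, of_nat n + bi_g \<rho>1 \<rho>2 r1 r2 + 2, \<rho>2 + 1 + x, \<rho>2 + 1 - x]
                       [\<rho>1 + \<rho>2 + 2, \<rho>2 - r1 + 3/2, \<rho>2 - r2 + 3/2] 1)"
proof -
  have params: "\<rho>2 + 1 + (\<rho>1 + 1) = \<rho>1 + \<rho>2 + 2" "\<rho>2 + 1 + (1/2 - r1) = \<rho>2 - r1 + 3/2"
      "\<rho>2 + 1 + (1/2 - r2) = \<rho>2 - r2 + 3/2"
      "of_nat n + (\<rho>2 + 1 + (\<rho>1 + 1) + (1/2 - r1) + (1/2 - r2) - 1) = of_nat n + bi_g \<rho>1 \<rho>2 r1 r2 + 2"
    by (simp_all add: bi_g_def field_simps)
  have "poly (wilson (\<rho>2 + 1) (\<rho>1 + 1) (1/2 - r1) (1/2 - r2) n) (x\<^sup>2) = cbi_iota \<rho>1 \<rho>2 r1 r2 n *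
      hypergeo [- of_nat n, of_nat n + bi_g \<rho>1 \<rho>2 r1 r2 + 2, \<rho>2 + 1 + x, \<rho>2 + 1 - x]
        [\<rho>1 + \<rho>2 + 2, \<rho>2 - r1 + 3/2, \<rho>2 - r2 + 3/2] 1" for x
    unfolding cbi_iota_def params[symmetric]
  proof (rule wilson_hypergeo)
    fix j assume j: "j < n"
    show "of_nat n + (\<rho>2 + 1 + (\<rho>1 + 1) + (1/2 - r1) + (1/2 - r2) - 1) + of_nat j \<noteq> 0"
      unfolding params(4) using bi_regularD[OF reg, of "n + j + 2"] j by (simp add: algebra_simps)
    show "\<rho>2 + 1 + (\<rho>1 + 1) + of_nat j \<noteq> 0" "\<rho>2 + 1 + (1/2 - r1) + of_nat j \<noteq> 0"
        "\<rho>2 + 1 + (1/2 - r2) + of_nat j \<noteq> 0"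
      unfolding params using nz j by blast+
  qed
  then show ?thesis using CBI_wilson_base_rho2[of \<rho>1 \<rho>2 r1 r2 n] reg by blast
qed

text \<open>
  The Gauss weights \<open>1 / (I\<^sub>N(x\<^sub>k) I'\<^sub>N\<^sub>+\<^sub>1(x\<^sub>k))\<close> on the zeros of \<open>I\<^sub>N\<^sub>+\<^sub>1\<close>.
\<close>

lemma CBI_finite_orthogonality:
  fixes \<rho>1 \<rho>2 r1 r2 :: real
  assumes "bi_regular \<rho>1 \<rho>2 r1 r2 (N + 2)" "\<forall>n\<in>{1..N}. cbi_tau \<rho>1 \<rho>2 r1 r2 n > 0"
  shows "\<exists>x w h. simple_root_grid (CBI \<rho>1 \<rho>2 r1 r2 (N + 1)) N x \<and>
                 (\<forall>k\<le>N. w k > 0) \<and> (\<forall>n\<le>N. h n > 0) \<and>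
                 discrete_orthogonal (CBI \<rho>1 \<rho>2 r1 r2) N x w h"
proof -
  interpret positive_recurrence "CBI \<rho>1 \<rho>2 r1 r2" "\<lambda>n. (-1) ^ n * \<rho>2" "cbi_tau \<rho>1 \<rho>2 r1 r2" N
    by (rule positive_recurrence_CBI[OF assms])
  let ?I = "CBI \<rho>1 \<rho>2 r1 r2"
  obtain x where grid: "simple_root_grid (?I (Suc N)) N x" using ex_simple_root_grid by blast
  define w where "w k = 1 / (poly (?I N) (x k) * poly (pderiv (?I (Suc N))) (x k))" for k
  have "w k * (poly (?I N) (x k) * poly (pderiv (?I (Suc N))) (x k)) = 1" "0 < w k" if "k \<le> N" for k
    using last_times_derivative_pos[OF grid that] by (auto simp: w_def)
  with gauss_orthogonality[OF grid, of w 1] grid prod_t_pos show ?thesis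
    by (intro exI[of _ x] exI[of _ w] exI[of _ "\<lambda>n. 1 / prod (cbi_tau \<rho>1 \<rho>2 r1 r2) {n<..N}"]) auto
qed

lemma CBI_explicit_orthogonality:
  fixes \<rho>1 \<rho>2 r1 r2 :: real
  assumes reg: "bi_regular \<rho>1 \<rho>2 r1 r2 (N + 2)" and pos: "\<forall>n\<in>{1..N}. cbi_tau \<rho>1 \<rho>2 r1 r2 n > 0"
  shows "even N \<Longrightarrow> r1 = (real N + 1) / 2 + \<rho>2 \<or> r2 = (real N + 1) / 2 + \<rho>2 \<or>
                   \<rho>1 = - ((real N + 2) / 2) - \<rho>2 \<Longrightarrow>
          cbi_explicit_orthogonality \<rho>1 \<rho>2 r1 r2 N
            (\<lambda>k. (-1) ^ k * (\<rho>2 + real k / 2 + 1/4) - 1/4)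
            (\<lambda>k. bi_weight_denom k \<rho>2 \<rho>1 r1 r2)
            (\<lambda>k. bi_weight k \<rho>2 \<rho>1 r1 r2)"
    and "odd N \<Longrightarrow> r1 = (real N + 2) / 2 + \<rho>1 \<or> r1 = (real N + 1) / 2 - r2 \<Longrightarrow>
          cbi_explicit_orthogonality \<rho>1 \<rho>2 r1 r2 N
            (\<lambda>k. (-1) ^ k * (r1 - real k / 2 - 1/4) - 1/4)
            (\<lambda>k. bi_weight_denom k (- r1) (- r2) (- \<rho>1) (- \<rho>2))
            (\<lambda>k. bi_weight k (- r1) (- r2) (- \<rho>1) (- \<rho>2))"
    and "odd N \<Longrightarrow> r2 = (real N + 2) / 2 + \<rho>1 \<Longrightarrow>
          cbi_explicit_orthogonality \<rho>1 \<rho>2 r1 r2 N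
            (\<lambda>k. (-1) ^ k * (r2 - real k / 2 - 1/4) - 1/4)
            (\<lambda>k. bi_weight_denom k (- r2) (- r1) (- \<rho>1) (- \<rho>2))
            (\<lambda>k. bi_weight k (- r2) (- r1) (- \<rho>1) (- \<rho>2))"
proof -
  note rec = positive_recurrence_CBI[OF reg pos]
  show "cbi_explicit_orthogonality \<rho>1 \<rho>2 r1 r2 N
            (\<lambda>k. (-1) ^ k * (\<rho>2 + real k / 2 + 1/4) - 1/4)
            (\<lambda>k. bi_weight_denom k \<rho>2 \<rho>1 r1 r2) (\<lambda>k. bi_weight k \<rho>2 \<rho>1 r1 r2)"
    if "even N" "r1 = (real N + 1) / 2 + \<rho>2 \<or> r2 = (real N + 1) / 2 + \<rho>2 \<or>
                   \<rho>1 = - ((real N + 2) / 2) - \<rho>2"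
  proof -
    from that(1) obtain n where N: "N = 2 * n" by (elim evenE)
    show ?thesis
      unfolding N by (rule cbi_explicit_even[OF rec[unfolded N] reg[unfolded N]]) (use that(2) in \<open>simp add: N\<close>)
  qed
  show "cbi_explicit_orthogonality \<rho>1 \<rho>2 r1 r2 N
            (\<lambda>k. (-1) ^ k * (r1 - real k / 2 - 1/4) - 1/4)
            (\<lambda>k. bi_weight_denom k (- r1) (- r2) (- \<rho>1) (- \<rho>2))
            (\<lambda>k. bi_weight k (- r1) (- r2) (- \<rho>1) (- \<rho>2))"
    if "odd N" "r1 = (real N + 2) / 2 + \<rho>1 \<or> r1 = (real N + 1) / 2 - r2"
  proof -
    from that(1) obtain M where N: "N = 2 * M + 1" by (elim oddE)
    show ?thesis
      unfolding N
    proof (rule cbi_explicit_odd[OF rec[unfolded N]])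
      show "bi_regular \<rho>1 \<rho>2 r1 r2 (2 * M + 3)" using reg by (simp add: N numeral_3_eq_3)
      show "r1 = (2 * real M + 3) / 2 + \<rho>1 \<or> r1 = real M + 1 - r2"
        using that(2) by (auto simp: N field_simps)
    qed
  qed
  show "cbi_explicit_orthogonality \<rho>1 \<rho>2 r1 r2 N
            (\<lambda>k. (-1) ^ k * (r2 - real k / 2 - 1/4) - 1/4)
            (\<lambda>k. bi_weight_denom k (- r2) (- r1) (- \<rho>1) (- \<rho>2))
            (\<lambda>k. bi_weight k (- r2) (- r1) (- \<rho>1) (- \<rho>2))"
    if "odd N" "r2 = (real N + 2) / 2 + \<rho>1"
  proof -
    from that(1) obtain M where N: "N = 2 * M + 1" by (elim oddE)
    show ?thesis
      unfolding cbi_explicit_swap_r[of \<rho>1 \<rho>2 r2 r1, symmetric] N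
    proof (rule cbi_explicit_odd)
      show "positive_recurrence (CBI \<rho>1 \<rho>2 r2 r1) (\<lambda>n. (-1) ^ n * \<rho>2) (cbi_tau \<rho>1 \<rho>2 r1 r2) (2 * M + 1)"
        unfolding CBI_swap_r[of \<rho>1 \<rho>2 r2 r1] using rec by (simp add: N)
      show "bi_regular \<rho>1 \<rho>2 r2 r1 (2 * M + 3)"
        unfolding bi_regular_swap_r[of \<rho>1 \<rho>2 r2 r1] using reg by (simp add: N numeral_3_eq_3)
      show "r2 = (2 * real M + 3) / 2 + \<rho>1 \<or> r2 = real M + 1 - r1"
        using that(2) by (simp add: N field_simps)
    qed
  qed
qed

theorem proposition1:
  fixes \<rho>1 \<rho>2 r1 r2 :: "'a::{real_normed_field,banach}"
  shows
   "(\<forall>n. bi_regular \<rho>1 \<rho>2 r1 r2 (n + 1) \<and> poly (BI \<rho>1 \<rho>2 r1 r2 n) \<rho>1 \<noteq> 0 \<longrightarrow>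
      (\<forall>x. x \<noteq> \<rho>1 \<longrightarrow>
        poly (CBI \<rho>1 \<rho>2 r1 r2 n) x =
          inverse (x - \<rho>1) *
            (poly (BI \<rho>1 \<rho>2 r1 r2 (n + 1)) x
             - poly (BI \<rho>1 \<rho>2 r1 r2 (n + 1)) \<rho>1 / poly (BI \<rho>1 \<rho>2 r1 r2 n) \<rho>1
                 * poly (BI \<rho>1 \<rho>2 r1 r2 n) x)))
    \<and>
    (\<forall>n. bi_regular \<rho>1 \<rho>2 r1 r2 (n + 2) \<longrightarrow>
      CBI \<rho>1 \<rho>2 r1 r2 (n + 1) + smult ((-1) ^ n * \<rho>2) (CBI \<rho>1 \<rho>2 r1 r2 n)
        + smult (cbi_tau \<rho>1 \<rho>2 r1 r2 n) (if n = 0 then 0 else CBI \<rho>1 \<rho>2 r1 r2 (n - 1))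
      = [:0, 1:] * CBI \<rho>1 \<rho>2 r1 r2 n)
    \<and>
    (\<forall>n. bi_regular \<rho>1 \<rho>2 r1 r2 (2*n + 1) \<and>
         (\<forall>j<n. \<rho>1 + \<rho>2 + 1 + of_nat j \<noteq> 0 \<and> \<rho>2 - r1 + 1/2 + of_nat j \<noteq> 0 \<and>
                \<rho>2 - r2 + 1/2 + of_nat j \<noteq> 0) \<longrightarrow>
      (\<exists>R. (\<forall>x. poly (CBI \<rho>1 \<rho>2 r1 r2 (2*n)) x = poly R (x\<^sup>2)) \<and>
           (\<forall>x. poly R (x\<^sup>2) = cbi_eta \<rho>1 \<rho>2 r1 r2 n *
              hypergeo [- of_nat n, of_nat n + bi_g \<rho>1 \<rho>2 r1 r2 + 1, \<rho>2 + x, \<rho>2 - x]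
                       [\<rho>1 + \<rho>2 + 1, \<rho>2 - r1 + 1/2, \<rho>2 - r2 + 1/2] 1)))
    \<and>
    (\<forall>n. bi_regular \<rho>1 \<rho>2 r1 r2 (2*n + 2) \<and>
         (\<forall>j<n. \<rho>1 + \<rho>2 + 2 + of_nat j \<noteq> 0 \<and> \<rho>2 - r1 + 3/2 + of_nat j \<noteq> 0 \<and>
                \<rho>2 - r2 + 3/2 + of_nat j \<noteq> 0) \<longrightarrow>
      (\<exists>Q. (\<forall>x. poly (CBI \<rho>1 \<rho>2 r1 r2 (2*n + 1)) x = (x - \<rho>2) * poly Q (x\<^sup>2)) \<and>
           (\<forall>x. poly Q (x\<^sup>2) = cbi_iota \<rho>1 \<rho>2 r1 r2 n *
              hypergeo [- of_nat n, of_nat n + bi_g \<rho>1 \<rho>2 r1 r2 + 2, \<rho>2 + 1 + x, \<rho>2 + 1 - x]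
                       [\<rho>1 + \<rho>2 + 2, \<rho>2 - r1 + 3/2, \<rho>2 - r2 + 3/2] 1)))
    \<and>
    (\<forall>(\<rho>1::real) (\<rho>2::real) (r1::real) (r2::real) (N::nat).
      bi_regular \<rho>1 \<rho>2 r1 r2 (N + 2) \<and>
      cbi_tau \<rho>1 \<rho>2 r1 r2 (N + 1) = 0 \<and> (\<forall>n\<in>{1..N}. cbi_tau \<rho>1 \<rho>2 r1 r2 n > 0) \<longrightarrow>
        (\<exists>x w h. simple_root_grid (CBI \<rho>1 \<rho>2 r1 r2 (N + 1)) N x \<and>
                 (\<forall>k\<le>N. w k > 0) \<and> (\<forall>n\<le>N. h n > 0) \<and>
                 discrete_orthogonal (CBI \<rho>1 \<rho>2 r1 r2) N x w h)
        \<and>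
        (even N \<and> (r1 = (real N + 1) / 2 + \<rho>2 \<or> r2 = (real N + 1) / 2 + \<rho>2 \<or>
                   \<rho>1 = - ((real N + 2) / 2) - \<rho>2) \<longrightarrow>
          cbi_explicit_orthogonality \<rho>1 \<rho>2 r1 r2 N
            (\<lambda>k. (-1) ^ k * (\<rho>2 + real k / 2 + 1/4) - 1/4)
            (\<lambda>k. bi_weight_denom k \<rho>2 \<rho>1 r1 r2)
            (\<lambda>k. bi_weight k \<rho>2 \<rho>1 r1 r2))
        \<and>
        (odd N \<and> (r1 = (real N + 2) / 2 + \<rho>1 \<or> r1 = (real N + 1) / 2 - r2) \<longrightarrow>
          cbi_explicit_orthogonality \<rho>1 \<rho>2 r1 r2 N
            (\<lambda>k. (-1) ^ k * (r1 - real k / 2 - 1/4) - 1/4)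
            (\<lambda>k. bi_weight_denom k (- r1) (- r2) (- \<rho>1) (- \<rho>2))
            (\<lambda>k. bi_weight k (- r1) (- r2) (- \<rho>1) (- \<rho>2)))
        \<and>
        (odd N \<and> r2 = (real N + 2) / 2 + \<rho>1 \<longrightarrow>
          cbi_explicit_orthogonality \<rho>1 \<rho>2 r1 r2 N
            (\<lambda>k. (-1) ^ k * (r2 - real k / 2 - 1/4) - 1/4)
            (\<lambda>k. bi_weight_denom k (- r2) (- r1) (- \<rho>1) (- \<rho>2))
            (\<lambda>k. bi_weight k (- r2) (- r1) (- \<rho>1) (- \<rho>2))))"
proof (intro conjI allI impI, goal_cases)
  case (1 n x)
  then show ?case by (intro CBI_kernel_polynomial) auto
next
  case (2 n)
  then show ?case by (intro CBI_three_term bi_regular_mono[of _ _ _ _ "n + 2" "n + 1"]) auto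
next
  case (3 n)
  then show ?case by (intro CBI_even_hypergeo bi_regular_mono[of _ _ _ _ "2 * n + 1" "2 * n"]) auto
next
  case (4 n)
  then show ?case by (intro CBI_odd_hypergeo bi_regular_mono[of _ _ _ _ "2 * n + 2" "2 * n + 1"]) auto
next
  case (5 \<rho>1 \<rho>2 r1 r2 N)
  then show ?case by (intro CBI_finite_orthogonality) auto
next
  case (6 \<rho>1 \<rho>2 r1 r2 N)
  then show ?case by (intro CBI_explicit_orthogonality(1)) auto
next
  case (7 \<rho>1 \<rho>2 r1 r2 N)
  then show ?case by (intro CBI_explicit_orthogonality(2)) auto
next
  case (8 \<rho>1 \<rho>2 r1 r2 N)
  then show ?case by (intro CBI_explicit_orthogonality(3)) auto
qed

end
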